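(* Assume $A=A_s$ (i.e. $A=A'$). Let $Y^\delta\times H^\delta\times X^\delta\subset Y\times H\times X$ be closed subspaces with $X^\delta\subseteq Y^\delta$ and $\operatorname{ran}\gamma_0|_{X^\delta}\subseteq H^\delta$. Let $g\in Y'$ and $u_0\in H$. Then the Galerkin discretization of the saddle point system $$\begin{bmatrix} A_s & 0 & B \\ 0 & \mathrm{Id} & \gamma_0 \\ B' & \gamma_0' & 0 \end{bmatrix} \begin{bmatrix} \mu \\ \sigma \\ u \end{bmatrix} = \begin{bmatrix} g \\ u_0 \\ 0 \end{bmatrix},$$ i.e. the problem of finding $(\mu^\delta,\sigma^\delta,u^\delta)\in Y^\delta\times H^\delta\times X^\delta$ such that for all $(v_1,v_2,w)\in Y^\delta\times H^\delta\times X^\delta$, $$(A_s\mu^\delta)(v_1)+(Bu^\delta)(v_1)=g(v_1),\qquad\langle\sigma^\delta,v_2\rangle+\langle u^\delta(0),v_2\rangle=\langle u_0,v_2\rangle,\qquad(Bw)(\mu^\delta)+\langle w(0),\sigma^\delta\rangle=0,$$ has a unique solution, and with $u\in X$ denoting the solution of $$(Bu)(v_1)+\langle u(0),v_2\rangle=g(v_1)+\langle u_0,v_2\rangle\qquad((v_1,v_2)\in Y\times H),$$ it holds that $$\|u-u^\delta\|_{X,Y^\delta}\le2\inf_{\bar u^\delta\in X^\delta}\|u-\bar u^\delta\|_X .$$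
   Context: All spaces are real. Let $V,H$ be separable Hilbert spaces (of functions on some spatial domain) with $V\hookrightarrow H$ densely and compactly; identify $H$ with its dual, giving the Gelfand triple $V\hookrightarrow H\simeq H'\hookrightarrow V'$. $\langle\cdot,\cdot\rangle$ denotes the scalar product on $H$ and also its continuous extension to the duality pairing on $V'\times V$; $\|\cdot\|$ is the norm on $H$. Let $T>0$ and $I:=(0,T)$. For a.e. $t\in I$, $a(t;\cdot,\cdot)$ is a bilinear form on $V\times V$ such that $t\mapsto a(t;\eta,\zeta)$ is measurable for all $\eta,\zeta\in V$, and, with constants independent of $t$, $|a(t;\eta,\zeta)|\lesssim\|\eta\|_V\|\zeta\|_V$ and $a(t;\eta,\eta)\gtrsim\|\eta\|_V^2$ for all $\eta,\zeta\in V$ and a.e. $t\in I$. Set $Y:=L_2(I;V)$ and $X:=L_2(I;V)\cap H^1(I;V')$. One has $X\hookrightarrow C(\bar I;H)$, and for $t\in\bar I$, $\gamma_t\colon X\to H$, $\gamma_tu:=u(t)=u(t,\cdot)$, is the bounded trace map. Define $A\colon Y\to Y'$, $(Au)(v):=\int_I a(t;u(t),v(t))\,dt$; $B\colon X\to Y'$, $(Bw)(v):=\int_I\langle\frac{dw}{dt}(t),v(t)\rangle+a(t;w(t),v(t))\,dt$; $A_s:=\frac12(A+A')$; and $\partial_t:=B-A\colon X\to Y'$, so $(\partial_tw)(v)=\int_I\langle\frac{dw}{dt}(t),v(t)\rangle\,dt$. Primes on operators denote dual operators. It is known that $\begin{bmatrix} B \\ \gamma_0 \end{bmatrix}\colon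 X\to Y'\times H$ is bounded and boundedly invertible. $Y$ and $X$ are equipped with the energy norms $\|v\|_Y^2:=(A_sv)(v)$ and $\|u\|_X^2:=\|u\|_Y^2+\|\partial_tu\|_{Y'}^2+\|u(T)\|^2$ (equivalent to the standard norms), where $\|\cdot\|_{Y'}$ is dual to $\|\cdot\|_Y$. For a closed subspace $Y^\delta\subseteq Y$, define on $X$ the mesh-dependent norm $$\|u\|_{X,Y^\delta}^2:=\|u\|_Y^2+\sup_{0\neq v\in Y^\delta}\frac{(\partial_tu)(v)^2}{\|v\|_Y^2}+\|u(T)\|^2 .$$
   Formalization: Existence of the Galerkin solution fails for some closed subspaces; it is claimed here only if X^δ is finite-dimensional or ‖·‖_X ≤ C‖·‖_{X,Y^δ} on X^δ for some C. Uniqueness and the estimate (for any solution) hold for all closed subspaces. *)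

theory Defs
  imports "HOL-Analysis.Analysis"
begin

text \<open>
  \<open>V\<close> and \<open>H\<close> are the types \<open>'v\<close> and \<open>'h\<close>; the embedding of \<open>V\<close> into \<open>H\<close> is an explicit map \<open>j\<close>.
  The dual \<open>V'\<close> is \<open>'v \<Rightarrow>\<^sub>L real\<close>, in which \<open>h :: 'h\<close> appears as \<open>\<lambda>v. h \<bullet> j v\<close>.

  Elements of Bochner spaces over \<open>I = (0,T)\<close> are represented by functions on \<open>real\<close>, to be read
  modulo equality almost everywhere on \<open>I\<close>; the norms below are thus seminorms on representatives.
\<close>

definition gelfand_triple ::
  "('v::{real_inner,banach,second_countable_topology}
     \<Rightarrow> 'h::{real_inner,banach,second_countable_topology}) \<Rightarrow> bool"
  where "gelfand_triple j \<longleftrightarrow> bounded_linear j \<and> inj j \<and> closure (range j) = UNIV \<and>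
    (\<forall>S. bounded S \<longrightarrow> compact (closure (j ` S)))"

abbreviation time_measure :: "real \<Rightarrow> real measure"
  where "time_measure T \<equiv> lebesgue_on {0<..<T}"

definition parabolic_form ::
  "real \<Rightarrow> (real \<Rightarrow> 'v::real_normed_vector \<Rightarrow> 'v \<Rightarrow> real) \<Rightarrow> bool"
  where "parabolic_form T a \<longleftrightarrow>
    (AE t in time_measure T. bilinear (a t)) \<and>
    (\<forall>x y. (\<lambda>t. a t x y) \<in> borel_measurable (time_measure T)) \<and>
    (\<exists>C. AE t in time_measure T. \<forall>x y. \<bar>a t x y\<bar> \<le> C * norm x * norm y) \<and>
    (\<exists>c>0. AE t in time_measure T. \<forall>x. a t x x \<ge> c * (norm x)\<^sup>2)"

text \<open>
  Borel measurability is strong measurability when the range space is separable. This is the case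
  for \<open>V\<close>, and also for \<open>V'\<close>, being the dual of a separable Hilbert space.
\<close>

definition bochner_L2 :: "real \<Rightarrow> (real \<Rightarrow> 'b::real_normed_vector) set"
  where "bochner_L2 T = {f \<in> borel_measurable (time_measure T).
    integrable (time_measure T) (\<lambda>t. (norm (f t))\<^sup>2)}"

definition test_functions :: "real \<Rightarrow> (real \<Rightarrow> real) set"
  where "test_functions T = {\<phi>. (\<forall>n t. ((deriv ^^ n) \<phi>) differentiable (at t)) \<and>
    closure {t. \<phi> t \<noteq> 0} \<subseteq> {0<..<T}}"

text \<open>
  The identity \<open>\<integral> \<phi>' u = - \<integral> \<phi> w\<close> of Bochner integrals in \<open>V'\<close>, evaluated at every \<open>v\<close> in \<open>V\<close>.
\<close>

definition weak_derivative ::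
  "real \<Rightarrow> ('v::real_normed_vector \<Rightarrow> 'h::real_inner) \<Rightarrow> (real \<Rightarrow> 'v) \<Rightarrow> (real \<Rightarrow> 'v \<Rightarrow>\<^sub>L real) \<Rightarrow> bool"
  where "weak_derivative T j u w \<longleftrightarrow> (\<forall>\<phi>\<in>test_functions T. \<forall>v.
    (LINT t|time_measure T. deriv \<phi> t * (j (u t) \<bullet> j v)) =
    - (LINT t|time_measure T. \<phi> t * blinfun_apply (w t) v))"

definition space_Y :: "real \<Rightarrow> (real \<Rightarrow> 'v::real_normed_vector) set"
  where "space_Y T = bochner_L2 T"

definition space_X :: "real \<Rightarrow> ('v::real_normed_vector \<Rightarrow> 'h::real_inner) \<Rightarrow> (real \<Rightarrow> 'v) set"
  where "space_X T j = {u \<in> bochner_L2 T. \<exists>w\<in>bochner_L2 T. weak_derivative T j u w}"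

definition time_deriv ::
  "real \<Rightarrow> ('v::real_normed_vector \<Rightarrow> 'h::real_inner) \<Rightarrow> (real \<Rightarrow> 'v) \<Rightarrow> real \<Rightarrow> 'v \<Rightarrow>\<^sub>L real"
  where "time_deriv T j u = (SOME w. w \<in> bochner_L2 T \<and> weak_derivative T j u w)"

text \<open>\<open>u(t)\<close> is the value at \<open>t\<close> of the representative of \<open>u\<close> in \<open>C([0,T];H)\<close>.\<close>

definition time_trace ::
  "real \<Rightarrow> ('v::real_normed_vector \<Rightarrow> 'h::real_inner) \<Rightarrow> (real \<Rightarrow> 'v) \<Rightarrow> real \<Rightarrow> 'h"
  where "time_trace T j u = (SOME c. continuous_on {0..T} c \<and>
    (AE s in time_measure T. c s = j (u s)))"

definition op_A ::
  "real \<Rightarrow> (real \<Rightarrow> 'v::real_normed_vector \<Rightarrow> 'v \<Rightarrow> real) \<Rightarrow> (real \<Rightarrow> 'v) \<Rightarrow> (real \<Rightarrow> 'v) \<Rightarrow> real"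
  where "op_A T a u v = (LINT t|time_measure T. a t (u t) (v t))"

definition op_As ::
  "real \<Rightarrow> (real \<Rightarrow> 'v::real_normed_vector \<Rightarrow> 'v \<Rightarrow> real) \<Rightarrow> (real \<Rightarrow> 'v) \<Rightarrow> (real \<Rightarrow> 'v) \<Rightarrow> real"
  where "op_As T a u v = (op_A T a u v + op_A T a v u) / 2"

definition op_B ::
  "real \<Rightarrow> ('v::real_normed_vector \<Rightarrow> 'h::real_inner) \<Rightarrow> (real \<Rightarrow> 'v \<Rightarrow> 'v \<Rightarrow> real)
    \<Rightarrow> (real \<Rightarrow> 'v) \<Rightarrow> (real \<Rightarrow> 'v) \<Rightarrow> real"
  where "op_B T j a w v =
    (LINT t|time_measure T. blinfun_apply (time_deriv T j w t) (v t) + a t (w t) (v t))"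

definition op_dt ::
  "real \<Rightarrow> ('v::real_normed_vector \<Rightarrow> 'h::real_inner) \<Rightarrow> (real \<Rightarrow> 'v \<Rightarrow> 'v \<Rightarrow> real)
    \<Rightarrow> (real \<Rightarrow> 'v) \<Rightarrow> (real \<Rightarrow> 'v) \<Rightarrow> real"
  where "op_dt T j a w v = op_B T j a w v - op_A T a w v"

definition norm_Y ::
  "real \<Rightarrow> (real \<Rightarrow> 'v::real_normed_vector \<Rightarrow> 'v \<Rightarrow> real) \<Rightarrow> (real \<Rightarrow> 'v) \<Rightarrow> real"
  where "norm_Y T a v = sqrt (op_As T a v v)"

definition dual_Y ::
  "real \<Rightarrow> (real \<Rightarrow> 'v::real_normed_vector \<Rightarrow> 'v \<Rightarrow> real) \<Rightarrow> ((real \<Rightarrow> 'v) \<Rightarrow> real) set"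
  where "dual_Y T a = {g.
    (\<forall>u\<in>space_Y T. \<forall>v\<in>space_Y T. g (\<lambda>t. u t + v t) = g u + g v) \<and>
    (\<forall>c. \<forall>v\<in>space_Y T. g (\<lambda>t. c *\<^sub>R v t) = c * g v) \<and>
    (\<exists>C. \<forall>v\<in>space_Y T. \<bar>g v\<bar> \<le> C * norm_Y T a v)}"

text \<open>
  In both suprema below the vectors of norm zero contribute \<open>0\<close> (division by zero), which leaves
  the supremum over nonzero vectors unchanged and gives \<open>0\<close> when there are none.
\<close>

definition dual_norm_Y ::
  "real \<Rightarrow> (real \<Rightarrow> 'v::real_normed_vector \<Rightarrow> 'v \<Rightarrow> real) \<Rightarrow> ((real \<Rightarrow> 'v) \<Rightarrow> real) \<Rightarrow> real"
  where "dual_norm_Y T a f = (SUP v\<in>space_Y T. \<bar>f v\<bar> / norm_Y T a v)"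

definition norm_X ::
  "real \<Rightarrow> ('v::real_normed_vector \<Rightarrow> 'h::real_inner) \<Rightarrow> (real \<Rightarrow> 'v \<Rightarrow> 'v \<Rightarrow> real)
    \<Rightarrow> (real \<Rightarrow> 'v) \<Rightarrow> real"
  where "norm_X T j a u = sqrt ((norm_Y T a u)\<^sup>2 + (dual_norm_Y T a (op_dt T j a u))\<^sup>2
    + (norm (time_trace T j u T))\<^sup>2)"

definition mesh_norm ::
  "real \<Rightarrow> ('v::real_normed_vector \<Rightarrow> 'h::real_inner) \<Rightarrow> (real \<Rightarrow> 'v \<Rightarrow> 'v \<Rightarrow> real)
    \<Rightarrow> (real \<Rightarrow> 'v) set \<Rightarrow> (real \<Rightarrow> 'v) \<Rightarrow> real"
  where "mesh_norm T j a Yd u = sqrt ((norm_Y T a u)\<^sup>2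
    + (SUP v\<in>Yd. (op_dt T j a u v)\<^sup>2 / (norm_Y T a v)\<^sup>2)
    + (norm (time_trace T j u T))\<^sup>2)"

text \<open>
  The last condition also makes \<open>W\<close> closed under changing a function on a null set, so that \<open>W\<close>
  corresponds to a set of equivalence classes.
\<close>

definition closed_subspace_of ::
  "(real \<Rightarrow> 'v::real_normed_vector) set \<Rightarrow> ((real \<Rightarrow> 'v) \<Rightarrow> real) \<Rightarrow> (real \<Rightarrow> 'v) set \<Rightarrow> bool"
  where "closed_subspace_of S N W \<longleftrightarrow> W \<subseteq> S \<and> (\<lambda>t. 0) \<in> W \<and>
    (\<forall>u\<in>W. \<forall>v\<in>W. (\<lambda>t. u t + v t) \<in> W) \<and>
    (\<forall>c. \<forall>u\<in>W. (\<lambda>t. c *\<^sub>R u t) \<in> W) \<and>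
    (\<forall>w u. (\<forall>n::nat. w n \<in> W) \<and> u \<in> S \<and> (\<lambda>n. N (\<lambda>t. w n t - u t)) \<longlonglongrightarrow> 0 \<longrightarrow> u \<in> W)"

text \<open>
  Solvability of the Galerkin system needs completeness of \<open>Xd\<close> in the mesh-dependent norm, which
  holds in finite dimension but not for every closed \<open>Xd\<close>. With \<open>V = H = \<real>\<close>, \<open>T = 1\<close>, \<open>a t x y = x * y\<close>,
  \<open>Hd = {0}\<close>, let \<open>Xd\<close> and \<open>Yd\<close> be the closed spans of the functions \<open>sin (2 * pi * k * t)\<close>, \<open>k \<ge> 1\<close>,
  in \<open>X\<close> and in \<open>Y\<close>. Derivatives of members of \<open>Xd\<close> are orthogonal to \<open>Yd\<close>, so a solution has
  \<open>\<mu> = 0\<close> and \<open>u\<close> equal to the projection of \<open>g\<close> onto \<open>Yd\<close>, which need not lie in \<open>Xd\<close>.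
\<close>

definition finite_dim_ae :: "real \<Rightarrow> (real \<Rightarrow> 'v::real_normed_vector) set \<Rightarrow> bool"
  where "finite_dim_ae T W \<longleftrightarrow> (\<exists>F. finite F \<and> F \<subseteq> W \<and>
    (\<forall>w\<in>W. \<exists>c. AE t in time_measure T. w t = (\<Sum>f\<in>F. c f *\<^sub>R f t)))"

definition parabolic_solution ::
  "real \<Rightarrow> ('v::real_normed_vector \<Rightarrow> 'h::real_inner) \<Rightarrow> (real \<Rightarrow> 'v \<Rightarrow> 'v \<Rightarrow> real)
    \<Rightarrow> ((real \<Rightarrow> 'v) \<Rightarrow> real) \<Rightarrow> 'h \<Rightarrow> (real \<Rightarrow> 'v) \<Rightarrow> bool"
  where "parabolic_solution T j a g u0 u \<longleftrightarrow> u \<in> space_X T j \<and>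
    (\<forall>v1\<in>space_Y T. \<forall>v2.
      op_B T j a u v1 + time_trace T j u 0 \<bullet> v2 = g v1 + u0 \<bullet> v2)"

definition galerkin_solution ::
  "real \<Rightarrow> ('v::real_normed_vector \<Rightarrow> 'h::real_inner) \<Rightarrow> (real \<Rightarrow> 'v \<Rightarrow> 'v \<Rightarrow> real)
    \<Rightarrow> (real \<Rightarrow> 'v) set \<Rightarrow> 'h set \<Rightarrow> (real \<Rightarrow> 'v) set
    \<Rightarrow> ((real \<Rightarrow> 'v) \<Rightarrow> real) \<Rightarrow> 'h \<Rightarrow> (real \<Rightarrow> 'v) \<Rightarrow> 'h \<Rightarrow> (real \<Rightarrow> 'v) \<Rightarrow> bool"
  where "galerkin_solution T j a Yd Hd Xd g u0 \<mu> \<sigma> u \<longleftrightarrow> \<mu> \<in> Yd \<and> \<sigma> \<in> Hd \<and> u \<in> Xd \<and>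
    (\<forall>v1\<in>Yd. \<forall>v2\<in>Hd. \<forall>w\<in>Xd.
      op_As T a \<mu> v1 + op_B T j a u v1 = g v1 \<and>
      \<sigma> \<bullet> v2 + time_trace T j u 0 \<bullet> v2 = u0 \<bullet> v2 \<and>
      op_B T j a w \<mu> + time_trace T j w 0 \<bullet> \<sigma> = 0)"

end

theory Submission
  imports Defs "HOL-Library.Function_Algebras"
begin

text \<open>
  For \<open>w\<close> in \<open>X\<close> let \<open>R w\<close> in \<open>Yd\<close> be the Riesz representer, in the energy inner product \<open>A\<close> of \<open>Y\<close>,
  of the functional \<open>(B w)(\<cdot>)\<close> restricted to \<open>Yd\<close>.  Eliminating \<open>\<mu>\<close> and \<open>\<sigma>\<close> from the Galerkin
  system leaves the equation \<open>E(w, ud) = (B w)(r) + \<langle>w(0), u0\<rangle>\<close> for all \<open>w\<close> in \<open>Xd\<close>, where \<open>r\<close>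
  represents \<open>g\<close> on \<open>Yd\<close> and \<open>E(w, w') = A(R w, R w') + \<langle>w(0), w'(0)\<rangle>\<close>.  For the exact solution
  \<open>u\<close> the same right-hand side equals \<open>E(w, u)\<close>, so that \<open>ud\<close> is the best approximation of \<open>u\<close> from
  \<open>Xd\<close> in the seminorm of \<open>E\<close>.

  Two facts make this seminorm comparable with the energy norms.  Since \<open>A\<close> is symmetric,
  expanding the square and using \<open>2 (\<partial>\<^sub>t w)(w) = |w(T)|\<^sup>2 - |w(0)|\<^sup>2\<close> gives
  \<open>E(w, w) = \<parallel>w\<parallel>\<^sup>2\<close> in the mesh-dependent norm for \<open>w\<close> in \<open>Xd\<close>, because then \<open>w\<close> lies in \<open>Yd\<close>
  (\<open>residual_eq_mesh\<close>); and the same computation with \<open>Y\<close> in place of \<open>Yd\<close> gives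
  \<open>E(w, w) \<le> \<parallel>w\<parallel>\<^sub>X\<^sup>2\<close> for every \<open>w\<close> in \<open>X\<close> (\<open>residual_le_norm_X\<close>).  The triangle inequality
  for \<open>u - ub\<close> and \<open>ub - ud\<close> then yields the factor 2.  Uniqueness holds because \<open>E\<close> dominates the \<open>Y\<close>
  norm on \<open>Xd\<close>; existence is the Riesz representation theorem for \<open>E\<close> on \<open>Xd\<close>, which is complete
  for \<open>E\<close> when the mesh-dependent norm bounds the norm of \<open>X\<close>; when \<open>Xd\<close> is finite dimensional,
  Gram-Schmidt orthogonalisation takes the place of completeness.

  The analytic core is the trace theorem: elements of \<open>X\<close> have continuous representatives with
  values in \<open>H\<close> and satisfy the energy identity above.  Write \<open>K : V \<rightarrow> V\<close> for the operator with
  \<open>K x \<bullet> y = j x \<bullet> j y\<close>, and represent elements of \<open>V'\<close> by elements of \<open>V\<close>; then \<open>u\<close> is in \<open>X\<close> with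
  derivative \<open>z\<close> iff \<open>(K u)' = z\<close> weakly.  For continuously differentiable functions everything is
  the fundamental theorem of calculus, and the general case follows by density.  Density is proved by
  orthogonality.  If \<open>u\<close> is orthogonal to all continuously differentiable functions for the graph
  inner product and \<open>w\<close> is its derivative, then testing shows \<open>K w = U\<close>, where \<open>U\<close> is the primitive of
  \<open>u\<close>, with \<open>U(0) = U(T) = 0\<close>.  Integrating by parts, legitimate since \<open>K (K u)\<close> is a constant plus
  a primitive of \<open>U\<close>, gives \<open>\<integral> |K u|\<^sup>2 = \<integral> u \<bullet> K (K u) = - \<integral> |U|\<^sup>2\<close>, hence \<open>K u = 0\<close> and \<open>u = 0\<close>
  (\<open>graph_orthogonal_null\<close>).
\<close>

section \<open>Functions as vectors\<close>

text \<open>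
  With pointwise operations the functions on an arbitrary type form a real vector space, so that sets
  of representatives such as \<open>X\<close> and \<open>Y\<close> are subspaces in the sense of the library.
\<close>

instantiation "fun" :: (type, scaleR) scaleR
begin
definition scaleR_fun_def: "c *\<^sub>R f = (\<lambda>x. c *\<^sub>R f x)"
instance ..
end

instance "fun" :: (type, real_vector) real_vector
  by standard (auto simp: scaleR_fun_def fun_eq_iff scaleR_add_right scaleR_add_left)

lemma scaleR_fun_apply [simp]: "(c *\<^sub>R f) x = c *\<^sub>R f x"
  by (simp add: scaleR_fun_def)

lemma sum_fun_apply: "(sum f A) x = (\<Sum>i\<in>A. f i x)"
  for f :: "'i \<Rightarrow> 'a \<Rightarrow> 'b::comm_monoid_add"
  by (induction A rule: infinite_finite_induct) auto

section \<open>Positive semidefinite forms and Riesz representation\<close>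

text \<open>
  A symmetric positive semidefinite bilinear form on a subspace.  Null vectors are allowed, since
  functions that vanish almost everywhere are null vectors without being zero.
\<close>

locale psd_form =
  fixes S :: "'a::real_vector set" and b :: "'a \<Rightarrow> 'a \<Rightarrow> real"
  assumes sub: "subspace S"
    and sym: "\<lbrakk>x \<in> S; y \<in> S\<rbrakk> \<Longrightarrow> b x y = b y x"
    and add_left: "\<lbrakk>x \<in> S; y \<in> S; z \<in> S\<rbrakk> \<Longrightarrow> b (x + y) z = b x z + b y z"
    and scale_left: "\<lbrakk>x \<in> S; z \<in> S\<rbrakk> \<Longrightarrow> b (c *\<^sub>R x) z = c * b x z"
    and nonneg: "x \<in> S \<Longrightarrow> 0 \<le> b x x"
begin

lemma mem [simp, intro]:
  "0 \<in> S" "\<lbrakk>x \<in> S; y \<in> S\<rbrakk> \<Longrightarrow> x + y \<in> S" "\<lbrakk>x \<in> S; y \<in> S\<rbrakk> \<Longrightarrow> x - y \<in> S"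
  "x \<in> S \<Longrightarrow> c *\<^sub>R x \<in> S"
  using sub by (auto simp: subspace_0 subspace_add subspace_diff subspace_scale)

lemma add_right: "\<lbrakk>x \<in> S; y \<in> S; z \<in> S\<rbrakk> \<Longrightarrow> b z (x + y) = b z x + b z y"
  by (metis add_left mem(2) sym)

lemma scale_right: "\<lbrakk>x \<in> S; z \<in> S\<rbrakk> \<Longrightarrow> b z (c *\<^sub>R x) = c * b z x"
  by (metis scale_left mem(4) sym)

lemma diff_left: "\<lbrakk>x \<in> S; y \<in> S; z \<in> S\<rbrakk> \<Longrightarrow> b (x - y) z = b x z - b y z"
  using add_left[of x "(-1) *\<^sub>R y" z] scale_left[of y z "-1"] mem(4)[of y "-1"] by simp

lemma diff_right: "\<lbrakk>x \<in> S; y \<in> S; z \<in> S\<rbrakk> \<Longrightarrow> b z (x - y) = b z x - b z y"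
  by (metis diff_left mem(3) sym)

lemmas bilin = add_left add_right scale_left scale_right diff_left diff_right

lemma zero_left [simp]: "x \<in> S \<Longrightarrow> b 0 x = 0"
  using scale_left[of 0 x 0] by simp

lemma zero_right [simp]: "x \<in> S \<Longrightarrow> b x 0 = 0"
  using scale_right[of 0 x 0] by simp

lemma expand_add: "\<lbrakk>x \<in> S; y \<in> S\<rbrakk> \<Longrightarrow> b (x + y) (x + y) = b x x + 2 * b x y + b y y"
  by (simp add: add_left add_right sym[of y x])

lemma expand_diff: "\<lbrakk>x \<in> S; y \<in> S\<rbrakk> \<Longrightarrow> b (x - y) (x - y) = b x x - 2 * b x y + b y y"
  by (simp add: diff_left diff_right sym[of y x])

lemma cauchy_schwarz_sq:
  assumes "x \<in> S" "y \<in> S" shows "(b x y)\<^sup>2 \<le> b x x * b y y"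
proof -
  have q: "0 \<le> b y y + 2 * t * b x y + t\<^sup>2 * b x x" for t
  proof -
    have "b (t *\<^sub>R x + y) (t *\<^sub>R x + y) = t\<^sup>2 * b x x + 2 * t * b x y + b y y"
      using assms by (simp add: expand_add scale_left scale_right power2_eq_square)
    then show ?thesis using nonneg[of "t *\<^sub>R x + y"] assms by simp
  qed
  show ?thesis
  proof (cases "b x x = 0")
    case True
    have "b x y = 0"
    proof (rule ccontr)
      assume ne: "b x y \<noteq> 0"
      show False using q[of "- (b y y + 1) / (2 * b x y)"] True ne by (simp add: field_simps)
    qed
    then show ?thesis using True by simp
  next
    case False
    then have pos: "b x x > 0" using nonneg[OF assms(1)] by simp
    have "0 \<le> b y y - (b x y)\<^sup>2 / b x x"
      using q[of "- b x y / b x x"] pos by (simp add: field_simps power2_eq_square)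
    then show ?thesis using pos by (simp add: field_simps)
  qed
qed

definition nrm :: "'a \<Rightarrow> real" where "nrm x = sqrt (b x x)"

lemma nrm_nonneg [simp]: "x \<in> S \<Longrightarrow> 0 \<le> nrm x"
  by (simp add: nrm_def nonneg)

lemma nrm_sq: "x \<in> S \<Longrightarrow> (nrm x)\<^sup>2 = b x x"
  by (simp add: nrm_def nonneg)

lemma cauchy_schwarz:
  assumes "x \<in> S" "y \<in> S" shows "\<bar>b x y\<bar> \<le> nrm x * nrm y"
  using real_sqrt_le_mono[OF cauchy_schwarz_sq[OF assms]] by (simp add: real_sqrt_mult nrm_def)

lemma null_left: "\<lbrakk>x \<in> S; y \<in> S; b x x = 0\<rbrakk> \<Longrightarrow> b x y = 0"
  using cauchy_schwarz_sq[of x y] by simp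

lemma null_right: "\<lbrakk>x \<in> S; y \<in> S; b x x = 0\<rbrakk> \<Longrightarrow> b y x = 0"
  using null_left sym by metis

lemma triangle:
  assumes "x \<in> S" "y \<in> S" shows "nrm (x + y) \<le> nrm x + nrm y"
proof (rule power2_le_imp_le)
  have "(nrm (x + y))\<^sup>2 = b x x + 2 * b x y + b y y"
    using assms by (simp add: nrm_sq expand_add)
  also have "\<dots> \<le> (nrm x)\<^sup>2 + 2 * (nrm x * nrm y) + (nrm y)\<^sup>2"
    using cauchy_schwarz[OF assms] assms by (simp add: nrm_sq)
  finally show "(nrm (x + y))\<^sup>2 \<le> (nrm x + nrm y)\<^sup>2"
    by (simp add: power2_eq_square algebra_simps)
qed (use assms in simp)

lemma nrm_minus: assumes "x \<in> S" "y \<in> S" shows "nrm (x - y) = nrm (y - x)"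
  using assms by (simp add: nrm_def expand_diff sym[of y x])

lemma triangle_sub: "\<lbrakk>x \<in> S; y \<in> S; z \<in> S\<rbrakk> \<Longrightarrow> nrm (x - z) \<le> nrm (x - y) + nrm (y - z)"
  using triangle[of "x - y" "y - z"] by simp

lemma restrict: "subspace S' \<Longrightarrow> S' \<subseteq> S \<Longrightarrow> psd_form S' b"
  by unfold_locales (auto simp: add_left scale_left nonneg subset_iff intro: sym)

text \<open>
  If \<open>b p p = b r p\<close>, as for the projection \<open>p\<close> of \<open>r\<close> onto a subspace, then \<open>p\<close> is no longer than \<open>r\<close>.
\<close>

lemma le_if_projection:
  assumes "p \<in> S" "r \<in> S" "b p p = b r p" shows "b p p \<le> b r r"
proof (cases "b p p = 0")
  case False
  have "b p p * b p p \<le> b r r * b p p"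
    using cauchy_schwarz_sq[OF assms(2,1)] assms(3) by (simp add: power2_eq_square)
  then show ?thesis using False nonneg[OF assms(1)] by (simp add: mult_le_cancel_right)
qed (use nonneg[OF assms(2)] in simp)

lemma form_tendsto:
  assumes X: "\<And>n. X n \<in> S" "x \<in> S" "(\<lambda>n. nrm (X n - x)) \<longlonglongrightarrow> 0"
    and Y: "\<And>n. Y n \<in> S" "y \<in> S" "(\<lambda>n. nrm (Y n - y)) \<longlonglongrightarrow> 0"
  shows "(\<lambda>n. b (X n) (Y n)) \<longlonglongrightarrow> b x y"
proof (rule Lim_null_comparison[THEN LIM_zero_cancel])
  have "\<bar>b (X n) (Y n) - b x y\<bar> \<le> nrm (X n - x) * nrm (Y n - y) + nrm (X n - x) * nrm y + nrm x * nrm (Y n - y)" for n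
  proof -
    have "b (X n) (Y n) - b x y = b (X n - x) (Y n - y) + b (X n - x) y + b x (Y n - y)"
      using X Y by (simp add: diff_left diff_right)
    moreover have "\<bar>b (X n - x) (Y n - y)\<bar> \<le> nrm (X n - x) * nrm (Y n - y)"
      "\<bar>b (X n - x) y\<bar> \<le> nrm (X n - x) * nrm y" "\<bar>b x (Y n - y)\<bar> \<le> nrm x * nrm (Y n - y)"
      using X Y by (auto intro!: cauchy_schwarz)
    ultimately show ?thesis by linarith
  qed
  then show "\<forall>\<^sub>F n in sequentially. norm (b (X n) (Y n) - b x y)
    \<le> nrm (X n - x) * nrm (Y n - y) + nrm (X n - x) * nrm y + nrm x * nrm (Y n - y)"
    by simp
  have "(\<lambda>n. nrm (X n - x) * nrm (Y n - y) + nrm (X n - x) * nrm y + nrm x * nrm (Y n - y))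
    \<longlonglongrightarrow> 0 * 0 + 0 * nrm y + nrm x * 0"
    by (intro tendsto_intros X Y)
  then show "(\<lambda>n. nrm (X n - x) * nrm (Y n - y) + nrm (X n - x) * nrm y + nrm x * nrm (Y n - y)) \<longlonglongrightarrow> 0"
    by simp
qed

lemma nrm_sq_tendsto_0:
  assumes "\<And>n. X n \<in> S" "x \<in> S" "(\<lambda>n. nrm (X n - x)) \<longlonglongrightarrow> 0"
  shows "(\<lambda>n. b (X n - x) (X n - x)) \<longlonglongrightarrow> 0"
proof -
  have "(\<lambda>n. (nrm (X n - x))\<^sup>2) \<longlonglongrightarrow> 0\<^sup>2" by (intro tendsto_power assms)
  then show ?thesis using assms(1,2) by (simp add: nrm_sq)
qed

text \<open>
  The dual norm of a represented functional is the norm of its representer, also in the squared form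
  of the mesh-dependent norm.  The supremum is attained at the representer; null vectors contribute
  \<open>0\<close> because of division by zero.
\<close>
lemma SUP_quotient_sq:
  assumes r: "r \<in> S" and f: "\<And>v. v \<in> S \<Longrightarrow> f v = b r v"
  shows "(SUP v\<in>S. (f v)\<^sup>2 / (nrm v)\<^sup>2) = b r r"
    and "(SUP v\<in>S. \<bar>f v\<bar> / nrm v) = nrm r"
proof -
  have q: "(f v)\<^sup>2 / (nrm v)\<^sup>2 \<le> b r r" if "v \<in> S" for v
  proof (cases "b v v = 0")
    case True then show ?thesis using that nonneg[OF r] by (simp add: nrm_sq)
  next
    case False then show ?thesis
      using cauchy_schwarz_sq[OF r that] nonneg[OF that] by (simp add: nrm_sq[OF that] f[OF that] divide_le_eq)
  qed
  show "(SUP v\<in>S. (f v)\<^sup>2 / (nrm v)\<^sup>2) = b r r"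
  proof (rule cSup_eq_maximum)
    show "b r r \<in> (\<lambda>v. (f v)\<^sup>2 / (nrm v)\<^sup>2) ` S"
      by (rule image_eqI[OF _ r]) (simp add: f r nrm_sq, simp add: power2_eq_square)
  qed (use q in auto)
  have q2: "\<bar>f v\<bar> / nrm v \<le> nrm r" if "v \<in> S" for v
  proof (rule power2_le_imp_le)
    show "(\<bar>f v\<bar> / nrm v)\<^sup>2 \<le> (nrm r)\<^sup>2" using q[OF that] by (simp add: power_divide nrm_sq[OF r])
  qed (use r in simp)
  show "(SUP v\<in>S. \<bar>f v\<bar> / nrm v) = nrm r"
  proof (rule cSup_eq_maximum)
    have "b r r / nrm r = nrm r" using real_div_sqrt[OF nonneg[OF r]] by (simp add: nrm_def)
    then show "nrm r \<in> (\<lambda>v. \<bar>f v\<bar> / nrm v) ` S"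
      by (intro image_eqI[OF _ r]) (simp only: f[OF r] abs_of_nonneg[OF nonneg[OF r]])
  qed (use q2 in auto)
qed

text \<open>
  Riesz representation on the span of a finite set, without completeness: the functional only has to
  vanish on null vectors.
\<close>
lemma riesz_span:
  assumes "finite F" "F \<subseteq> S"
    and "\<And>x y. x \<in> S \<Longrightarrow> y \<in> S \<Longrightarrow> f (x + y) = f x + f y"
    and "\<And>c x. x \<in> S \<Longrightarrow> f (c *\<^sub>R x) = c * f x"
    and "\<And>x. x \<in> S \<Longrightarrow> b x x = 0 \<Longrightarrow> f x = 0"
  shows "\<exists>r\<in>span F. \<forall>x\<in>span F. f x = b r x"
  using assms
proof (induction F arbitrary: f rule: finite_induct)
  case empty
  have "f 0 = 0" using empty(3)[of 0 0] by simp
  then show ?case by simp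
next
  case (insert v F)
  have spS: "span (insert v F) \<subseteq> S" using insert.prems(1) sub by (simp add: span_minimal)
  have sp: "span F \<subseteq> span (insert v F)" by (simp add: span_mono subset_insertI)
  have v: "v \<in> S" using insert.prems by simp
  obtain r where r: "r \<in> span F" "\<And>x. x \<in> span F \<Longrightarrow> f x = b r x"
    using insert.IH[of f] insert.prems by auto
  obtain p where p: "p \<in> span F" "\<And>x. x \<in> span F \<Longrightarrow> b v x = b p x"
  proof -
    have "\<exists>r\<in>span F. \<forall>x\<in>span F. b v x = b r x"
      by (rule insert.IH) (use insert.prems(1) v null_right[OF _ v] in \<open>auto intro: add_right scale_right\<close>)
    then show ?thesis using that by blast
  qed
  \<comment> \<open>the Gram-Schmidt step: the new vector minus its projection onto the old span\<close>
  define q where "q = v - p"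
  have pS: "p \<in> S" and rS: "r \<in> S" using p r sp spS by auto
  have qS: "q \<in> S" using v pS by (simp add: q_def)
  have orth: "b q x = 0" if "x \<in> span F" for x
  proof -
    have "x \<in> S" using that sp spS by auto
    then show ?thesis using p(2)[OF that] v pS by (simp add: q_def diff_left)
  qed
  define c where "c = (if b q q = 0 then 0 else f q / b q q)"
  have fq: "f q = c * b q q" using insert.prems(4)[OF qS] by (auto simp: c_def)
  have qsp: "q \<in> span (insert v F)"
    unfolding q_def using p(1) sp span_base[of v "insert v F"] by (intro span_diff) auto
  show ?case
  proof (intro bexI ballI)
    show "r + c *\<^sub>R q \<in> span (insert v F)" using r(1) sp qsp by (auto intro!: span_add span_scale)
    fix x assume x: "x \<in> span (insert v F)"
    then obtain k where k: "x - k *\<^sub>R v \<in> span F" using span_breakdown_eq by blast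
    define y where "y = x - k *\<^sub>R q"
    have "y = (x - k *\<^sub>R v) + k *\<^sub>R p" by (simp add: y_def q_def algebra_simps)
    then have y: "y \<in> span F" using k p(1) by (simp add: span_add span_scale)
    have yS: "y \<in> S" using y sp spS by auto
    have xe: "x = y + k *\<^sub>R q" by (simp add: y_def)
    have "f x = b r y + k * (c * b q q)"
      unfolding xe using yS qS insert.prems(2,3) r(2)[OF y] fq by simp
    also have "\<dots> = b (r + c *\<^sub>R q) x"
      unfolding xe using yS qS rS orth[OF y] orth[OF r(1)] sym[OF qS rS]
      by (simp add: bilin)
    finally show "f x = b (r + c *\<^sub>R q) x" .
  qed
qed

end

text \<open>
  A Hilbert space up to null vectors: every Cauchy sequence has a limit in the subspace, which is
  unique only modulo null vectors.
\<close>

locale hilbert_form = psd_form +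
  assumes complete: "\<lbrakk>\<And>n::nat. X n \<in> S; \<And>e. e > 0 \<Longrightarrow> \<exists>N. \<forall>m\<ge>N. \<forall>n\<ge>N. nrm (X m - X n) < e\<rbrakk>
    \<Longrightarrow> \<exists>x\<in>S. (\<lambda>n. nrm (X n - x)) \<longlonglongrightarrow> 0"
begin

theorem riesz:
  assumes fadd: "\<And>x y. x \<in> S \<Longrightarrow> y \<in> S \<Longrightarrow> f (x + y) = f x + f y"
    and fscale: "\<And>c x. x \<in> S \<Longrightarrow> f (c *\<^sub>R x) = c * f x"
    and fbd: "\<And>x. x \<in> S \<Longrightarrow> \<bar>f x\<bar> \<le> C * nrm x"
  obtains r where "r \<in> S" "\<And>x. x \<in> S \<Longrightarrow> f x = b r x"
proof -
  \<comment> \<open>the representer is the minimiser of the quadratic functional \<open>J\<close>\<close>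
  define J where "J x = b x x - 2 * f x" for x
  have J_lb: "- C\<^sup>2 \<le> J x" if "x \<in> S" for x
  proof -
    have "0 \<le> (nrm x - C)\<^sup>2" by simp
    then show ?thesis using fbd[OF that] nrm_sq[OF that]
      by (simp add: J_def power2_eq_square algebra_simps)
  qed
  define m where "m = Inf (J ` S)"
  have bdd: "bdd_below (J ` S)" using J_lb by (rule bdd_belowI2)
  have m_le: "m \<le> J x" if "x \<in> S" for x using bdd that by (simp add: m_def cINF_lower)
  have "\<exists>x\<in>S. J x < m + 1 / Suc n" for n
  proof -
    have "Inf (J ` S) < m + 1 / Suc n" by (simp add: m_def)
    then show ?thesis using cInf_lessD[of "J ` S" "m + 1 / Suc n"] mem(1) by blast
  qed
  then obtain X where X: "\<And>n::nat. X n \<in> S" "\<And>n. J (X n) < m + 1 / Suc n" by metis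
  \<comment> \<open>by the parallelogram identity minimising sequences are Cauchy\<close>
  have J_par: "b (x - y) (x - y) \<le> 2 * (J x - m) + 2 * (J y - m)" if "x \<in> S" "y \<in> S" for x y
  proof -
    have "m \<le> J ((1/2) *\<^sub>R (x + y))" using that by (intro m_le) auto
    also have "\<dots> = (b x x + 2 * b x y + b y y) / 4 - (f x + f y)" using that
      by (simp add: J_def scale_left scale_right fadd fscale expand_add field_simps del: scaleR_add_right)
    finally show ?thesis unfolding J_def expand_diff[OF that] by argo
  qed
  have "\<exists>x\<in>S. (\<lambda>n. nrm (X n - x)) \<longlonglongrightarrow> 0"
  proof (rule complete[OF X(1)])
    fix e :: real assume e: "e > 0"
    obtain N :: nat where N: "inverse (real (Suc N)) < e\<^sup>2 / 4"
      using reals_Archimedean[of "e\<^sup>2 / 4"] e by auto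
    have "nrm (X k - X n) < e" if kn: "k \<ge> N" "n \<ge> N" for k n
    proof (rule power2_less_imp_less)
      have i: "1 / real (Suc k) \<le> inverse (real (Suc N))" "1 / real (Suc n) \<le> inverse (real (Suc N))"
        using kn by (auto simp: field_simps)
      have "b (X k - X n) (X k - X n) < e\<^sup>2"
        using J_par[OF X(1)[of k] X(1)[of n]] X(2)[of k] X(2)[of n] i N by argo
      then show "(nrm (X k - X n))\<^sup>2 < e\<^sup>2" using X(1) by (simp add: nrm_sq)
    qed (use e in simp)
    then show "\<exists>N. \<forall>m\<ge>N. \<forall>n\<ge>N. nrm (X m - X n) < e" by blast
  qed
  then obtain r where r: "r \<in> S" "(\<lambda>n. nrm (X n - r)) \<longlonglongrightarrow> 0" by blast
  have Jr: "J r \<le> m"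
  proof (rule LIMSEQ_le_const)
    have "J r \<le> J (X n) + (nrm (X n - r)) * (2 * nrm r + 2 * C)" for n
    proof -
      define d where "d = X n - r"
      have d: "d \<in> S" "X n = r + d" using X(1) r by (auto simp: d_def)
      have "J (X n) = J r + 2 * b r d + b d d - 2 * f d"
        using d r by (simp add: J_def expand_add fadd)
      moreover have "- (nrm r * nrm d) \<le> b r d" using cauchy_schwarz[OF r(1) d(1)] by linarith
      moreover have "f d \<le> C * nrm d" using fbd[OF d(1)] by linarith
      ultimately show ?thesis using nonneg[OF d(1)] unfolding d_def[symmetric]
        by (simp add: algebra_simps)
    qed
    moreover have "J (X n) \<le> m + inverse (real (Suc n))" for n
      using X(2)[of n] by (simp add: field_simps)
    ultimately have "J r \<le> m + inverse (real (Suc n)) + (nrm (X n - r)) * (2 * nrm r + 2 * C)" for n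
      by (meson add_right_mono order_trans)
    then show "\<exists>N. \<forall>n\<ge>N. J r \<le> m + inverse (real (Suc n)) + (nrm (X n - r)) * (2 * nrm r + 2 * C)" by blast
    show "(\<lambda>n. m + inverse (real (Suc n)) + (nrm (X n - r)) * (2 * nrm r + 2 * C)) \<longlonglongrightarrow> m"
      by (rule tendsto_eq_intros LIMSEQ_inverse_real_of_nat r(2) | simp)+
  qed
  have "f x = b r x" if x: "x \<in> S" for x
  proof -
    define k where "k = b r x - f x"
    have q: "0 \<le> 2 * t * k + t\<^sup>2 * b x x" for t
    proof -
      have "J r \<le> J (r + t *\<^sub>R x)" using Jr m_le[of "r + t *\<^sub>R x"] x r by simp
      then show ?thesis using x r
        by (simp add: J_def k_def expand_add fadd fscale scale_left scale_right power2_eq_square algebra_simps)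
    qed
    have "k = 0"
    proof (rule ccontr)
      assume ne: "k \<noteq> 0"
      have p: "b x x + 1 > 0" using nonneg[OF x] by simp
      \<comment> \<open>a step length for which the quadratic polynomial in \<open>q\<close> is negative\<close>
      have "2 * (- k / (b x x + 1)) * k + (- k / (b x x + 1))\<^sup>2 * b x x
          = - (k\<^sup>2 * (b x x + 2)) / (b x x + 1)\<^sup>2"
        using p by (simp add: divide_simps power2_eq_square) (simp add: algebra_simps)
      also have "\<dots> < 0" using p ne nonneg[OF x] by (simp add: divide_neg_pos)
      finally show False using q[of "- k / (b x x + 1)"] by linarith
    qed
    then show ?thesis by (simp add: k_def)
  qed
  with r(1) that show thesis by blast
qed

lemma hilbert_form_equivalent:
  assumes "psd_form S b'" "0 < c" "\<And>x. x \<in> S \<Longrightarrow> c * b x x \<le> b' x x" "\<And>x. x \<in> S \<Longrightarrow> b' x x \<le> C * b x x"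
  shows "hilbert_form S b'"
proof -
  interpret b': psd_form S b' by fact
  have C0: "b' x x \<le> \<bar>C\<bar> * b x x" if "x \<in> S" for x
    using assms(4)[OF that] mult_right_mono[OF abs_ge_self nonneg[OF that], of C] by linarith
  have up: "b'.nrm x \<le> sqrt \<bar>C\<bar> * nrm x" if "x \<in> S" for x
    using real_sqrt_le_mono[OF C0[OF that]] by (simp add: real_sqrt_mult b'.nrm_def nrm_def)
  have lo: "sqrt c * nrm x \<le> b'.nrm x" if "x \<in> S" for x
    using real_sqrt_le_mono[OF assms(3)[OF that]] by (simp add: real_sqrt_mult b'.nrm_def nrm_def)
  show ?thesis
  proof
    fix X :: "nat \<Rightarrow> 'a"
    assume X: "\<And>n. X n \<in> S" and Ca: "\<And>e. e > 0 \<Longrightarrow> \<exists>N. \<forall>m\<ge>N. \<forall>n\<ge>N. b'.nrm (X m - X n) < e"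
    have "\<exists>x\<in>S. (\<lambda>n. nrm (X n - x)) \<longlonglongrightarrow> 0"
    proof (rule complete[OF X])
      fix e :: real assume "e > 0"
      then have "sqrt c * e > 0" using assms(2) by simp
      from Ca[OF this] obtain N where N: "\<And>m n. m \<ge> N \<Longrightarrow> n \<ge> N \<Longrightarrow> b'.nrm (X m - X n) < sqrt c * e" by blast
      have "nrm (X m - X n) < e" if "m \<ge> N" "n \<ge> N" for m n
      proof -
        have "sqrt c * nrm (X m - X n) < sqrt c * e"
          using lo[OF mem(3)[OF X X], of m n] N[OF that] by linarith
        then show ?thesis using assms(2) by simp
      qed
      then show "\<exists>N. \<forall>m\<ge>N. \<forall>n\<ge>N. nrm (X m - X n) < e" by blast
    qed
    then obtain x where x: "x \<in> S" "(\<lambda>n. nrm (X n - x)) \<longlonglongrightarrow> 0" by blast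
    have "(\<lambda>n. b'.nrm (X n - x)) \<longlonglongrightarrow> 0"
    proof (rule real_tendsto_sandwich[OF _ _ tendsto_const])
      show "(\<lambda>n. sqrt \<bar>C\<bar> * nrm (X n - x)) \<longlonglongrightarrow> 0" using tendsto_mult_right_zero[OF x(2)] .
      show "\<forall>\<^sub>F n in sequentially. 0 \<le> b'.nrm (X n - x)"
        by (intro always_eventually allI b'.nrm_nonneg mem X x)
      show "\<forall>\<^sub>F n in sequentially. b'.nrm (X n - x) \<le> sqrt \<bar>C\<bar> * nrm (X n - x)"
        by (intro always_eventually allI up mem X x)
    qed
    with x(1) show "\<exists>x\<in>S. (\<lambda>n. b'.nrm (X n - x)) \<longlonglongrightarrow> 0" by blast
  qed
qed

text \<open>
  The closure of \<open>Z\<close> in \<open>S\<close> for the seminorm of the form.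
\<close>

definition limits_of :: "'a set \<Rightarrow> 'a set" where
  "limits_of Z = {x \<in> S. \<forall>e>0. \<exists>z\<in>Z. nrm (x - z) < e}"

lemma hilbert_form_closed:
  assumes "subspace Z" "Z \<subseteq> S"
    and cl: "\<And>w u. \<lbrakk>\<And>n::nat. w n \<in> Z; u \<in> S; (\<lambda>n. nrm (w n - u)) \<longlonglongrightarrow> 0\<rbrakk> \<Longrightarrow> u \<in> Z"
  shows "hilbert_form Z b"
proof -
  interpret Z: psd_form Z b by (rule restrict) fact+
  show ?thesis
  proof
    fix X :: "nat \<Rightarrow> 'a" assume X: "\<And>n. X n \<in> Z" and
      C: "\<And>e. e > 0 \<Longrightarrow> \<exists>N. \<forall>m\<ge>N. \<forall>n\<ge>N. nrm (X m - X n) < e"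
    have "\<exists>x\<in>S. (\<lambda>n. nrm (X n - x)) \<longlonglongrightarrow> 0"
      using X C assms(2) by (intro complete) auto
    then show "\<exists>x\<in>Z. (\<lambda>n. nrm (X n - x)) \<longlonglongrightarrow> 0" using cl[OF X] by auto
  qed
qed

text \<open>
  A subspace is dense if every vector orthogonal to it is null: the difference between a vector and its
  projection onto the closure of the subspace is such a vector.
\<close>
theorem dense_if_orthogonal_null:
  assumes Z: "subspace Z" "Z \<subseteq> S"
    and orth: "\<And>x. x \<in> S \<Longrightarrow> (\<And>z. z \<in> Z \<Longrightarrow> b x z = 0) \<Longrightarrow> b x x = 0"
    and u: "u \<in> S"
  obtains z where "\<And>n::nat. z n \<in> Z" "(\<lambda>n. nrm (z n - u)) \<longlonglongrightarrow> 0"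
proof -
  define L where "L = limits_of Z"
  have LS: "L \<subseteq> S" by (auto simp: L_def limits_of_def)
  have ZL: "Z \<subseteq> L"
    using Z(2) by (auto simp: L_def limits_of_def nrm_def intro!: bexI)
  have L: "subspace L"
  proof (rule subspaceI)
    show "0 \<in> L" using ZL subspace_0[OF Z(1)] by blast
    fix x y assume xy: "x \<in> L" "y \<in> L"
    show "x + y \<in> L" unfolding L_def limits_of_def
    proof (intro CollectI conjI allI impI)
      show "x + y \<in> S" using xy LS by auto
      fix e :: real assume "e > 0"
      then obtain z w where zw: "z \<in> Z" "w \<in> Z" "nrm (x - z) < e/2" "nrm (y - w) < e/2"
        using xy by (fastforce simp: L_def limits_of_def dest: spec[of _ "e/2"])
      then have "nrm (x + y - (z + w)) < e"
        using triangle[of "x - z" "y - w"] xy LS Z(2) by (auto simp: algebra_simps subset_iff)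
      then show "\<exists>z\<in>Z. nrm (x + y - z) < e" using zw subspace_add[OF Z(1)] by blast
    qed
  next
    fix c x assume x: "x \<in> L"
    show "c *\<^sub>R x \<in> L" unfolding L_def limits_of_def
    proof (intro CollectI conjI allI impI)
      show "c *\<^sub>R x \<in> S" using x LS by auto
      fix e :: real assume e: "e > 0"
      then have "e / (\<bar>c\<bar> + 1) > 0" by simp
      then obtain z where z: "z \<in> Z" "nrm (x - z) < e / (\<bar>c\<bar> + 1)"
        using x unfolding L_def limits_of_def by blast
      have "x - z \<in> S" using x z LS Z(2) by auto
      then have "nrm (c *\<^sub>R x - c *\<^sub>R z) = \<bar>c\<bar> * nrm (x - z)"
        by (simp add: nrm_def scale_left scale_right scaleR_diff_right[symmetric] mult.assoc[symmetric]
            real_sqrt_mult del: scaleR_diff_right)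
      also have "\<dots> \<le> (\<bar>c\<bar> + 1) * nrm (x - z)"
        using \<open>x - z \<in> S\<close> by (simp add: mult_right_mono)
      also have "\<dots> < e" using z(2) by (simp add: field_simps)
      finally show "\<exists>z\<in>Z. nrm (c *\<^sub>R x - z) < e" using z(1) subspace_scale[OF Z(1)] by blast
    qed
  qed
  have "hilbert_form L b"
  proof (rule hilbert_form_closed[OF L LS])
    fix w x assume w: "\<And>n::nat. w n \<in> L" and x: "x \<in> S" and lim: "(\<lambda>n. nrm (w n - x)) \<longlonglongrightarrow> 0"
    show "x \<in> L" unfolding L_def limits_of_def
    proof (intro CollectI conjI allI impI x)
      fix e :: real assume e: "e > 0"
      obtain n where n: "nrm (w n - x) < e/2"
        using order_tendstoD(2)[OF lim, of "e/2"] e by (auto simp: eventually_sequentially)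
      obtain z where z: "z \<in> Z" "nrm (w n - z) < e/2"
        using w[of n] e unfolding L_def limits_of_def by (fastforce dest: spec[of _ "e/2"])
      have "nrm (x - z) < e"
      proof -
        have S: "w n \<in> S" "z \<in> S" using w[of n] LS z Z(2) by auto
        show ?thesis
          using triangle_sub[OF x S] nrm_minus[OF x S(1)] z(2) n by linarith
      qed
      then show "\<exists>z\<in>Z. nrm (x - z) < e" using z(1) by blast
    qed
  qed
  then interpret L: hilbert_form L b .
  obtain p where p: "p \<in> L" "\<And>x. x \<in> L \<Longrightarrow> b u x = b p x"
    using L.riesz[of "b u" "nrm u"] u LS
    by (auto simp: add_right scale_right subset_iff cauchy_schwarz)
  have pS: "p \<in> S" using p LS by auto
  have null: "b (u - p) (u - p) = 0"
    using u pS p(2) ZL Z(2) by (intro orth) (auto simp: diff_left subset_iff)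
  have "\<exists>z\<in>Z. nrm (z - u) < 1 / Suc n" for n :: nat
  proof -
    obtain z where z: "z \<in> Z" "nrm (p - z) < 1 / Suc n"
    proof -
      have "\<exists>z\<in>Z. nrm (p - z) < 1 / Suc n"
        using p(1) unfolding L_def limits_of_def by simp
      then show ?thesis using that by blast
    qed
    have zS: "z \<in> S" using z Z(2) by auto
    have "nrm (u - p) = 0" using null by (simp add: nrm_def)
    then have "nrm (z - u) < 1 / Suc n"
      using triangle_sub[OF u pS zS] z(2) nrm_minus[OF zS u] by linarith
    with z(1) show ?thesis by blast
  qed
  then obtain z where z: "\<And>n::nat. z n \<in> Z" "\<And>n. nrm (z n - u) < 1 / Suc n" by metis
  have "(\<lambda>n. nrm (z n - u)) \<longlonglongrightarrow> 0"
  proof (rule real_tendsto_sandwich[OF _ _ tendsto_const LIMSEQ_inverse_real_of_nat])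
    show "\<forall>\<^sub>F n in sequentially. 0 \<le> nrm (z n - u)"
      by (simp add: nrm_nonneg subsetD[OF Z(2) z(1)] u)
    show "\<forall>\<^sub>F n in sequentially. nrm (z n - u) \<le> inverse (real (Suc n))"
      using z(2) by (auto simp: inverse_eq_divide less_imp_le)
  qed
  with z(1) that show thesis by blast
qed

end

lemma hilbert_form_inner:
  assumes "subspace S" "closed S"
  shows "hilbert_form S (inner :: 'a::{real_inner,banach} \<Rightarrow> _)"
proof -
  interpret psd_form S "inner :: 'a \<Rightarrow> _"
    by unfold_locales (auto simp: assms inner_add_left intro: inner_commute)
  have nrm: "nrm = norm" by (simp add: fun_eq_iff nrm_def norm_eq_sqrt_inner)
  show ?thesis
  proof
    fix X :: "nat \<Rightarrow> 'a" assume X: "\<And>n. X n \<in> S" and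
      C: "\<And>e. e > 0 \<Longrightarrow> \<exists>N. \<forall>m\<ge>N. \<forall>n\<ge>N. nrm (X m - X n) < e"
    have "Cauchy X" unfolding Cauchy_iff using C by (simp add: nrm)
    then obtain x where x: "X \<longlonglongrightarrow> x" using convergentD Cauchy_convergent by blast
    then have "x \<in> S" using X assms(2) closed_sequentially by blast
    moreover have "(\<lambda>n. nrm (X n - x)) \<longlonglongrightarrow> 0"
      using x by (simp add: nrm LIM_zero_iff tendsto_norm_zero_iff)
    ultimately show "\<exists>x\<in>S. (\<lambda>n. nrm (X n - x)) \<longlonglongrightarrow> 0" by blast
  qed
qed

section \<open>Square integrable functions\<close>

text \<open>
  Square integrable functions and their inner product.  These are functions rather than classes of
  functions modulo equality almost everywhere; the latter is recovered by \<open>L2_null_iff\<close>.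
\<close>

definition L2_space :: "'a measure \<Rightarrow> ('a \<Rightarrow> 'b::real_normed_vector) set" where
  "L2_space M = {f \<in> borel_measurable M. integrable M (\<lambda>t. (norm (f t))\<^sup>2)}"

lemma L2_spaceD:
  assumes "f \<in> L2_space M"
  shows "f \<in> borel_measurable M" "integrable M (\<lambda>t. (norm (f t))\<^sup>2)"
  using assms by (auto simp: L2_space_def)

lemma L2_space_bound:
  fixes f :: "'a \<Rightarrow> 'b::real_normed_vector" and g :: "'a \<Rightarrow> 'c::real_normed_vector"
  assumes f: "f \<in> L2_space M" and g: "g \<in> borel_measurable M"
    and le: "AE t in M. norm (g t) \<le> C * norm (f t)"
  shows "g \<in> L2_space M"
proof -
  have "integrable M (\<lambda>t. (norm (g t))\<^sup>2)"
  proof (rule Bochner_Integration.integrable_bound)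
    show "integrable M (\<lambda>t. C\<^sup>2 * (norm (f t))\<^sup>2)" using L2_spaceD(2)[OF f] by simp
    show "AE t in M. norm ((norm (g t))\<^sup>2) \<le> norm (C\<^sup>2 * (norm (f t))\<^sup>2)"
      using le
    proof eventually_elim
      case (elim t)
      have "(norm (g t))\<^sup>2 \<le> (C * norm (f t))\<^sup>2" using elim by (simp add: power_mono)
      then show ?case by (simp add: power_mult_distrib)
    qed
  qed (use g in measurable)
  with g show ?thesis by (simp add: L2_space_def)
qed

lemma subspace_L2: "subspace (L2_space M :: ('a \<Rightarrow> 'b::{real_normed_vector, second_countable_topology}) set)"
proof (rule subspaceI)
  show "(0 :: 'a \<Rightarrow> 'b) \<in> L2_space M" by (simp add: L2_space_def zero_fun_def)
  fix f g :: "'a \<Rightarrow> 'b" assume fg: "f \<in> L2_space M" "g \<in> L2_space M"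
  note [measurable] = fg[THEN L2_spaceD(1)]
  have "integrable M (\<lambda>t. (norm (f t + g t))\<^sup>2)"
  proof (rule Bochner_Integration.integrable_bound)
    show "integrable M (\<lambda>t. 2 * (norm (f t))\<^sup>2 + 2 * (norm (g t))\<^sup>2)"
      using fg[THEN L2_spaceD(2)] by simp
    show "AE t in M. norm ((norm (f t + g t))\<^sup>2) \<le> norm (2 * (norm (f t))\<^sup>2 + 2 * (norm (g t))\<^sup>2)"
    proof (rule AE_I2)
      fix t
      have "(norm (f t + g t))\<^sup>2 \<le> (norm (f t) + norm (g t))\<^sup>2"
        by (simp add: power_mono norm_triangle_ineq)
      also have "\<dots> \<le> 2 * (norm (f t))\<^sup>2 + 2 * (norm (g t))\<^sup>2"
        using sum_squares_bound[of "norm (f t)" "norm (g t)"] by (simp add: power2_eq_square algebra_simps)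
      finally show "norm ((norm (f t + g t))\<^sup>2) \<le> norm (2 * (norm (f t))\<^sup>2 + 2 * (norm (g t))\<^sup>2)" by simp
    qed
  qed measurable
  then show "f + g \<in> L2_space M" by (simp add: L2_space_def plus_fun_def)
next
  fix c and f :: "'a \<Rightarrow> 'b" assume f: "f \<in> L2_space M"
  show "c *\<^sub>R f \<in> L2_space M"
    using L2_spaceD[OF f] by (simp add: L2_space_def scaleR_fun_def power_mult_distrib)
qed

lemma L2_inner_integrable:
  fixes f g :: "'a \<Rightarrow> 'b::{real_inner, second_countable_topology}"
  assumes "f \<in> L2_space M" "g \<in> L2_space M"
  shows "integrable M (\<lambda>t. f t \<bullet> g t)"
proof (rule Bochner_Integration.integrable_bound)
  note [measurable] = assms[THEN L2_spaceD(1)]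
  show "integrable M (\<lambda>t. (norm (f t))\<^sup>2 + (norm (g t))\<^sup>2)"
    using assms[THEN L2_spaceD(2)] by simp
  show "(\<lambda>t. f t \<bullet> g t) \<in> borel_measurable M" by measurable
  show "AE t in M. norm (f t \<bullet> g t) \<le> norm ((norm (f t))\<^sup>2 + (norm (g t))\<^sup>2)"
  proof (rule AE_I2)
    fix t
    have "\<bar>f t \<bullet> g t\<bar> \<le> norm (f t) * norm (g t)" by (rule Cauchy_Schwarz_ineq2)
    also have "\<dots> \<le> (norm (f t))\<^sup>2 + (norm (g t))\<^sup>2"
    proof -
      have "0 \<le> norm (f t) * norm (g t)" by simp
      then show ?thesis 
        using sum_squares_bound[of "norm (f t)" "norm (g t)"] unfolding mult.assoc by linarith
    qed
    finally show "norm (f t \<bullet> g t) \<le> norm ((norm (f t))\<^sup>2 + (norm (g t))\<^sup>2)" by simp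
  qed
qed

definition L2_inner :: "'a measure \<Rightarrow> ('a \<Rightarrow> 'b::real_inner) \<Rightarrow> ('a \<Rightarrow> 'b) \<Rightarrow> real" where
  "L2_inner M f g = (LINT t|M. f t \<bullet> g t)"

lemma psd_form_L2: "psd_form (L2_space M :: ('a \<Rightarrow> 'b::{real_inner, second_countable_topology}) set) (L2_inner M)"
proof
  show "subspace (L2_space M :: ('a \<Rightarrow> 'b) set)" by (rule subspace_L2)
qed (auto simp: L2_inner_def inner_add_left L2_inner_integrable intro!: Bochner_Integration.integral_cong
    intro: inner_commute)

lemma L2_inner_self: "L2_inner M f f = (LINT t|M. (norm (f t))\<^sup>2)"
  by (simp add: L2_inner_def power2_norm_eq_inner)

lemma L2_null_iff:
  fixes f :: "'a \<Rightarrow> 'b::{real_inner, second_countable_topology}"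
  assumes "f \<in> L2_space M"
  shows "L2_inner M f f = 0 \<longleftrightarrow> (AE t in M. f t = 0)"
  using integral_nonneg_eq_0_iff_AE[OF L2_spaceD(2)[OF assms]] by (simp add: L2_inner_self)

lemma L2_inner_cong_AE:
  fixes f g :: "'a \<Rightarrow> 'b::{real_inner, second_countable_topology}"
  assumes "f \<in> L2_space M" "g \<in> L2_space M" "f' \<in> L2_space M" "g' \<in> L2_space M"
    "AE t in M. f t = f' t" "AE t in M. g t = g' t"
  shows "L2_inner M f g = L2_inner M f' g'"
  unfolding L2_inner_def
proof (rule integral_cong_AE)
  show "AE t in M. f t \<bullet> g t = f' t \<bullet> g' t" using assms(5,6) by eventually_elim simp
qed (use L2_inner_integrable assms(1-4) in \<open>blast intro: borel_measurable_integrable\<close>)+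

lemma AE_bounded_if_summable_integrals:
  fixes h :: "nat \<Rightarrow> 'a \<Rightarrow> real"
  assumes h: "\<And>n. integrable M (h n)" "\<And>n t. 0 \<le> h n t"
    and s: "summable (\<lambda>n. LINT t|M. h n t)"
  shows "AE t in M. \<exists>C. \<forall>n. h n t \<le> C"
proof -
  have [measurable]: "h n \<in> borel_measurable M" for n using h(1) by simp
  have "(\<integral>\<^sup>+t. (\<Sum>n. ennreal (h n t)) \<partial>M) = (\<Sum>n. \<integral>\<^sup>+t. ennreal (h n t) \<partial>M)"
    by (rule nn_integral_suminf) measurable
  also have "\<dots> = (\<Sum>n. ennreal (LINT t|M. h n t))"
    using h by (simp add: nn_integral_eq_integral)
  also have "\<dots> = ennreal (\<Sum>n. LINT t|M. h n t)"
    by (rule suminf_ennreal2) (use h s in auto)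
  finally have "(\<integral>\<^sup>+t. (\<Sum>n. ennreal (h n t)) \<partial>M) \<noteq> \<infinity>" by simp
  then have "AE t in M. (\<Sum>n. ennreal (h n t)) \<noteq> \<infinity>"
    by (intro nn_integral_PInf_AE) measurable
  then show ?thesis
  proof eventually_elim
    case (elim t)
    then obtain C where C: "C \<ge> 0" "(\<Sum>n. ennreal (h n t)) = ennreal C"
      by (metis ennreal_cases infinity_ennreal_def)
    have "h n t \<le> C" for n
    proof -
      have "ennreal (h n t) \<le> (\<Sum>n. ennreal (h n t))"
        using sum_le_suminf[of "\<lambda>n. ennreal (h n t)" "{n}"] by simp
      then show ?thesis using C by simp
    qed
    then show ?case by blast
  qed
qed

lemma L2_fatou:
  fixes X :: "nat \<Rightarrow> 'a \<Rightarrow> 'b::{real_normed_vector, second_countable_topology}"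
  assumes X: "\<And>n. X n \<in> L2_space M" and f[measurable]: "f \<in> borel_measurable M"
    and lim: "AE t in M. (\<lambda>n. X n t) \<longlonglongrightarrow> f t"
    and bd: "\<forall>\<^sub>F n in sequentially. (LINT t|M. (norm (X n t))\<^sup>2) \<le> C"
  shows "f \<in> L2_space M" "(LINT t|M. (norm (f t))\<^sup>2) \<le> C"
proof -
  note [measurable] = X[THEN L2_spaceD(1)]
  have C: "0 \<le> C"
  proof -
    obtain n where "(LINT t|M. (norm (X n t))\<^sup>2) \<le> C" using bd by (auto simp: eventually_sequentially)
    moreover have "0 \<le> (LINT t|M. (norm (X n t))\<^sup>2)" by simp
    ultimately show ?thesis by linarith
  qed
  have "(\<integral>\<^sup>+t. ennreal ((norm (f t))\<^sup>2) \<partial>M) = (\<integral>\<^sup>+t. liminf (\<lambda>n. ennreal ((norm (X n t))\<^sup>2)) \<partial>M)"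
  proof (rule nn_integral_cong_AE)
    show "AE t in M. ennreal ((norm (f t))\<^sup>2) = liminf (\<lambda>n. ennreal ((norm (X n t))\<^sup>2))"
      using lim
    proof eventually_elim
      case (elim t)
      have "(\<lambda>n. ennreal ((norm (X n t))\<^sup>2)) \<longlonglongrightarrow> ennreal ((norm (f t))\<^sup>2)"
        by (intro tendsto_ennrealI tendsto_power tendsto_norm elim)
      then show ?case by (intro lim_imp_Liminf[symmetric]) simp_all
    qed
  qed
  also have "\<dots> \<le> liminf (\<lambda>n. \<integral>\<^sup>+t. ennreal ((norm (X n t))\<^sup>2) \<partial>M)"
    by (rule nn_integral_liminf) measurable
  also have "\<dots> \<le> ennreal C"
  proof (rule Liminf_le)
    show "\<forall>\<^sub>F n in sequentially. (\<integral>\<^sup>+t. ennreal ((norm (X n t))\<^sup>2) \<partial>M) \<le> ennreal C"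
      using bd
    proof eventually_elim
      case (elim n)
      then show ?case
        using L2_spaceD(2)[OF X[of n]] by (simp add: nn_integral_eq_integral ennreal_leI)
    qed
  qed simp
  finally have *: "(\<integral>\<^sup>+t. ennreal ((norm (f t))\<^sup>2) \<partial>M) \<le> ennreal C" .
  have int: "integrable M (\<lambda>t. (norm (f t))\<^sup>2)"
  proof (rule integrableI_bounded)
    show "(\<integral>\<^sup>+t. ennreal (norm ((norm (f t))\<^sup>2)) \<partial>M) < \<infinity>"
      using le_less_trans[OF * ennreal_less_top[of C]] by simp
  qed measurable
  then show "f \<in> L2_space M" by (simp add: L2_space_def)
  show "(LINT t|M. (norm (f t))\<^sup>2) \<le> C"
    using * C by (simp add: nn_integral_eq_integral[OF int])
qed

text \<open>
  The Riesz-Fischer theorem for functions with values in a separable Hilbert space.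
\<close>

theorem hilbert_form_L2:
  "hilbert_form (L2_space M :: ('a \<Rightarrow> 'b::{real_inner, banach, second_countable_topology}) set) (L2_inner M)"
proof -
  interpret psd_form "L2_space M :: ('a \<Rightarrow> 'b) set" "L2_inner M" by (rule psd_form_L2)
  show ?thesis
  proof
    fix X :: "nat \<Rightarrow> 'a \<Rightarrow> 'b"
    assume X: "\<And>n. X n \<in> L2_space M"
      and C: "\<And>e. e > 0 \<Longrightarrow> \<exists>N. \<forall>m\<ge>N. \<forall>n\<ge>N. nrm (X m - X n) < e"
    note [measurable] = X[THEN L2_spaceD(1)]
    obtain N where N: "\<And>n k l. k \<ge> N n \<Longrightarrow> l \<ge> N n \<Longrightarrow> nrm (X k - X l) < (1/4)^n"
    proof -
      have "\<forall>n. \<exists>N. \<forall>k\<ge>N. \<forall>l\<ge>N. nrm (X k - X l) < (1/4)^n" using C by simp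
      then show ?thesis using that by metis
    qed
    \<comment> \<open>a subsequence along which consecutive differences are below \<open>(1/4)^n\<close>\<close>
    define r where "r n = (\<Sum>i\<le>n. N i) + n" for n
    have rN: "N n \<le> r n" for n unfolding r_def by (simp add: member_le_sum trans_le_add1)
    have rS: "r n \<le> r (Suc n)" for n by (simp add: r_def)
    have r_ge: "n \<le> r n" for n by (simp add: r_def)
    define d where "d n = X (r (Suc n)) - X (r n)" for n
    have d: "d n \<in> L2_space M" for n unfolding d_def using X by auto
    have nd: "(LINT t|M. (norm (d n t))\<^sup>2) \<le> (1/16)^n" for n
    proof -
      have "nrm (d n) < (1/4)^n" unfolding d_def using rN rS by (intro N) (auto intro: order_trans)
      then have "(nrm (d n))\<^sup>2 \<le> ((1/4)^n)\<^sup>2" using d by (intro power_mono) auto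
      then show ?thesis using d
        by (simp add: nrm_sq L2_inner_self power2_eq_square[of "(1/4)^n"] power_mult_distrib[symmetric])
    qed
    \<comment> \<open>the weight \<open>2^n\<close> leaves a summable series and makes the differences decay geometrically\<close>
    have "AE t in M. \<exists>C. \<forall>n. 2^n * (norm (d n t))\<^sup>2 \<le> C"
    proof (rule AE_bounded_if_summable_integrals)
      show "integrable M (\<lambda>t. 2^n * (norm (d n t))\<^sup>2)" for n using L2_spaceD(2)[OF d] by simp
      show "summable (\<lambda>n. LINT t|M. 2^n * (norm (d n t))\<^sup>2)"
      proof (rule summable_comparison_test'[of "\<lambda>n. (1/8)^n"])
        show "summable (\<lambda>n. (1/8::real)^n)" by (simp add: summable_geometric)
        fix n :: nat
        have "2^n * (LINT t|M. (norm (d n t))\<^sup>2) \<le> 2^n * (1/16)^n"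
          by (intro mult_left_mono nd) simp
        also have "\<dots> = (1/8)^n" by (simp flip: power_mult_distrib)
        finally show "norm (LINT t|M. 2^n * (norm (d n t))\<^sup>2) \<le> (1/8)^n" by simp
      qed
    qed simp
    then have conv: "AE t in M. convergent (\<lambda>n. X (r n) t)"
    proof eventually_elim
      case (elim t)
      then obtain C where C: "\<And>n. 2^n * (norm (d n t))\<^sup>2 \<le> C" by blast
      have C0: "0 \<le> C" using C[of 0] by (meson order_trans zero_le_mult_iff zero_le_numeral zero_le_power zero_le_power2)
      have "summable (\<lambda>n. d n t)"
      proof (rule summable_comparison_test'[of "\<lambda>n. sqrt C * (sqrt (1/2))^n"])
        show "summable (\<lambda>n. sqrt C * (sqrt (1/2))^n)"
          by (intro summable_mult summable_geometric) (simp add: real_sqrt_divide)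
        fix n :: nat
        have "(norm (d n t))\<^sup>2 \<le> C * (1/2)^n" using C[of n] by (simp add: field_simps power_one_over)
        then have "sqrt ((norm (d n t))\<^sup>2) \<le> sqrt (C * (1/2)^n)" by (rule real_sqrt_le_mono)
        then show "norm (d n t) \<le> sqrt C * (sqrt (1/2))^n" by (simp add: real_sqrt_mult real_sqrt_power)
      qed
      then have "convergent (\<lambda>n. \<Sum>i<n. d i t)" by (simp add: summable_iff_convergent)
      moreover have "(\<Sum>i<n. d i t) = X (r n) t - X (r 0) t" for n
        unfolding d_def by (induction n) auto
      ultimately have "convergent (\<lambda>n. X (r n) t - X (r 0) t + X (r 0) t)"
        by (intro convergent_add convergent_const) simp
      then show ?case by simp
    qed
    define f where "f t = lim (\<lambda>n. X (r n) t)" for t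
    have f[measurable]: "f \<in> borel_measurable M" unfolding f_def by measurable
    have lim: "AE t in M. (\<lambda>n. X (r n) t) \<longlonglongrightarrow> f t"
      using conv by eventually_elim (simp add: f_def convergent_LIMSEQ_iff)
    have key: "X k - f \<in> L2_space M \<and> nrm (X k - f) \<le> e"
      if e: "e > 0" and K: "\<And>m n. m \<ge> K \<Longrightarrow> n \<ge> K \<Longrightarrow> nrm (X m - X n) < e" and k: "k \<ge> K" for e K k
    proof -
      have bd: "\<forall>\<^sub>F n in sequentially. (LINT t|M. (norm ((X k - X (r n)) t))\<^sup>2) \<le> e\<^sup>2"
        unfolding eventually_sequentially
      proof (intro exI allI impI)
        fix n assume "n \<ge> K"
        then have "nrm (X k - X (r n)) < e" using r_ge[of n] by (intro K k) simp
        then have "(nrm (X k - X (r n)))\<^sup>2 \<le> e\<^sup>2" using X by (intro power_mono) auto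
        then show "(LINT t|M. (norm ((X k - X (r n)) t))\<^sup>2) \<le> e\<^sup>2"
          using X by (simp add: nrm_sq L2_inner_self)
      qed
      have lim': "AE t in M. (\<lambda>n. (X k - X (r n)) t) \<longlonglongrightarrow> (X k - f) t"
        using lim by eventually_elim (auto intro: tendsto_diff)
      have m: "X k - f \<in> borel_measurable M" by (simp add: fun_diff_def)
      have "X k - X (r n) \<in> L2_space M" for n using X by auto
      note fatou = L2_fatou[OF this m lim' bd]
      have "nrm (X k - f) \<le> e"
        unfolding nrm_def L2_inner_self using fatou(2) e by (intro real_le_lsqrt) auto
      with fatou(1) show ?thesis by blast
    qed
    show "\<exists>f\<in>L2_space M. (\<lambda>n. nrm (X n - f)) \<longlonglongrightarrow> 0"
    proof (intro bexI)
      obtain K where K: "\<And>m n. m \<ge> K \<Longrightarrow> n \<ge> K \<Longrightarrow> nrm (X m - X n) < 1" using C[of 1] by auto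
      have "X K - (X K - f) \<in> L2_space M" using key[OF zero_less_one K order_refl] X by blast
      then show "f \<in> L2_space M" by simp
      then have S: "X n - f \<in> L2_space M" for n using X by auto
      show "(\<lambda>n. nrm (X n - f)) \<longlonglongrightarrow> 0"
      proof (rule LIMSEQ_I)
        fix e :: real assume e: "e > 0"
        then obtain K where "\<And>m n. m \<ge> K \<Longrightarrow> n \<ge> K \<Longrightarrow> nrm (X m - X n) < e/2" using C[of "e/2"] by auto
        then have "nrm (X n - f) \<le> e/2" if "n \<ge> K" for n using key[of "e/2" K n] e that by auto
        then have "norm (nrm (X n - f) - 0) < e" if "n \<ge> K" for n using that e nrm_nonneg[OF S] 
          by (fastforce dest: order.strict_trans1[of _ "e/2"])
        then show "\<exists>K. \<forall>n\<ge>K. norm (nrm (X n - f) - 0) < e" by blast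
      qed
    qed
  qed
qed

lemma L2_tendsto_AE_subseq:
  fixes X :: "nat \<Rightarrow> 'a \<Rightarrow> 'b::{real_inner, second_countable_topology}"
  assumes X: "\<And>n. X n \<in> L2_space M" "f \<in> L2_space M"
    and lim: "(\<lambda>n. L2_inner M (X n - f) (X n - f)) \<longlonglongrightarrow> 0"
  obtains r where "strict_mono r" "AE t in M. (\<lambda>n. X (r n) t) \<longlonglongrightarrow> f t"
proof -
  have d: "X n - f \<in> L2_space M" for n using X by (simp add: subspace_diff[OF subspace_L2])
  have "\<exists>r::nat\<Rightarrow>nat. strict_mono r \<and> (AE t in M. (\<lambda>n. (norm ((X (r n) - f) t))\<^sup>2) \<longlonglongrightarrow> 0)"
  proof (rule tendsto_L1_AE_subseq)
    show "integrable M (\<lambda>t. (norm ((X n - f) t))\<^sup>2)" for n using L2_spaceD(2)[OF d] .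
    show "(\<lambda>n. LINT t|M. norm ((norm ((X n - f) t))\<^sup>2)) \<longlonglongrightarrow> 0" using lim by (simp add: L2_inner_self)
  qed
  then obtain r :: "nat \<Rightarrow> nat" where r: "strict_mono r" and
    ae: "AE t in M. (\<lambda>n. (norm ((X (r n) - f) t))\<^sup>2) \<longlonglongrightarrow> 0" by blast
  have "AE t in M. (\<lambda>n. X (r n) t) \<longlonglongrightarrow> f t"
    using ae
  proof eventually_elim
    case (elim t)
    have "(\<lambda>n. sqrt ((norm ((X (r n) - f) t))\<^sup>2)) \<longlonglongrightarrow> sqrt 0" by (rule tendsto_real_sqrt[OF elim])
    then show ?case by (simp add: LIM_zero_iff tendsto_norm_zero_iff)
  qed
  with r that show thesis by blast
qed

section \<open>Smooth test functions\<close>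

text \<open>
  \<open>diff_times n f\<close> means that \<open>f\<close> and its first \<open>n\<close> derivatives are differentiable everywhere.
\<close>

fun diff_times :: "nat \<Rightarrow> (real \<Rightarrow> real) \<Rightarrow> bool" where
  "diff_times 0 f \<longleftrightarrow> (\<forall>t. f differentiable at t)"
| "diff_times (Suc n) f \<longleftrightarrow> (\<forall>t. f differentiable at t) \<and> diff_times n (deriv f)"

lemma diff_times_differentiable: "diff_times n f \<Longrightarrow> f differentiable at t"
  by (cases n) auto

lemma diff_times_Suc_imp: "diff_times (Suc n) f \<Longrightarrow> diff_times n f"
  by (induction n arbitrary: f) auto

lemma diff_times_deriv_funpow: "diff_times n f \<Longrightarrow> ((deriv ^^ n) f) differentiable at t"
  by (induction n arbitrary: f) (auto simp: funpow_Suc_right simp del: funpow.simps)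

lemma diff_times_SucI:
  assumes "\<And>t. (f has_real_derivative f' t) (at t)" "diff_times n f'"
  shows "diff_times (Suc n) f"
proof -
  have "deriv f = f'" using assms(1) by (auto simp: fun_eq_iff intro: DERIV_imp_deriv)
  then show ?thesis using assms by (auto simp: real_differentiable_def)
qed

lemma differentiable_DERIV: "f differentiable at t \<Longrightarrow> (f has_real_derivative deriv f t) (at t)" for f :: "real \<Rightarrow> real"
  by (metis DERIV_imp_deriv real_differentiable_def)

lemma diff_times_const: "diff_times n (\<lambda>t. c)"
  by (induction n arbitrary: c) (auto intro!: diff_times_SucI[where f' = "\<lambda>_. 0"])

lemma diff_times_add: "diff_times n f \<Longrightarrow> diff_times n g \<Longrightarrow> diff_times n (\<lambda>t. f t + g t)"
proof (induction n arbitrary: f g)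
  case (Suc n)
  then show ?case
    by (intro diff_times_SucI[where f' = "\<lambda>t. deriv f t + deriv g t"])
       (auto intro!: derivative_intros differentiable_DERIV)
qed auto

lemma diff_times_mult: "diff_times n f \<Longrightarrow> diff_times n g \<Longrightarrow> diff_times n (\<lambda>t. f t * g t)"
proof (induction n arbitrary: f g)
  case (Suc n)
  have "diff_times n f" "diff_times n g" using Suc.prems diff_times_Suc_imp by blast+
  with Suc.prems have "diff_times n (\<lambda>t. deriv f t * g t + deriv g t * f t)"
    by (intro diff_times_add Suc.IH) auto
  with Suc.prems show ?case
    by (intro diff_times_SucI[where f' = "\<lambda>t. deriv f t * g t + deriv g t * f t"] DERIV_mult)
       (auto intro!: differentiable_DERIV)
qed auto

lemma diff_times_inverse:
  assumes "\<And>t. f t \<noteq> 0"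
  shows "diff_times n f \<Longrightarrow> diff_times n (\<lambda>t. inverse (f t))"
proof (induction n)
  case 0
  then show ?case using assms by (auto intro: differentiable_inverse)
next
  case (Suc n)
  have "diff_times n (\<lambda>t. inverse (f t))" using Suc diff_times_Suc_imp by blast
  then have "diff_times n (\<lambda>t. (- 1) * (inverse (f t) * deriv f t * inverse (f t)))"
    using Suc.prems by (intro diff_times_mult diff_times_const) auto
  then show ?case
  proof (rule diff_times_SucI[rotated])
    fix t
    show "((\<lambda>t. inverse (f t)) has_real_derivative (- 1) * (inverse (f t) * deriv f t * inverse (f t))) (at t)"
      using DERIV_inverse'[OF differentiable_DERIV[OF diff_times_differentiable[OF Suc.prems, of t]] assms] by simp
  qed
qed

lemma diff_times_affine: "diff_times n f \<Longrightarrow> diff_times n (\<lambda>t. f (c * t + d))"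
proof (induction n arbitrary: f)
  case 0
  have "((\<lambda>t. f (c * t + d)) has_real_derivative deriv f (c * t + d) * c) (at t)" for t
    by (rule DERIV_chain2[OF differentiable_DERIV[OF diff_times_differentiable[OF 0]]])
       (auto intro!: derivative_eq_intros)
  then have "(\<lambda>t. f (c * t + d)) differentiable at t" for t
    unfolding real_differentiable_def by blast
  then show ?case by simp
next
  case (Suc n)
  have "diff_times n (\<lambda>t. deriv f (c * t + d) * c)"
    by (rule diff_times_mult[OF Suc.IH diff_times_const]) (use Suc.prems in simp)
  then show ?case
  proof (rule diff_times_SucI[rotated])
    fix t
    show "((\<lambda>t. f (c * t + d)) has_real_derivative deriv f (c * t + d) * c) (at t)"
      by (rule DERIV_chain2[OF differentiable_DERIV[OF diff_times_differentiable[OF Suc.prems]]])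
         (auto intro!: derivative_eq_intros)
  qed
qed

text \<open>
  The functions \<open>p (1 / t) exp (- 1 / t)\<close>, extended by \<open>0\<close> to \<open>t \<le> 0\<close>.  The family over all
  polynomials \<open>p\<close> is closed under differentiation, so each member is smooth.
\<close>

definition exp_inv :: "real poly \<Rightarrow> real \<Rightarrow> real" where
  "exp_inv p t = (if t > 0 then poly p (1 / t) * exp (- (1 / t)) else 0)"

lemma poly_div_exp_tendsto_0: "((\<lambda>x. poly p x / exp x) \<longlongrightarrow> (0::real)) at_top"
proof -
  have "((\<lambda>x. \<Sum>i\<le>degree p. coeff p i * (x ^ i / exp x)) \<longlongrightarrow> (\<Sum>i\<le>degree p. coeff p i * 0)) at_top"
    by (intro tendsto_intros tendsto_power_div_exp_0)
  then show ?thesis by (simp add: poly_altdef sum_divide_distrib)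
qed

lemma exp_inv_tendsto_0: "((\<lambda>h. poly p (1 / h) * exp (- (1 / h))) \<longlongrightarrow> (0::real)) (at_right 0)"
proof -
  have "filterlim (\<lambda>h::real. 1 / h) at_top (at_right 0)"
    using filterlim_inverse_at_top_right by (simp add: inverse_eq_divide)
  from filterlim_compose[OF poly_div_exp_tendsto_0 this]
  show ?thesis by (simp add: exp_minus inverse_eq_divide)
qed

lemma DERIV_exp_inv:
  "(exp_inv p has_real_derivative exp_inv ([:0, 0, 1:] * (p - pderiv p)) t) (at t)"
proof -
  consider "t > 0" | "t < 0" | "t = 0" by linarith
  then show ?thesis
  proof cases
    case 1
    have "((\<lambda>t. poly p (1 / t) * exp (- (1 / t))) has_real_derivative
        exp_inv ([:0, 0, 1:] * (p - pderiv p)) t) (at t)"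
      using 1 unfolding exp_inv_def
      by (auto intro!: derivative_eq_intros DERIV_chain2[OF poly_DERIV] simp: field_simps power2_eq_square)
    moreover have "\<forall>\<^sub>F s in nhds t. exp_inv p s = poly p (1 / s) * exp (- (1 / s))"
      using eventually_nhds_in_open[of "{0<..}" t] 1 by (auto elim!: eventually_mono simp: exp_inv_def)
    ultimately show ?thesis by (subst DERIV_cong_ev[OF refl _ refl]) auto
  next
    case 2
    have "\<forall>\<^sub>F s in nhds t. exp_inv p s = 0"
      using eventually_nhds_in_open[of "{..<0}" t] 2 by (auto elim!: eventually_mono simp: exp_inv_def)
    then show ?thesis using 2 by (subst DERIV_cong_ev[OF refl _ refl, where g = "\<lambda>_. 0"]) (auto simp: exp_inv_def)
  next
    case 3
    have r: "((\<lambda>h. exp_inv p h / h) \<longlongrightarrow> 0) (at_right 0)"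
    proof (rule Lim_transform_eventually[OF exp_inv_tendsto_0[of "[:0, 1:] * p"]])
      show "\<forall>\<^sub>F h in at_right 0. poly ([:0, 1:] * p) (1 / h) * exp (- (1 / h)) = exp_inv p h / h"
        using eventually_at_right_less[of "0::real"]
        by eventually_elim (simp add: exp_inv_def)
    qed
    have l: "((\<lambda>h. exp_inv p h / h) \<longlongrightarrow> 0) (at_left 0)"
      by (rule tendsto_eventually)
         (auto simp: eventually_at_left_field exp_inv_def intro!: exI[of _ "-1"])
    have "((\<lambda>h. exp_inv p h / h) \<longlongrightarrow> 0) (at 0)" using r l by (simp add: filterlim_split_at)
    then show ?thesis using 3 by (simp add: DERIV_def exp_inv_def)
  qed
qed

lemma diff_times_exp_inv: "diff_times n (exp_inv p)"
proof (induction n arbitrary: p)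
  case 0
  then show ?case using DERIV_exp_inv by (auto simp: real_differentiable_def)
next
  case (Suc n)
  show ?case by (rule diff_times_SucI[OF DERIV_exp_inv Suc.IH])
qed

text \<open>
  A smooth transition from \<open>0\<close> on \<open>t \<le> 0\<close> to \<open>1\<close> on \<open>t \<ge> 1\<close>.
\<close>

definition smooth_step :: "real \<Rightarrow> real" where
  "smooth_step t = exp_inv 1 t * inverse (exp_inv 1 t + exp_inv 1 ((-1) * t + 1))"

lemma diff_times_smooth_step: "diff_times n smooth_step"
proof -
  have pos: "exp_inv 1 t + exp_inv 1 ((-1) * t + 1) \<noteq> 0" for t
  proof -
    have "0 \<le> exp_inv 1 t" "0 \<le> exp_inv 1 ((-1) * t + 1)" "t > 0 \<Longrightarrow> 0 < exp_inv 1 t"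
      "t < 1 \<Longrightarrow> 0 < exp_inv 1 ((-1) * t + 1)"
      by (auto simp: exp_inv_def)
    then show ?thesis by (cases "t > 0") (force, force)
  qed
  have "diff_times n (\<lambda>t. exp_inv 1 t * inverse (exp_inv 1 t + exp_inv 1 ((-1) * t + 1)))"
    by (intro diff_times_mult diff_times_inverse pos diff_times_add diff_times_affine diff_times_exp_inv)
  then show ?thesis by (simp add: smooth_step_def[abs_def])
qed

lemma smooth_step_eq: "t \<le> 0 \<Longrightarrow> smooth_step t = 0" "t \<ge> 1 \<Longrightarrow> smooth_step t = 1"
  by (auto simp: smooth_step_def exp_inv_def)

text \<open>
  A smooth function that vanishes for \<open>t \<le> 0\<close> and equals \<open>t\<close> for \<open>t \<ge> 1\<close>, with bounded derivative.
\<close>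
definition ramp :: "real \<Rightarrow> real" where "ramp t = t * smooth_step t"

lemma ramp_eq: "t \<le> 0 \<Longrightarrow> ramp t = 0" "t \<ge> 1 \<Longrightarrow> ramp t = t"
  by (auto simp: ramp_def smooth_step_eq)

lemma diff_times_ramp: "diff_times n ramp"
proof -
  have "diff_times n (\<lambda>t. t)"
    by (cases n) (auto intro!: diff_times_SucI[where f' = "\<lambda>_. 1"] diff_times_const)
  then show ?thesis
    unfolding ramp_def[abs_def] by (intro diff_times_mult diff_times_smooth_step)
qed

lemma DERIV_ramp: "(ramp has_real_derivative deriv ramp t) (at t)"
  by (rule differentiable_DERIV[OF diff_times_differentiable[OF diff_times_ramp[of 0]]])

lemma deriv_ramp_eq: "t < 0 \<Longrightarrow> deriv ramp t = 0" "t > 1 \<Longrightarrow> deriv ramp t = 1"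
proof -
  assume "t < 0"
  then have "\<forall>\<^sub>F s in nhds t. ramp s = 0"
    using eventually_nhds_in_open[of "{..<0}" t] by (auto elim!: eventually_mono simp: ramp_eq)
  then show "deriv ramp t = 0" using deriv_cong_ev[of ramp "\<lambda>_. 0" t t] by simp
next
  assume "t > 1"
  then have "\<forall>\<^sub>F s in nhds t. ramp s = s"
    using eventually_nhds_in_open[of "{1<..}" t] by (auto elim!: eventually_mono simp: ramp_eq)
  then show "deriv ramp t = 1" using deriv_cong_ev[of ramp "\<lambda>s. s" t t] by simp
qed

lemma bounded_deriv_ramp: obtains C where "\<And>t. \<bar>deriv ramp t\<bar> \<le> C" "C \<ge> 1"
proof -
  have "continuous_on {0..1} (deriv ramp)"
    using diff_times_ramp[of 1]
    by (intro differentiable_imp_continuous_on) (auto simp: differentiable_on_def intro: differentiable_at_withinI)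
  then have "bounded (deriv ramp ` {0..1})"
    by (intro compact_imp_bounded compact_continuous_image) auto
  then obtain C where C: "\<And>t. 0 \<le> t \<Longrightarrow> t \<le> 1 \<Longrightarrow> \<bar>deriv ramp t\<bar> \<le> C" by (force simp: bounded_iff)
  have "\<bar>deriv ramp t\<bar> \<le> max C 1" for t
    using C[of t] deriv_ramp_eq[of t] by (cases "t < 0"; cases "t > 1") auto
  then show thesis using that[of "max C 1"] by simp
qed

text \<open>
  The ramp rescaled to transition width \<open>1 / (n + 1)\<close>.  It tends to \<open>max 0 t\<close>, and its derivative
  tends to the indicator of the positive half-line, boundedly.
\<close>
definition ramp_n :: "nat \<Rightarrow> real \<Rightarrow> real" where
  "ramp_n n t = ramp (real (Suc n) * t) / real (Suc n)"

lemma diff_times_ramp_n: "diff_times k (\<lambda>t. ramp_n n (t - a))"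
proof -
  have "diff_times k (\<lambda>t. (1 / real (Suc n)) * ramp (real (Suc n) * t + (- a * real (Suc n))))"
    by (intro diff_times_mult diff_times_const diff_times_affine diff_times_ramp)
  then show ?thesis by (simp add: ramp_n_def algebra_simps)
qed

lemma DERIV_ramp_n:
  "((\<lambda>t. ramp_n n (t - a)) has_real_derivative deriv ramp (real (Suc n) * (t - a))) (at t)"
  unfolding ramp_n_def
  by (rule derivative_eq_intros DERIV_chain2[OF DERIV_ramp] refl | simp)+

lemma ramp_n_eq: "t \<le> 0 \<Longrightarrow> ramp_n n t = 0" "t \<ge> 1 / real (Suc n) \<Longrightarrow> ramp_n n t = t"
proof -
  assume "t \<le> 0"
  then have "real (Suc n) * t \<le> 0" by (simp add: mult_nonneg_nonpos)
  then show "ramp_n n t = 0" by (simp add: ramp_n_def ramp_eq del: of_nat_Suc)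
next
  assume "t \<ge> 1 / real (Suc n)"
  then have "real (Suc n) * t \<ge> 1" by (simp add: field_simps)
  then show "ramp_n n t = t" by (simp add: ramp_n_def ramp_eq del: of_nat_Suc)
qed

lemma ramp_n_tendsto: "(\<lambda>n. ramp_n n t) \<longlonglongrightarrow> max 0 t"
proof (cases "t \<le> 0")
  case False
  then have "\<forall>\<^sub>F n in sequentially. inverse (real (Suc n)) < t"
    using order_tendstoD(2)[OF LIMSEQ_inverse_real_of_nat, of t] by simp
  then have "\<forall>\<^sub>F n in sequentially. ramp_n n t = max 0 t"
    by (rule eventually_mono) (use False in \<open>auto simp: ramp_n_eq inverse_eq_divide simp del: of_nat_Suc\<close>)
  then show ?thesis by (rule tendsto_eventually)
qed (auto simp: ramp_n_eq)

lemma deriv_ramp_tendsto: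
  assumes "t \<noteq> 0" shows "(\<lambda>n. deriv ramp (real (Suc n) * t)) \<longlonglongrightarrow> indicator {0<..} t"
proof (cases "t < 0")
  case True
  then show ?thesis by (simp add: deriv_ramp_eq mult_pos_neg)
next
  case False
  then have t: "t > 0" using assms by simp
  then have "\<forall>\<^sub>F n in sequentially. inverse (real (Suc n)) < t"
    using order_tendstoD(2)[OF LIMSEQ_inverse_real_of_nat, of t] by simp
  then have "\<forall>\<^sub>F n in sequentially. deriv ramp (real (Suc n) * t) = indicator {0<..} t"
    by (rule eventually_mono) (use t in \<open>auto simp: deriv_ramp_eq field_simps simp del: of_nat_Suc\<close>)
  then show ?thesis by (rule tendsto_eventually)
qed

lemma ramp_n_bound:
  assumes "\<And>t. \<bar>deriv ramp t\<bar> \<le> C"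
  shows "\<bar>ramp_n n t\<bar> \<le> C * \<bar>t\<bar>"
proof -
  have "norm (ramp_n n (t - 0) - ramp_n n (0 - 0)) \<le> C * norm (t - 0)"
    by (rule field_differentiable_bound[of UNIV _ "\<lambda>t. deriv ramp (real (Suc n) * (t - 0))"])
       (use DERIV_ramp_n[of n 0] assms in auto)
  then show ?thesis by (simp add: ramp_n_eq)
qed

text \<open>
  A smoothed piecewise linear function with kinks at \<open>a\<close>, \<open>b\<close> and \<open>d\<close>.  The weights have sum zero and
  first moment zero, so that the function vanishes beyond the last kink.
\<close>
definition tent :: "nat \<Rightarrow> real \<Rightarrow> real \<Rightarrow> real \<Rightarrow> real \<Rightarrow> real" where
  "tent n a b d t = (d - b) * ramp_n n (t - a) + (a - d) * ramp_n n (t - b) + (b - a) * ramp_n n (t - d)"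

lemma DERIV_tent:
  "(tent n a b d has_real_derivative (d - b) * deriv ramp (real (Suc n) * (t - a))
    + (a - d) * deriv ramp (real (Suc n) * (t - b)) + (b - a) * deriv ramp (real (Suc n) * (t - d))) (at t)"
  unfolding tent_def[abs_def] by (intro DERIV_add DERIV_cmult DERIV_ramp_n)

lemma tent_test_function:
  assumes abd: "a \<in> {0<..<T}" "b \<in> {0<..<T}" "d \<in> {0<..<T}"
    and n: "1 / real (Suc n) < T - Max {a, b, d}"
  shows "tent n a b d \<in> test_functions T"
proof -
  define m where "m = Min {a, b, d}"
  define M where "M = Max {a, b, d} + 1 / real (Suc n)"
  have zero: "tent n a b d t = 0" if t: "t \<notin> {m..M}" for t
  proof -
    have left: ?thesis if "t \<le> a" "t \<le> b" "t \<le> d"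
      using that by (simp add: tent_def ramp_n_eq(1))
    have right: ?thesis
      if "1 / real (Suc n) \<le> t - a" "1 / real (Suc n) \<le> t - b" "1 / real (Suc n) \<le> t - d"
    proof -
      have "tent n a b d t = (d - b) * (t - a) + (a - d) * (t - b) + (b - a) * (t - d)"
        unfolding tent_def by (simp only: ramp_n_eq(2) that)
      then show ?thesis by (simp add: algebra_simps)
    qed
    have "t < m \<or> M < t" using t by (simp add: not_le)
    then show ?thesis
    proof
      assume "t < m"
      then show ?thesis by (intro left) (simp_all add: m_def)
    next
      assume "M < t"
      then have "1 / real (Suc n) < t - Max {a, b, d}" by (simp add: M_def)
      moreover have "a \<le> Max {a, b, d}" "b \<le> Max {a, b, d}" "d \<le> Max {a, b, d}" by simp_all
      ultimately show ?thesis by (intro right) linarith+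
    qed
  qed
  have "closure {t. tent n a b d t \<noteq> 0} \<subseteq> {m..M}"
    using zero by (intro closure_minimal subsetI) (blast, simp)
  also have "{m..M} \<subseteq> {0<..<T}" 
  proof -
    have "0 < m" using abd by (simp add: m_def)
    moreover have "M < T" using n by (simp add: M_def)
    ultimately show ?thesis by auto
  qed
  finally have "closure {t. tent n a b d t \<noteq> 0} \<subseteq> {0<..<T}" .
  moreover have "diff_times k (tent n a b d)" for k
    unfolding tent_def[abs_def] by (intro diff_times_add diff_times_mult diff_times_const diff_times_ramp_n)
  ultimately show ?thesis by (auto simp: test_functions_def intro: diff_times_deriv_funpow)
qed

section \<open>Primitives in time and the fundamental lemma\<close>

lemma finite_time_measure: "finite_measure (time_measure T)"
  by (rule finite_measure_lebesgue_on) simp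

lemma ident_measurable_time: "(\<lambda>t. t) \<in> borel_measurable (time_measure T)"
  using id_borel_measurable_lebesgue_on by (simp add: id_def)

lemma borel_measurable_time: "f \<in> borel_measurable borel \<Longrightarrow> f \<in> borel_measurable (time_measure T)"
  by (rule measurable_compose[OF ident_measurable_time])

lemma AE_time_neq: "AE t in time_measure T. t \<noteq> a"
proof -
  have "AE t in lebesgue. t \<noteq> a" by (rule AE_I'[of "{a}"]) auto
  then have "AE t in lebesgue. t \<in> {0<..<T} \<longrightarrow> t \<noteq> a" by eventually_elim simp
  then show ?thesis by (subst AE_restrict_space_iff) auto
qed

text \<open>
  The primitive \<open>\<integral>\<^sub>0\<^sup>a f\<close> of an integrable function on \<open>(0,T)\<close>.
\<close>

definition prim :: "real \<Rightarrow> (real \<Rightarrow> 'b::{banach, second_countable_topology}) \<Rightarrow> real \<Rightarrow> 'b" where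
  "prim T f a = (LINT s|time_measure T. indicator {..<a} s *\<^sub>R f s)"

lemma integrable_indicator_time:
  fixes f :: "real \<Rightarrow> 'b::{banach, second_countable_topology}"
  assumes f: "integrable (time_measure T) f" and A: "A \<in> sets borel"
  shows "integrable (time_measure T) (\<lambda>s. indicator A s *\<^sub>R f s)"
proof (rule Bochner_Integration.integrable_bound[OF f])
  have [measurable]: "(indicator A :: real \<Rightarrow> real) \<in> borel_measurable (time_measure T)"
    using A by (intro borel_measurable_time borel_measurable_indicator)
  show "(\<lambda>s. indicator A s *\<^sub>R f s) \<in> borel_measurable (time_measure T)" using f by measurable
qed (auto simp: indicator_def)

lemma prim_add:
  assumes "integrable (time_measure T) f" "integrable (time_measure T) g"
  shows "prim T (\<lambda>s. f s + g s) a = prim T f a + prim T g a"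
  unfolding prim_def using assms by (simp add: scaleR_add_right integrable_indicator_time)

lemma prim_diff:
  assumes "integrable (time_measure T) f" "integrable (time_measure T) g"
  shows "prim T (\<lambda>s. f s - g s) a = prim T f a - prim T g a"
  unfolding prim_def using assms by (simp add: scaleR_diff_right integrable_indicator_time)

lemma prim_bounded_linear:
  assumes "bounded_linear L" "integrable (time_measure T) f"
  shows "prim T (\<lambda>s. L (f s)) a = L (prim T f a)"
proof -
  interpret bounded_linear L by fact
  show ?thesis
    unfolding prim_def using integral_bounded_linear[OF assms(1) integrable_indicator_time[OF assms(2), of "{..<a}"]]
    by (simp add: scaleR)
qed

lemma prim_cong_AE:
  assumes "integrable (time_measure T) f" "integrable (time_measure T) g"
    "AE s in time_measure T. f s = g s"
  shows "prim T f a = prim T g a"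
  unfolding prim_def
  using assms(3) by (intro integral_cong_AE borel_measurable_integrable integrable_indicator_time assms) auto

lemma prim_tail:
  assumes "integrable (time_measure T) f"
  shows "(LINT t|time_measure T. indicator {s<..} t *\<^sub>R f t) = (LINT t|time_measure T. f t) - prim T f s"
proof -
  have "(LINT t|time_measure T. f t) = (LINT t|time_measure T. indicator {s<..} t *\<^sub>R f t + indicator {..<s} t *\<^sub>R f t)"
  proof (rule integral_cong_AE)
    show "AE t in time_measure T. f t = indicator {s<..} t *\<^sub>R f t + indicator {..<s} t *\<^sub>R f t"
      using AE_time_neq[of s] by eventually_elim (auto simp: indicator_def)
  qed (use assms in \<open>auto intro!: borel_measurable_integrable Bochner_Integration.integrable_add integrable_indicator_time\<close>)
  then show ?thesis using assms by (simp add: prim_def integrable_indicator_time)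
qed

lemma prim_eq_0: "a \<le> 0 \<Longrightarrow> prim T f a = 0"
  unfolding prim_def by (rule integral_eq_zero_AE, rule AE_I2) (auto simp: indicator_def)

lemma prim_eq_total: "a \<ge> T \<Longrightarrow> prim T f a = (LINT s|time_measure T. f s)"
  unfolding prim_def by (rule Bochner_Integration.integral_cong) (auto simp: indicator_def)

lemma prim_const:
  assumes "0 \<le> a" "a \<le> T"
  shows "prim T (\<lambda>s. c) a = a *\<^sub>R c"
proof -
  have "measure (time_measure T) ({..<a} \<inter> {0<..<T}) = a"
  proof -
    have e: "{..<a} \<inter> {0<..<T} = {0<..<a}" using assms by auto
    have "measure (time_measure T) {0<..<a} = measure lebesgue {0<..<a}"
      using assms by (subst measure_restrict_space) auto
    then show ?thesis using assms e by simp
  qed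
  moreover have "{..<a} \<inter> {0<..<T} \<in> sets (time_measure T)"
    by (rule sets_restrict_space_iff[THEN iffD2]) auto
  moreover have "(LINT s|time_measure T. indicator {..<a} s *\<^sub>R c)
    = (LINT s|time_measure T. indicator ({..<a} \<inter> {0<..<T}) s *\<^sub>R c)"
    by (rule Bochner_Integration.integral_cong) (auto simp: indicator_def)
  ultimately show ?thesis
    unfolding prim_def
    using finite_measure.emeasure_finite[OF finite_time_measure, of T "{..<a} \<inter> {0<..<T}"]
    by (simp add: less_top)
qed

lemma continuous_prim:
  fixes f :: "real \<Rightarrow> 'b::{banach, second_countable_topology}"
  assumes f: "integrable (time_measure T) f"
  shows "continuous_on A (prim T f)"
proof (rule continuous_on_subset[of UNIV])
  show "continuous_on UNIV (prim T f)"
    unfolding continuous_on_sequentially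
  proof (intro allI ballI impI, elim conjE)
    fix X :: "nat \<Rightarrow> real" and a assume X: "X \<longlonglongrightarrow> a"
    show "(prim T f \<circ> X) \<longlonglongrightarrow> prim T f a"
      unfolding o_def prim_def
    proof (rule integral_dominated_convergence[where w = "\<lambda>t. norm (f t)"])
      show "AE t in time_measure T. (\<lambda>n. indicator {..<X n} t *\<^sub>R f t) \<longlonglongrightarrow> indicator {..<a} t *\<^sub>R f t"
        using AE_time_neq[of a]
      proof eventually_elim
        case (elim t)
        have "\<forall>\<^sub>F n in sequentially. indicator {..<X n} t *\<^sub>R f t = indicator {..<a} t *\<^sub>R f t"
        proof (cases "t < a")
          case True
          show ?thesis using order_tendstoD(1)[OF X True] by eventually_elim (use True in auto)
        next
          case False
          then have "a < t" using elim by simp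
          show ?thesis using order_tendstoD(2)[OF X \<open>a < t\<close>] by eventually_elim (use False in auto)
        qed
        then show ?case by (rule tendsto_eventually)
      qed
    qed (auto intro!: borel_measurable_integrable integrable_indicator_time f AE_I2 split: split_indicator)
  qed
qed simp

text \<open>
  An integrable function whose primitive is constant on \<open>(0,T)\<close> vanishes almost everywhere: its
  integral vanishes over half-lines, hence over Borel sets, hence over all measurable sets.
\<close>

lemma prim_const_imp_AE_0:
  fixes h :: "real \<Rightarrow> 'b::{banach, second_countable_topology}"
  assumes T: "T > 0" and h: "integrable (time_measure T) h"
    and k: "\<And>a. 0 < a \<Longrightarrow> a < T \<Longrightarrow> prim T h a = k"
  shows "AE t in time_measure T. h t = 0"
proof -
  have k': "prim T h a = k" if "a \<in> {0..T}" for a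
  proof -
    have "closure {0<..<T} = {0..T}" using T by simp
    moreover have "\<And>x. x \<in> {0<..<T} \<Longrightarrow> prim T h x = k" using k by auto
    ultimately show ?thesis
      using continuous_constant_on_closure[of "{0<..<T}" "prim T h" k] continuous_prim[OF h] that by metis
  qed
  have k0: "k = 0" using k'[of 0] prim_eq_0[of 0 T h] T by simp
  have z: "prim T h a = 0" for a
  proof -
    consider "a \<le> 0" | "a \<in> {0..T}" | "a \<ge> T" by fastforce
    then show ?thesis
      using prim_eq_0[of a T h] k'[of a] k'[of T] k0 prim_eq_total[of T a h] prim_eq_total[of T T h] T
      by cases auto
  qed
  have tot: "(LINT s|time_measure T. h s) = 0" using z[of T] prim_eq_total[of T T h] by simp
  have borel_zero: "(LINT s|time_measure T. indicator A s *\<^sub>R h s) = 0" if A: "A \<in> sets borel" for A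
  proof -
    have "sets (borel :: real measure) = sigma_sets UNIV (range lessThan)"
      by (subst borel_Iio) simp
    with A have As: "A \<in> sigma_sets UNIV (range (lessThan :: real \<Rightarrow> _))" by simp
    have G: "Int_stable (range (lessThan :: real \<Rightarrow> _))"
    proof (rule Int_stableI)
      fix x y :: "real set" assume "x \<in> range lessThan" "y \<in> range lessThan"
      then obtain a b where ab: "x = {..<a}" "y = {..<b}" by auto
      have "x \<inter> y = {..<min a b}" unfolding ab by auto
      then show "x \<inter> y \<in> range lessThan" by blast
    qed
    show ?thesis
      using G subset_UNIV[of "range lessThan", unfolded Pow_UNIV[symmetric]] As
    proof (induction rule: sigma_sets_induct_disjoint)
      case (basic A) then show ?case using z by (auto simp: prim_def)
    next
      case (compl A)
      then have "A \<in> sets borel" by (simp add: borel_Iio)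
      have "(LINT s|time_measure T. indicator (UNIV - A) s *\<^sub>R h s)
        = (LINT s|time_measure T. h s - indicator A s *\<^sub>R h s)"
        by (rule Bochner_Integration.integral_cong) (auto simp: indicator_def)
      then show ?case using compl tot h \<open>A \<in> sets borel\<close> by (simp add: integrable_indicator_time)
    next
      case (union A)
      have Ai: "A i \<in> sets borel" for i using union by (auto simp: borel_Iio image_subset_iff)
      define A' where "A' i = A i \<inter> {0<..<T}" for i
      have A': "A' i \<in> sets (time_measure T)" for i
        unfolding A'_def using Ai by (intro sets_restrict_space_iff[THEN iffD2]) auto
      have eq: "(LINT s|time_measure T. indicator (B \<inter> {0<..<T}) s *\<^sub>R h s) = (LINT s|time_measure T. indicator B s *\<^sub>R h s)" for B
        by (rule Bochner_Integration.integral_cong) (auto simp: indicator_def)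
      have "(LINT s:(\<Union>i. A' i)|time_measure T. h s) = (\<Sum>i. (LINT s:A' i|time_measure T. h s))"
      proof (rule lebesgue_integral_countable_add[OF A'])
        show "A' i \<inter> A' j = {}" if "i \<noteq> j" for i j
          using union(1) that by (auto simp: A'_def disjoint_family_on_def)
        show "set_integrable (time_measure T) (\<Union>i. A' i) h"
          unfolding set_integrable_def using A' h by (intro integrable_mult_indicator) auto
      qed
      moreover have "(LINT s:A' i|time_measure T. h s) = 0" for i
        unfolding set_lebesgue_integral_def A'_def eq using union by simp
      moreover have "(LINT s:(\<Union>i. A' i)|time_measure T. h s) = (LINT s|time_measure T. indicator (\<Union>i. A i) s *\<^sub>R h s)"
        unfolding set_lebesgue_integral_def A'_def eq[symmetric, of "\<Union>i. A i"] by simp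
      ultimately show ?case by simp
    qed auto
  qed
  interpret M: finite_measure "time_measure T" by (rule finite_time_measure)
  show ?thesis
  proof (rule M.density_zero[OF h])
    fix A assume A: "A \<in> sets (time_measure T)"
    then have "A \<in> sets lebesgue" by (auto simp: sets_restrict_space)
    then obtain C N where CN: "fsigma C" "N \<in> null_sets lebesgue" "C \<union> N = A"
      by (rule lebesgue_set_almost_fsigma)
    have C: "C \<in> sets borel" using CN(1) by (auto elim!: fsigma.cases intro!: sets.countable_UN)
    have "(LINT s|time_measure T. indicator A s *\<^sub>R h s) = (LINT s|time_measure T. indicator C s *\<^sub>R h s)"
    proof (rule integral_cong_AE)
      have "AE s in lebesgue. s \<notin> N" using CN(2) by (rule AE_not_in)
      then have "AE s in time_measure T. s \<notin> N" by (auto simp: AE_restrict_space_iff elim: eventually_mono)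
      then show "AE s in time_measure T. indicator A s *\<^sub>R h s = indicator C s *\<^sub>R h s"
        by eventually_elim (use CN(3) in \<open>auto simp: indicator_def\<close>)
    qed (intro borel_measurable_integrable integrable_mult_indicator[OF A h] integrable_indicator_time[OF h C])+
    then show "(LINT s:A|time_measure T. h s) = 0"
      unfolding set_lebesgue_integral_def using borel_zero[OF C] by simp
  qed
qed

text \<open>
  Fubini's theorem on the triangle \<open>s < t\<close>, for an arbitrary bounded bilinear product.  It takes the
  place of integration by parts.
\<close>

lemma prim_swap:
  fixes f :: "real \<Rightarrow> 'a::{banach, second_countable_topology}"
    and g :: "real \<Rightarrow> 'b::{banach, second_countable_topology}"
    and B :: "'a \<Rightarrow> 'b \<Rightarrow> 'c::{banach, second_countable_topology}"
  assumes B: "bounded_bilinear B" and f: "integrable (time_measure T) f" and g: "integrable (time_measure T) g"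
  shows "(LINT t|time_measure T. B (prim T f t) (g t))
    = (LINT s|time_measure T. B (f s) ((LINT t|time_measure T. g t) - prim T g s))"
proof -
  define M where "M = time_measure T"
  interpret M: finite_measure M unfolding M_def by (rule finite_time_measure)
  interpret pair_sigma_finite M M ..
  interpret B: bounded_bilinear B by fact
  have [measurable]: "f \<in> borel_measurable M" "g \<in> borel_measurable M" "(\<lambda>t. t) \<in> borel_measurable M"
    using f g ident_measurable_time by (auto simp: M_def)
  obtain K where K: "\<And>x y. norm (B x y) \<le> norm x * norm y * K" "K > 0" using B.pos_bounded by blast
  define F where "F s t = indicator {..<t} s *\<^sub>R B (f s) (g t)" for s t
  have cB: "(\<lambda>p. B (f (fst p)) (g (snd p))) \<in> borel_measurable (M \<Otimes>\<^sub>M M)"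
  proof -
    have "continuous_on UNIV (\<lambda>q::'a \<times> 'b. B (fst q) (snd q))"
      by (intro B.continuous_on continuous_intros)
    then have "(\<lambda>q::'a \<times> 'b. B (fst q) (snd q)) \<in> borel_measurable borel"
      by (rule borel_measurable_continuous_onI)
    then have "(\<lambda>q::'a \<times> 'b. B (fst q) (snd q)) \<circ> (\<lambda>p. (f (fst p), g (snd p))) \<in> borel_measurable (M \<Otimes>\<^sub>M M)"
      by (intro measurable_comp[where N = borel]) measurable
    then show ?thesis by (simp add: o_def)
  qed
  have meas: "case_prod F \<in> borel_measurable (M \<Otimes>\<^sub>M M)"
  proof -
    have "(\<lambda>p. (if fst p < snd p then 1 else 0 :: real)) \<in> borel_measurable (M \<Otimes>\<^sub>M M)" by measurable
    then have "(\<lambda>p. (if fst p < snd p then 1 else 0 :: real) *\<^sub>R B (f (fst p)) (g (snd p))) \<in> borel_measurable (M \<Otimes>\<^sub>M M)"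
      using cB by (rule borel_measurable_scaleR)
    moreover have "case_prod F = (\<lambda>p. (if fst p < snd p then 1 else 0 :: real) *\<^sub>R B (f (fst p)) (g (snd p)))"
      by (auto simp: F_def fun_eq_iff)
    ultimately show ?thesis by simp
  qed
  have dom: "integrable (M \<Otimes>\<^sub>M M) (\<lambda>p. norm (f (fst p)) * norm (g (snd p)) * K)"
  proof (rule Fubini_integrable)
    show "(\<lambda>p. norm (f (fst p)) * norm (g (snd p)) * K) \<in> borel_measurable (M \<Otimes>\<^sub>M M)" by measurable
    show "integrable M (\<lambda>s. \<integral>t. norm (norm (f (fst (s, t))) * norm (g (snd (s, t))) * K) \<partial>M)"
      using f K(2) by (simp add: abs_mult M_def)
    show "AE s in M. integrable M (\<lambda>t. norm (f (fst (s, t))) * norm (g (snd (s, t))) * K)"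
      using g by (simp add: M_def)
  qed
  have int: "integrable (M \<Otimes>\<^sub>M M) (case_prod F)"
  proof (rule Bochner_Integration.integrable_bound[OF dom meas], rule AE_I2)
    fix p
    have "norm (case_prod F p) \<le> norm (B (f (fst p)) (g (snd p)))"
      by (cases p) (auto simp: F_def indicator_def)
    also have "\<dots> \<le> norm (f (fst p)) * norm (g (snd p)) * K" by (rule K)
    also have "\<dots> \<le> norm (norm (f (fst p)) * norm (g (snd p)) * K)" by simp
    finally show "norm (case_prod F p) \<le> norm (norm (f (fst p)) * norm (g (snd p)) * K)" .
  qed
  have "B (prim T f t) (g t) = (LINT s|M. F s t)" for t
    using integral_bounded_linear[OF B.bounded_linear_left integrable_indicator_time[OF f, of "{..<t}"], of "g t"]
    by (simp add: prim_def F_def M_def B.scaleR_left)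
  moreover have "B (f s) ((LINT t|M. g t) - prim T g s) = (LINT t|M. F s t)" for s
  proof -
    have "B (f s) (LINT t|M. indicator {s<..} t *\<^sub>R g t) = (LINT t|M. B (f s) (indicator {s<..} t *\<^sub>R g t))"
      unfolding M_def by (rule integral_bounded_linear[OF B.bounded_linear_right integrable_indicator_time[OF g], symmetric]) simp
    also have "\<dots> = (LINT t|M. F s t)"
      by (rule Bochner_Integration.integral_cong) (auto simp: F_def B.scaleR_right indicator_def B.zero_right)
    finally show ?thesis using prim_tail[OF g] by (simp add: M_def)
  qed
  ultimately show ?thesis
    using Fubini_integral[OF int] by (simp add: M_def)
qed

lemma norm_prim_le:
  assumes "integrable (time_measure T) f"
  shows "norm (prim T f a) \<le> (LINT s|time_measure T. norm (f s))"
proof -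
  have "norm (prim T f a) \<le> (LINT s|time_measure T. norm (indicator {..<a} s *\<^sub>R f s))"
    unfolding prim_def by (rule integral_norm_bound)
  also have "\<dots> \<le> (LINT s|time_measure T. norm (f s))"
    using assms by (intro integral_mono integrable_norm integrable_indicator_time) (auto simp: indicator_def)
  finally show ?thesis .
qed

lemma borel_measurable_prim:
  assumes "integrable (time_measure T) f"
  shows "prim T f \<in> borel_measurable (time_measure T)"
  by (intro borel_measurable_time borel_measurable_continuous_onI continuous_prim assms)

lemma integrable_prim:
  assumes "integrable (time_measure T) f"
  shows "integrable (time_measure T) (prim T f)"
  by (rule finite_measure.integrable_const_bound[OF finite_time_measure])
     (auto intro!: AE_I2 norm_prim_le borel_measurable_prim assms)

lemma integrable_bounded_scaleR:
  fixes f :: "real \<Rightarrow> 'b::{banach, second_countable_topology}"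
  assumes "integrable M f" "m \<in> borel_measurable M" "AE t in M. \<bar>m t\<bar> \<le> C"
  shows "integrable M (\<lambda>t. m t *\<^sub>R f t)"
proof (rule Bochner_Integration.integrable_bound)
  show "integrable M (\<lambda>t. C * norm (f t))" using assms by simp
  show "AE t in M. norm (m t *\<^sub>R f t) \<le> norm (C * norm (f t))"
    using assms(3)
  proof eventually_elim
    case (elim t)
    then have "\<bar>m t\<bar> * norm (f t) \<le> C * norm (f t)" by (intro mult_right_mono) auto
    then show ?case by simp
  qed
qed (use assms in measurable)

lemma integral_ramp:
  fixes g :: "real \<Rightarrow> 'b::{banach, second_countable_topology}"
  assumes g: "integrable (time_measure T) g" and a: "0 < a" "a < T"
  shows "(LINT t|time_measure T. max 0 (t - a) *\<^sub>R g t)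
    = (LINT s|time_measure T. indicator {a<..} s *\<^sub>R ((LINT t|time_measure T. g t) - prim T g s))"
proof -
  have one: "integrable (time_measure T) (\<lambda>s. 1 :: real)"
    using finite_measure.integrable_const[OF finite_time_measure] .
  have ind: "integrable (time_measure T) (\<lambda>s. indicator {a<..} s :: real)"
    using integrable_indicator_time[OF one, of "{a<..}"] by simp
  have eq: "prim T (\<lambda>s. indicat_real {a<..} s) t = max 0 (t - a)" if t: "0 < t" "t < T" for t
  proof (cases "t \<le> a")
    case True
    then have "prim T (\<lambda>s. indicator {a<..} s :: real) t = 0"
      unfolding prim_def by (intro integral_eq_zero_AE AE_I2) (auto simp: indicator_def)
    then show ?thesis using True by simp
  next
    case False
    have "prim T (\<lambda>s. indicat_real {a<..} s) t
      = (LINT s|time_measure T. indicator {..<t} s *\<^sub>R (1::real) - indicator {..<a} s *\<^sub>R 1)"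
      unfolding prim_def
    proof (rule integral_cong_AE)
      show "AE s in time_measure T. indicator {..<t} s *\<^sub>R indicat_real {a<..} s
        = indicator {..<t} s *\<^sub>R 1 - indicator {..<a} s *\<^sub>R 1"
        using AE_time_neq[of a] by eventually_elim (use False in \<open>auto simp: indicator_def\<close>)
    qed (use integrable_indicator_time[OF ind] integrable_indicator_time[OF one] in
        \<open>auto intro!: borel_measurable_integrable Bochner_Integration.integrable_diff\<close>)
    also have "\<dots> = prim T (\<lambda>_. 1 :: real) t - prim T (\<lambda>_. 1) a"
      unfolding prim_def
      by (rule Bochner_Integration.integral_diff; rule integrable_indicator_time[OF one]) auto
    also have "\<dots> = t - a" using t a by (simp add: prim_const)
    finally show ?thesis using False by simp
  qed
  have "(LINT t|time_measure T. max 0 (t - a) *\<^sub>R g t)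
    = (LINT t|time_measure T. prim T (\<lambda>s. indicat_real {a<..} s) t *\<^sub>R g t)"
    by (rule Bochner_Integration.integral_cong) (auto simp: eq)
  then show ?thesis using prim_swap[OF bounded_bilinear_scaleR ind g] by simp
qed

text \<open>
  A function with an integrable weak derivative is a constant plus the primitive of that derivative.
  Testing with smoothed piecewise linear functions and letting the smoothing width tend to zero shows
  that \<open>\<Lambda>(a) = \<integral>\<^sub>a\<^sup>T f + \<integral>\<^sub>a\<^sup>T (t - a) g(t) dt\<close> is an affine function of \<open>a\<close>.  By Fubini it is also
  \<open>\<integral>\<^sub>a\<^sup>T (f(t) + \<integral>\<^sub>t\<^sup>T g) dt\<close>, so the integrand \<open>k\<close> of this last integral is constant.
\<close>
theorem weak_primitive:
  fixes f g :: "real \<Rightarrow> 'b::{real_inner, banach, second_countable_topology}"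
  assumes T: "T > 0" and f: "integrable (time_measure T) f" and g: "integrable (time_measure T) g"
    and weak: "\<And>\<phi> v. \<phi> \<in> test_functions T \<Longrightarrow>
      (LINT t|time_measure T. deriv \<phi> t * (f t \<bullet> v)) = - (LINT t|time_measure T. \<phi> t * (g t \<bullet> v))"
  obtains c where "AE t in time_measure T. f t = c + prim T g t"
proof -
  define M where "M = time_measure T"
  note fM = f[folded M_def] and gM = g[folded M_def]
  define G where "G = (LINT t|M. g t)"
  define W :: "real \<Rightarrow> real \<Rightarrow> real" where "W a t = indicator {a<..} t" for a t
  define k where "k t = f t + (G - prim T g t)" for t
  have k: "integrable M k"
    unfolding k_def[abs_def] M_def
    by (intro Bochner_Integration.integrable_add Bochner_Integration.integrable_diff f integrable_prim g
        finite_measure.integrable_const finite_time_measure)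
  have ident: "(\<lambda>t. t) \<in> borel_measurable M" unfolding M_def by (rule ident_measurable_time)
  have Wm: "W a \<in> borel_measurable M" for a
    unfolding W_def[abs_def] M_def by (intro borel_measurable_time borel_measurable_indicator) auto
  have Rm: "(\<lambda>t. max 0 (t - a)) \<in> borel_measurable M" for a using ident by measurable
  have Wi: "integrable M (\<lambda>t. W a t *\<^sub>R h t)" if "integrable M h" for a and h :: "real \<Rightarrow> 'b"
    using that integrable_indicator_time[of T h "{a<..}"] by (simp add: W_def M_def)
  have Ri: "integrable M (\<lambda>t. max 0 (t - a) *\<^sub>R g t)" if "0 < a" "a < T" for a
    by (rule integrable_bounded_scaleR[where C = T, OF gM Rm])
       (use that in \<open>auto intro!: AE_I2 simp: M_def\<close>)
  define \<Lambda> where "\<Lambda> a = (LINT t|M. W a t *\<^sub>R f t) + (LINT t|M. max 0 (t - a) *\<^sub>R g t)" for a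
  have \<Lambda>_prim: "\<Lambda> a = (LINT t|M. k t) - prim T k a" if a: "0 < a" "a < T" for a
  proof -
    have "\<Lambda> a = (LINT t|M. W a t *\<^sub>R f t) + (LINT t|M. W a t *\<^sub>R (G - prim T g t))"
      using integral_ramp[OF g a] by (simp add: \<Lambda>_def W_def M_def G_def)
    also have "\<dots> = (LINT t|M. W a t *\<^sub>R k t)"
      unfolding k_def scaleR_add_right
      by (rule Bochner_Integration.integral_add[symmetric]; rule Wi)
         (auto simp: M_def intro!: f g Bochner_Integration.integrable_diff integrable_prim
          finite_measure.integrable_const finite_time_measure)
    finally show ?thesis using prim_tail[of T k a] k by (simp add: W_def M_def)
  qed
  have affine: "(d - b) *\<^sub>R \<Lambda> a + (a - d) *\<^sub>R \<Lambda> b + (b - a) *\<^sub>R \<Lambda> d = 0"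
    if abd: "a \<in> {0<..<T}" "b \<in> {0<..<T}" "d \<in> {0<..<T}" for a b d
  proof -
    obtain C where C: "\<And>t. \<bar>deriv ramp t\<bar> \<le> C" "C \<ge> 1" using bounded_deriv_ramp by blast
    define m where "m = Max {a, b, d}"
    have "T - m > 0" using abd by (simp add: m_def)
    then obtain N where N: "inverse (real (Suc N)) < T - m" using reals_Archimedean by blast
    define \<phi> where "\<phi> n = tent (n + N) a b d" for n
    have \<phi>: "\<phi> n \<in> test_functions T" for n
      unfolding \<phi>_def
    proof (rule tent_test_function[OF abd])
      have "1 / real (Suc (n + N)) \<le> inverse (real (Suc N))" by (simp add: field_simps)
      then show "1 / real (Suc (n + N)) < T - Max {a, b, d}" using N by (simp add: m_def)
    qed
    define D where "D n t = (d - b) * deriv ramp (real (Suc (n + N)) * (t - a))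
      + (a - d) * deriv ramp (real (Suc (n + N)) * (t - b)) + (b - a) * deriv ramp (real (Suc (n + N)) * (t - d))" for n t
    have D: "deriv (\<phi> n) t = D n t" for n t
      unfolding \<phi>_def D_def by (rule DERIV_imp_deriv[OF DERIV_tent])
    define D' where "D' t = (d - b) * W a t + (a - d) * W b t + (b - a) * W d t" for t
    define \<phi>' where "\<phi>' t = (d - b) * max 0 (t - a) + (a - d) * max 0 (t - b) + (b - a) * max 0 (t - d)" for t
    define E where "E = \<bar>d - b\<bar> * C + \<bar>a - d\<bar> * C + \<bar>b - a\<bar> * C"
    have bound3: "\<bar>(d - b) * x + (a - d) * y + (b - a) * z\<bar> \<le> \<bar>d - b\<bar> * K + \<bar>a - d\<bar> * K + \<bar>b - a\<bar> * K"
      if "\<bar>x\<bar> \<le> K" "\<bar>y\<bar> \<le> K" "\<bar>z\<bar> \<le> K" for x y z K :: real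
    proof -
      have "\<bar>(d - b) * x\<bar> \<le> \<bar>d - b\<bar> * K" "\<bar>(a - d) * y\<bar> \<le> \<bar>a - d\<bar> * K" "\<bar>(b - a) * z\<bar> \<le> \<bar>b - a\<bar> * K"
        unfolding abs_mult using that by (simp_all add: mult_left_mono)
      then show ?thesis by linarith
    qed
    have Dbound: "\<bar>D n t\<bar> \<le> E" for n t
      unfolding D_def E_def by (intro bound3 C)
    define E' where "E' = \<bar>d - b\<bar> * (C * T) + \<bar>a - d\<bar> * (C * T) + \<bar>b - a\<bar> * (C * T)"
    have \<phi>bound: "\<bar>\<phi> n t\<bar> \<le> E'" if t: "t \<in> {0<..<T}" for n t
    proof -
      have "\<bar>ramp_n (n + N) (t - x)\<bar> \<le> C * T" if x: "x \<in> {0<..<T}" for x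
      proof -
        have "\<bar>ramp_n (n + N) (t - x)\<bar> \<le> C * \<bar>t - x\<bar>" by (rule ramp_n_bound[OF C(1)])
        also have "\<dots> \<le> C * T" using C(2) t x by (intro mult_left_mono) auto
        finally show ?thesis .
      qed
      then show ?thesis unfolding \<phi>_def tent_def E'_def using abd by (intro bound3) auto
    qed
    have comb: "(LINT t|M. (x *\<^sub>R p t + y *\<^sub>R q t + z *\<^sub>R r t) \<bullet> v)
      = (x *\<^sub>R (LINT t|M. p t) + y *\<^sub>R (LINT t|M. q t) + z *\<^sub>R (LINT t|M. r t)) \<bullet> v"
      if "integrable M p" "integrable M q" "integrable M r" for x y z v and p q r :: "real \<Rightarrow> 'b"
      using that by simp
    have orth: "((d - b) *\<^sub>R \<Lambda> a + (a - d) *\<^sub>R \<Lambda> b + (b - a) *\<^sub>R \<Lambda> d) \<bullet> v = 0" for v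
    proof -
      have fv: "integrable M (\<lambda>t. f t \<bullet> v)" and gv: "integrable M (\<lambda>t. g t \<bullet> v)"
        using fM gM by auto
      note [measurable] = borel_measurable_integrable[OF fv] borel_measurable_integrable[OF gv]
      have Dm [measurable]: "D n \<in> borel_measurable M" for n
      proof -
        have "continuous_on UNIV (deriv ramp)"
          using diff_times_ramp[of 1]
          by (intro differentiable_imp_continuous_on) (auto simp: differentiable_on_def intro: differentiable_at_withinI)
        then have "continuous_on UNIV (\<lambda>t. deriv ramp (real (Suc (n + N)) * (t - x)))" for x
          by (rule continuous_on_compose2) (auto intro!: continuous_intros)
        then have "continuous_on UNIV (D n)"
          unfolding D_def[abs_def] by (intro continuous_intros)
        then show ?thesis unfolding M_def by (intro borel_measurable_time borel_measurable_continuous_onI)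
      qed
      have \<phi>m [measurable]: "\<phi> n \<in> borel_measurable M" for n
      proof -
        have "continuous_on UNIV (\<phi> n)"
          unfolding \<phi>_def using DERIV_tent DERIV_isCont by (blast intro: continuous_at_imp_continuous_on)
        then show ?thesis unfolding M_def by (intro borel_measurable_time borel_measurable_continuous_onI)
      qed
      have D'm [measurable]: "D' \<in> borel_measurable M" unfolding D'_def[abs_def] using Wm by measurable
      have \<phi>'m [measurable]: "\<phi>' \<in> borel_measurable M" unfolding \<phi>'_def[abs_def] using Rm by measurable
      have lim1: "(\<lambda>n. LINT t|M. D n t * (f t \<bullet> v)) \<longlonglongrightarrow> (LINT t|M. D' t * (f t \<bullet> v))"
      proof (rule integral_dominated_convergence[where w = "\<lambda>t. E * \<bar>f t \<bullet> v\<bar>"])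
        show "AE t in M. (\<lambda>n. D n t * (f t \<bullet> v)) \<longlonglongrightarrow> D' t * (f t \<bullet> v)"
          using AE_time_neq[of a T] AE_time_neq[of b T] AE_time_neq[of d T] unfolding M_def[symmetric]
        proof eventually_elim
          case (elim t)
          have "(\<lambda>n. deriv ramp (real (Suc (n + N)) * (t - x))) \<longlonglongrightarrow> W x t" if "t \<noteq> x" for x
            using LIMSEQ_ignore_initial_segment[OF deriv_ramp_tendsto[of "t - x"], of N] that
            by (simp add: W_def indicator_def)
          then show ?case unfolding D_def D'_def using elim by (intro tendsto_intros) auto
        qed
        show "AE t in M. norm (D n t * (f t \<bullet> v)) \<le> E * \<bar>f t \<bullet> v\<bar>" for n
          by (auto simp: abs_mult intro!: AE_I2 mult_right_mono Dbound)
      qed (use fv in \<open>auto intro!: borel_measurable_times\<close>)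
      have lim2: "(\<lambda>n. LINT t|M. \<phi> n t * (g t \<bullet> v)) \<longlonglongrightarrow> (LINT t|M. \<phi>' t * (g t \<bullet> v))"
      proof (rule integral_dominated_convergence[where w = "\<lambda>t. E' * \<bar>g t \<bullet> v\<bar>"])
        show "AE t in M. (\<lambda>n. \<phi> n t * (g t \<bullet> v)) \<longlonglongrightarrow> \<phi>' t * (g t \<bullet> v)"
        proof (rule AE_I2)
          fix t
          have "(\<lambda>n. ramp_n (n + N) (t - x)) \<longlonglongrightarrow> max 0 (t - x)" for x
            by (rule LIMSEQ_ignore_initial_segment[OF ramp_n_tendsto])
          then show "(\<lambda>n. \<phi> n t * (g t \<bullet> v)) \<longlonglongrightarrow> \<phi>' t * (g t \<bullet> v)"
            unfolding \<phi>_def tent_def \<phi>'_def by (intro tendsto_intros)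
        qed
        show "AE t in M. norm (\<phi> n t * (g t \<bullet> v)) \<le> E' * \<bar>g t \<bullet> v\<bar>" for n
          by (auto simp: abs_mult M_def intro!: AE_I2 mult_right_mono \<phi>bound)
      qed (use gv in \<open>auto intro!: borel_measurable_times\<close>)
      have "(LINT t|M. D n t * (f t \<bullet> v)) = - (LINT t|M. \<phi> n t * (g t \<bullet> v))" for n
        using weak[OF \<phi>, of n v] by (simp add: D M_def)
      then have lim3: "(\<lambda>n. LINT t|M. D n t * (f t \<bullet> v)) \<longlonglongrightarrow> - (LINT t|M. \<phi>' t * (g t \<bullet> v))"
        using tendsto_minus[OF lim2] by simp
      have "(LINT t|M. D' t * (f t \<bullet> v)) + (LINT t|M. \<phi>' t * (g t \<bullet> v)) = 0"
        using LIMSEQ_unique[OF lim1 lim3] by simp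
      moreover have "(LINT t|M. D' t * (f t \<bullet> v))
        = ((d - b) *\<^sub>R (LINT t|M. W a t *\<^sub>R f t) + (a - d) *\<^sub>R (LINT t|M. W b t *\<^sub>R f t)
          + (b - a) *\<^sub>R (LINT t|M. W d t *\<^sub>R f t)) \<bullet> v"
      proof -
        have "(LINT t|M. D' t * (f t \<bullet> v)) = (LINT t|M. ((d - b) *\<^sub>R (W a t *\<^sub>R f t)
          + (a - d) *\<^sub>R (W b t *\<^sub>R f t) + (b - a) *\<^sub>R (W d t *\<^sub>R f t)) \<bullet> v)"
          by (rule Bochner_Integration.integral_cong) (simp_all add: D'_def algebra_simps inner_add_left)
        then show ?thesis using comb[OF Wi[OF fM] Wi[OF fM] Wi[OF fM]] by simp
      qed
      moreover have "(LINT t|M. \<phi>' t * (g t \<bullet> v))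
        = ((d - b) *\<^sub>R (LINT t|M. max 0 (t - a) *\<^sub>R g t) + (a - d) *\<^sub>R (LINT t|M. max 0 (t - b) *\<^sub>R g t)
          + (b - a) *\<^sub>R (LINT t|M. max 0 (t - d) *\<^sub>R g t)) \<bullet> v"
      proof -
        have "(LINT t|M. \<phi>' t * (g t \<bullet> v)) = (LINT t|M. ((d - b) *\<^sub>R (max 0 (t - a) *\<^sub>R g t)
          + (a - d) *\<^sub>R (max 0 (t - b) *\<^sub>R g t) + (b - a) *\<^sub>R (max 0 (t - d) *\<^sub>R g t)) \<bullet> v)"
          by (rule Bochner_Integration.integral_cong) (simp_all add: \<phi>'_def algebra_simps inner_add_left)
        moreover have "0 < a" "a < T" "0 < b" "b < T" "0 < d" "d < T" using abd by auto
        ultimately show ?thesis using comb[OF Ri Ri Ri] by simp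
      qed
      ultimately show ?thesis unfolding \<Lambda>_def by (simp add: algebra_simps inner_add_left)
    qed
    show ?thesis using orth[of "(d - b) *\<^sub>R \<Lambda> a + (a - d) *\<^sub>R \<Lambda> b + (b - a) *\<^sub>R \<Lambda> d"] by simp
  qed
  \<comment> \<open>\<open>b\<close> and \<open>2 * b\<close> are two reference points in \<open>(0,T)\<close>, and \<open>q\<close> is the slope of \<open>\<Lambda>\<close>\<close>
  define b where "b = T / 3"
  define q where "q = (3 / T) *\<^sub>R (\<Lambda> (2 * b) - \<Lambda> b)"
  have "AE t in M. k t + q = 0"
    unfolding M_def
  proof (rule prim_const_imp_AE_0[OF T])
    have const: "integrable (time_measure T) (\<lambda>_. q)"
      by (rule finite_measure.integrable_const[OF finite_time_measure])
    show "integrable (time_measure T) (\<lambda>t. k t + q)"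
      by (intro Bochner_Integration.integrable_add k[unfolded M_def] const)
    fix a assume a: "0 < a" "a < T"
    have "b *\<^sub>R \<Lambda> a + (a - 2 * b) *\<^sub>R \<Lambda> b + (b - a) *\<^sub>R \<Lambda> (2 * b) = 0"
      using affine[of a b "2 * b"] a T by (simp add: b_def)
    then have "b *\<^sub>R \<Lambda> a = (2 * b - a) *\<^sub>R \<Lambda> b + (a - b) *\<^sub>R \<Lambda> (2 * b)"
      by (simp add: algebra_simps)
    then have "(3 / T) *\<^sub>R (b *\<^sub>R \<Lambda> a)
      = (3 / T * (2 * b - a)) *\<^sub>R \<Lambda> b + (3 / T * (a - b)) *\<^sub>R \<Lambda> (2 * b)"
      by (simp only: scaleR_add_right scaleR_scaleR)
    moreover have "3 / T * b = 1" "3 / T * (2 * b - a) = 2 - a * (3 / T)" "3 / T * (a - b) = a * (3 / T) - 1"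
      using T by (simp_all add: b_def field_simps)
    ultimately have "\<Lambda> a = (2 - a * (3 / T)) *\<^sub>R \<Lambda> b + (a * (3 / T) - 1) *\<^sub>R \<Lambda> (2 * b)"
      by (simp only: scaleR_scaleR scaleR_one)
    also have "\<dots> = \<Lambda> b - (\<Lambda> (2 * b) - \<Lambda> b) + a *\<^sub>R q"
      unfolding q_def scaleR_scaleR scaleR_diff_left scaleR_diff_right by (simp add: scaleR_2)
    finally have "\<Lambda> a = \<Lambda> b - (\<Lambda> (2 * b) - \<Lambda> b) + a *\<^sub>R q" .
    then show "prim T (\<lambda>t. k t + q) a = (LINT t|M. k t) - (\<Lambda> b - (\<Lambda> (2 * b) - \<Lambda> b))"
      using \<Lambda>_prim[OF a] prim_add[OF k[unfolded M_def] const, of a] prim_const[of a T q] a by (simp add: algebra_simps)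
  qed
  then have "AE t in M. f t = (- q - G) + prim T g t"
  proof eventually_elim
    case (elim t)
    have "f t = (k t + q) + (- q - G) + prim T g t" by (simp add: k_def)
    then show ?case using elim by simp
  qed
  then show thesis using that unfolding M_def by blast
qed

section \<open>The space of functions with a weak time derivative\<close>

text \<open>
  The Riesz representer of a bounded linear functional on a Hilbert space.
\<close>

definition riesz_vec :: "('a::{real_inner,banach} \<Rightarrow> real) \<Rightarrow> 'a" where
  "riesz_vec f = (SOME r. \<forall>x. f x = r \<bullet> x)"

lemma riesz_vec:
  assumes "bounded_linear f" shows "riesz_vec f \<bullet> x = f x"
proof -
  interpret f: bounded_linear f by fact
  interpret hilbert_form "UNIV :: 'a set" inner by (rule hilbert_form_inner) auto
  obtain K where K: "\<And>x. norm (f x) \<le> norm x * K" using f.bounded by blast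
  obtain r where "\<And>x. f x = r \<bullet> x"
    using riesz[of f K] K by (auto simp: f.add f.scaleR nrm_def norm_eq_sqrt_inner mult.commute)
  then have "\<exists>r. \<forall>x. f x = r \<bullet> x" by blast
  then have "\<forall>x. f x = riesz_vec f \<bullet> x" unfolding riesz_vec_def by (rule someI_ex)
  then show ?thesis by metis
qed

lemma inner_eqI: "(\<And>x. y \<bullet> x = z \<bullet> x) \<Longrightarrow> y = z"
  by (metis inner_commute vector_eq_rdot)

text \<open>
  The Riesz isomorphism between the dual space and the space itself.  Derivatives in \<open>V'\<close> are treated
  as \<open>V\<close>-valued functions through this map; \<open>V\<close> is second countable, as sums of measurable functions
  require.
\<close>

definition riesz_rep :: "('a::{real_inner,banach} \<Rightarrow>\<^sub>L real) \<Rightarrow> 'a" where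
  "riesz_rep w = riesz_vec (blinfun_apply w)"

lemma riesz_rep [simp]: "riesz_rep w \<bullet> x = blinfun_apply w x"
  unfolding riesz_rep_def by (rule riesz_vec) (rule blinfun.bounded_linear_right)

lemma norm_riesz_rep: "norm (riesz_rep w) = norm w"
proof (rule antisym)
  have "norm (riesz_rep w) * norm (riesz_rep w) \<le> norm w * norm (riesz_rep w)"
    using norm_blinfun[of w "riesz_rep w"] by (simp flip: riesz_rep add: norm_eq_sqrt_inner)
  then show "norm (riesz_rep w) \<le> norm w"
    by (cases "norm (riesz_rep w) = 0") (auto simp: mult_le_cancel_right)
  show "norm w \<le> norm (riesz_rep w)"
    by (rule norm_blinfun_bound) (auto simp flip: riesz_rep intro: Cauchy_Schwarz_ineq2)
qed

lemma bounded_linear_riesz_rep: "bounded_linear riesz_rep"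
proof (rule bounded_linear_intro[where K = 1])
  show "riesz_rep (x + y) = riesz_rep x + riesz_rep y" for x y :: "'a \<Rightarrow>\<^sub>L real"
    by (rule inner_eqI) (simp add: inner_add_left blinfun.add_left)
  show "riesz_rep (c *\<^sub>R x) = c *\<^sub>R riesz_rep x" for c and x :: "'a \<Rightarrow>\<^sub>L real"
    by (rule inner_eqI) (simp add: blinfun.scaleR_left)
qed (simp add: norm_riesz_rep)

lemma bochner_L2_eq: "bochner_L2 T = L2_space (time_measure T)"
  by (auto simp: bochner_L2_def L2_space_def)

lemma integrable_L2_time:
  fixes f :: "real \<Rightarrow> 'b::{real_inner, banach, second_countable_topology}"
  assumes "f \<in> L2_space (time_measure T)"
  shows "integrable (time_measure T) f"
proof (rule Bochner_Integration.integrable_bound)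
  show "integrable (time_measure T) (\<lambda>t. 1 + (norm (f t))\<^sup>2)"
    by (intro Bochner_Integration.integrable_add L2_spaceD(2)[OF assms]
        finite_measure.integrable_const[OF finite_time_measure])
  show "AE t in time_measure T. norm (f t) \<le> norm (1 + (norm (f t))\<^sup>2)"
  proof (rule AE_I2)
    fix t
    have "norm (f t) \<le> 1 + (norm (f t))\<^sup>2"
      using sum_squares_bound[of "norm (f t)" 1] norm_ge_zero[of "f t"] by (simp, linarith)
    then show "norm (f t) \<le> norm (1 + (norm (f t))\<^sup>2)" by simp
  qed
qed (use L2_spaceD(1)[OF assms] in simp)

lemma L2_bounded_linear:
  fixes L :: "'b::real_normed_vector \<Rightarrow> 'c::real_normed_vector"
  assumes L: "bounded_linear L" and f: "f \<in> L2_space M"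
  shows "(\<lambda>t. L (f t)) \<in> L2_space M"
proof -
  interpret bounded_linear L by fact
  obtain K where K: "\<And>x. norm (L x) \<le> norm x * K" using bounded by blast
  have "L \<in> borel_measurable borel"
    by (intro borel_measurable_continuous_onI linear_continuous_on L)
  then have "(\<lambda>t. L (f t)) \<in> borel_measurable M"
    by (rule measurable_compose[OF L2_spaceD(1)[OF f]])
  then show ?thesis
    by (rule L2_space_bound[OF f, where C = K]) (use K in \<open>auto simp: mult.commute\<close>)
qed

lemma L2_continuous:
  fixes f :: "real \<Rightarrow> 'b::{real_normed_vector}"
  assumes "continuous_on UNIV f"
  shows "f \<in> L2_space (time_measure T)"
proof -
  have m: "f \<in> borel_measurable (time_measure T)"
    by (intro borel_measurable_time borel_measurable_continuous_onI assms)
  have "bounded (f ` {0..T})"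
    by (intro compact_imp_bounded compact_continuous_image continuous_on_subset[OF assms]) auto
  then obtain C where C: "\<And>t. t \<in> {0..T} \<Longrightarrow> norm (f t) \<le> C" by (fastforce simp: bounded_iff)
  have "integrable (time_measure T) (\<lambda>t. (norm (f t))\<^sup>2)"
  proof (rule finite_measure.integrable_const_bound[OF finite_time_measure, where B = "C\<^sup>2"])
    show "AE t in time_measure T. norm ((norm (f t))\<^sup>2) \<le> C\<^sup>2"
      by (rule AE_I2) (auto intro!: power_mono C)
  qed (use m in measurable)
  with m show ?thesis by (simp add: L2_space_def)
qed

lemma prim_FTC:
  fixes F :: "real \<Rightarrow> real"
  assumes F: "\<And>t. (F has_real_derivative F' t) (at t)" and c: "continuous_on UNIV F'" and a: "0 \<le> a" "a \<le> T"
  shows "prim T F' a = F a - F 0"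
proof -
  have F'm: "F' \<in> borel_measurable borel" by (rule borel_measurable_continuous_onI[OF c])
  have "prim T F' a = (LINT s|lebesgue. indicator {0<..<T} s *\<^sub>R (indicator {..<a} s *\<^sub>R F' s))"
    unfolding prim_def by (subst integral_restrict_space) auto
  also have "\<dots> = (LINT s|lebesgue. F' s * indicator {0..a} s)"
  proof (rule integral_cong_AE)
    have ne: "AE s in lebesgue. s \<noteq> x" for x :: real
      by (rule AE_I'[of "{x}"]) auto
    from ne[of a] ne[of 0] ne[of T] show "AE s in lebesgue. indicator {0<..<T} s *\<^sub>R (indicator {..<a} s *\<^sub>R F' s) = F' s * indicator {0..a} s"
      by eventually_elim (use a in \<open>auto simp: indicator_def\<close>)
  qed (use F'm in \<open>auto intro!: measurable_completion\<close>)
  also have "\<dots> = (LINT s|lborel. F' s * indicator {0..a} s)"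
    by (rule integral_completion) (use F'm in auto)
  also have "\<dots> = F a - F 0"
    by (rule integral_FTC_Icc_real[OF a(1) F]) (use c in \<open>auto simp: continuous_on_eq_continuous_at\<close>)
  finally show ?thesis .
qed

lemma AE_continuous_eq:
  fixes f g :: "real \<Rightarrow> 'b::metric_space"
  assumes T: "T > 0" and c: "continuous_on {0..T} f" "continuous_on {0..T} g"
    and ae: "AE t in time_measure T. f t = g t" and t: "t \<in> {0..T}"
  shows "f t = g t"
proof -
  define d where "d t = dist (f t) (g t)" for t
  have d: "continuous_on {0..T} d" unfolding d_def[abs_def] by (intro continuous_intros c)
  define S where "S = {0<..<T} \<inter> d -` (- {0})"
  have "open S" unfolding S_def
    by (rule continuous_open_preimage[OF continuous_on_subset[OF d]]) auto
  moreover have "negligible S"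
  proof -
    have "AE t in lebesgue. t \<in> {0<..<T} \<longrightarrow> f t = g t"
      using ae by (subst (asm) AE_restrict_space_iff) auto
    then have "AE t in lebesgue. t \<notin> S" by eventually_elim (auto simp: S_def d_def)
    moreover have "S \<in> sets lebesgue" using \<open>open S\<close> by simp
    ultimately have "S \<in> null_sets lebesgue"
      using AE_iff_null_sets[of S lebesgue] by simp
    then show ?thesis by (simp add: negligible_iff_null_sets)
  qed
  ultimately have "S = {}" using open_not_negligible by blast
  then have "d s = 0" if "s \<in> {0<..<T}" for s using that by (auto simp: S_def)
  moreover have "closure {0<..<T} = {0..T}" using T by simp
  ultimately have "d t = 0"
    using continuous_constant_on_closure[of "{0<..<T}" d 0 t] d t by simp
  then show ?thesis by (simp add: d_def)
qed

lemma test_functionD: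
  assumes \<phi>: "\<phi> \<in> test_functions T" and T: "T > 0"
  shows "(\<phi> has_real_derivative deriv \<phi> t) (at t)" "continuous_on UNIV \<phi>" "continuous_on UNIV (deriv \<phi>)"
    "\<phi> 0 = 0" "\<phi> T = 0"
proof -
  have n: "((deriv ^^ n) \<phi>) differentiable (at t)" for n t using \<phi> by (simp add: test_functions_def)
  have D0: "\<phi> differentiable (at t)" for t using n[of 0] by simp
  have D1: "deriv \<phi> differentiable (at t)" for t using n[of 1] by simp
  show "(\<phi> has_real_derivative deriv \<phi> t) (at t)" by (rule differentiable_DERIV[OF D0])
  show "continuous_on UNIV \<phi>"
    by (intro differentiable_imp_continuous_on) (auto simp: differentiable_on_def D0)
  show "continuous_on UNIV (deriv \<phi>)"
    by (intro differentiable_imp_continuous_on) (auto simp: differentiable_on_def D1)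
  have "\<phi> t = 0" if "t \<notin> {0<..<T}" for t
    using \<phi> that closure_subset[of "{t. \<phi> t \<noteq> 0}"] by (auto simp: test_functions_def)
  then show "\<phi> 0 = 0" "\<phi> T = 0" by auto
qed

text \<open>
  The Gelfand triple given by \<open>j\<close>, with a time horizon \<open>T\<close>.
\<close>

locale gelfand_time =
  fixes j :: "'v::{real_inner,banach,second_countable_topology} \<Rightarrow> 'h::{real_inner,banach,second_countable_topology}"
    and T :: real
  assumes T: "T > 0" and gelfand: "gelfand_triple j"
begin

lemma j: "bounded_linear j" using gelfand by (simp add: gelfand_triple_def)

sublocale j: bounded_linear j by (rule j)

lemma j_eq_0: "j u = 0 \<longleftrightarrow> u = 0"
  using gelfand j.zero by (metis gelfand_triple_def injD)

abbreviation M :: "real measure" where "M \<equiv> time_measure T"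

sublocale Y: hilbert_form "L2_space M :: (real \<Rightarrow> 'v) set" "L2_inner M" by (rule hilbert_form_L2)

text \<open>
  The operator on \<open>V\<close> obtained by following \<open>j\<close> with its adjoint.  It is symmetric and injective.
\<close>

definition K :: "'v \<Rightarrow> 'v" where "K u = riesz_vec (\<lambda>v. j u \<bullet> j v)"

lemma K_inner: "K u \<bullet> v = j u \<bullet> j v"
  unfolding K_def by (rule riesz_vec) (intro bounded_linear_compose[OF bounded_linear_inner_right j])

lemma K_sym: "u \<bullet> K v = K u \<bullet> v"
  by (metis K_inner inner_commute)

lemma K: "bounded_linear K"
proof -
  obtain C where C: "\<And>x. norm (j x) \<le> norm x * C" "0 \<le> C" using j.nonneg_bounded by auto
  show ?thesis
  proof (rule bounded_linear_intro[where K = "C * C"])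
    show "K (x + y) = K x + K y" for x y by (rule inner_eqI) (simp add: K_inner inner_add_left j.add)
    show "K (c *\<^sub>R x) = c *\<^sub>R K x" for c x by (rule inner_eqI) (simp add: K_inner j.scaleR)
    show "norm (K x) \<le> norm x * (C * C)" for x
    proof -
      have "norm (K x) * norm (K x) = j x \<bullet> j (K x)"
        by (simp flip: K_inner power2_eq_square power2_norm_eq_inner)
      also have "\<dots> \<le> norm (j x) * norm (j (K x))" by (rule norm_cauchy_schwarz)
      also have "\<dots> \<le> (norm x * C) * (norm (K x) * C)" using C by (intro mult_mono) auto
      finally have "norm (K x) * norm (K x) \<le> (norm x * (C * C)) * norm (K x)" by (simp add: algebra_simps)
      then show ?thesis using C by (cases "norm (K x) = 0") (auto simp: mult_le_cancel_right)
    qed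
  qed
qed

sublocale K: bounded_linear K by (rule K)

text \<open>
  The square integrable function \<open>z\<close> represents the weak time derivative of \<open>u\<close> in \<open>V'\<close>, that is,
  \<open>K u\<close> has weak derivative \<open>z\<close>.
\<close>
definition vderiv :: "(real \<Rightarrow> 'v) \<Rightarrow> (real \<Rightarrow> 'v) \<Rightarrow> bool" where
  "vderiv u z \<longleftrightarrow> u \<in> L2_space M \<and> z \<in> L2_space M \<and>
    (\<forall>\<phi>\<in>test_functions T. \<forall>v. (LINT t|M. deriv \<phi> t * (K (u t) \<bullet> v)) = - (LINT t|M. \<phi> t * (z t \<bullet> v)))"

lemma vderiv_primitive:
  assumes "vderiv u z"
  obtains c where "AE t in M. K (u t) = c + prim T z t"
proof (rule weak_primitive[OF T])
  show "integrable M (\<lambda>t. K (u t))" "integrable M z"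
    using assms by (auto simp: vderiv_def intro!: integrable_L2_time L2_bounded_linear[OF K])
qed (use assms in \<open>auto simp: vderiv_def\<close>)

lemma L2_test:
  assumes "\<phi> \<in> test_functions T"
  shows "(\<lambda>t. \<phi> t *\<^sub>R v) \<in> L2_space M" "(\<lambda>t. deriv \<phi> t *\<^sub>R v) \<in> L2_space M"
  by (intro L2_continuous continuous_intros test_functionD[OF assms T])+

lemma vderiv_L2_inner:
  "vderiv u z \<longleftrightarrow> u \<in> L2_space M \<and> z \<in> L2_space M \<and>
    (\<forall>\<phi>\<in>test_functions T. \<forall>v. L2_inner M u (\<lambda>t. deriv \<phi> t *\<^sub>R K v) = - L2_inner M z (\<lambda>t. \<phi> t *\<^sub>R v))"
  by (simp add: vderiv_def L2_inner_def K_sym)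

lemma vderiv_add: "vderiv u z \<Longrightarrow> vderiv u' z' \<Longrightarrow> vderiv (u + u') (z + z')"
  unfolding vderiv_L2_inner by (auto simp: Y.bilin L2_test)

lemma vderiv_scale: "vderiv u z \<Longrightarrow> vderiv (c *\<^sub>R u) (c *\<^sub>R z)"
  unfolding vderiv_L2_inner by (auto simp: Y.bilin L2_test)

lemma vderiv_unique:
  assumes "vderiv u z" "vderiv u' z'" "AE t in M. u t = u' t"
  shows "AE t in M. z t = z' t"
proof -
  have L: "u \<in> L2_space M" "z \<in> L2_space M" "u' \<in> L2_space M" "z' \<in> L2_space M"
    using assms by (auto simp: vderiv_def)
  have i: "integrable M z" "integrable M z'" using L by (auto intro: integrable_L2_time)
  obtain c where c: "AE t in M. K (u t) = c + prim T z t" using vderiv_primitive[OF assms(1)] by blast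
  obtain c' where c': "AE t in M. K (u' t) = c' + prim T z' t" using vderiv_primitive[OF assms(2)] by blast
  have ae: "AE t in M. prim T z t - prim T z' t = c' - c"
    using c c' assms(3)
  proof eventually_elim
    case (elim t)
    then have "c + prim T z t = c' + prim T z' t" by simp
    then show ?case by (simp add: algebra_simps)
  qed
  have "AE t in M. z t - z' t = 0"
  proof (rule prim_const_imp_AE_0[OF T])
    show "integrable M (\<lambda>t. z t - z' t)" using i by simp
    fix a assume a: "0 < a" "a < T"
    have "prim T z a - prim T z' a = c' - c"
      by (rule AE_continuous_eq[OF T _ _ ae]) (use a i in \<open>auto intro!: continuous_intros continuous_prim\<close>)
    then show "prim T (\<lambda>t. z t - z' t) a = c' - c" using prim_diff[OF i] by simp
  qed
  then show ?thesis by simp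
qed

text \<open>
  The functions with a weak time derivative; \<open>space_X_eq\<close> identifies this set with \<open>space_X\<close>.
\<close>

definition X :: "(real \<Rightarrow> 'v) set" where "X = {u. \<exists>z. vderiv u z}"

text \<open>
  The chosen weak time derivative, represented in \<open>V\<close>; it is unique up to null sets.
\<close>

definition Dt :: "(real \<Rightarrow> 'v) \<Rightarrow> real \<Rightarrow> 'v" where "Dt u t = riesz_rep (time_deriv T j u t)"

lemma riesz_rep_weak_derivative:
  assumes "u \<in> L2_space M" "w \<in> bochner_L2 T" "weak_derivative T j u w"
  shows "vderiv u (\<lambda>t. riesz_rep (w t))"
  using assms L2_bounded_linear[OF bounded_linear_riesz_rep, of w M]
  by (simp add: vderiv_def bochner_L2_eq weak_derivative_def K_inner)

lemma weak_derivative_blinfun: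
  assumes "vderiv u z"
  shows "(\<lambda>t. blinfun_inner_left (z t)) \<in> bochner_L2 T" "weak_derivative T j u (\<lambda>t. blinfun_inner_left (z t))"
  using assms L2_bounded_linear[OF bounded_linear_blinfun_inner_left, of z M]
  by (auto simp: vderiv_def bochner_L2_eq weak_derivative_def K_inner inner_commute[of _ "z _"])

lemma space_X_eq: "space_X T j = X"
proof (intro equalityI subsetI)
  fix u assume "u \<in> space_X T j"
  then show "u \<in> X"
    unfolding X_def using riesz_rep_weak_derivative by (fastforce simp: space_X_def bochner_L2_eq)
next
  fix u assume "u \<in> X"
  then obtain z where z: "vderiv u z" by (auto simp: X_def)
  then show "u \<in> space_X T j"
    unfolding space_X_def using weak_derivative_blinfun[OF z] by (auto simp: vderiv_def bochner_L2_eq)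
qed

lemma vderiv_Dt:
  assumes "u \<in> X" shows "vderiv u (Dt u)"
proof -
  have u: "u \<in> space_X T j" using assms by (simp add: space_X_eq)
  then have "\<exists>w. w \<in> bochner_L2 T \<and> weak_derivative T j u w" by (auto simp: space_X_def)
  from someI_ex[OF this] have "time_deriv T j u \<in> bochner_L2 T \<and> weak_derivative T j u (time_deriv T j u)"
    by (simp add: time_deriv_def)
  then show ?thesis
    using u riesz_rep_weak_derivative by (simp add: Dt_def[abs_def] space_X_def bochner_L2_eq)
qed

lemma X_L2: "u \<in> X \<Longrightarrow> u \<in> L2_space M" and Dt_L2: "u \<in> X \<Longrightarrow> Dt u \<in> L2_space M"
  using vderiv_Dt by (auto simp: vderiv_def)

lemma Dt_eq: "vderiv u z \<Longrightarrow> AE t in M. Dt u t = z t"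
  by (rule vderiv_unique[OF vderiv_Dt]) (auto simp: X_def)

lemma subspace_X: "subspace X"
proof (rule subspaceI)
  have "vderiv 0 0" by (simp add: vderiv_L2_inner subspace_0[OF subspace_L2] L2_test)
  then show "0 \<in> X" by (auto simp: X_def)
qed (auto simp: X_def intro: vderiv_add vderiv_scale)

lemma X_intros [simp, intro]: "u \<in> X \<Longrightarrow> v \<in> X \<Longrightarrow> u + v \<in> X" "u \<in> X \<Longrightarrow> v \<in> X \<Longrightarrow> u - v \<in> X"
  "u \<in> X \<Longrightarrow> c *\<^sub>R u \<in> X" "0 \<in> X"
  using subspace_X by (auto simp: subspace_add subspace_diff subspace_scale subspace_0)

lemma Dt_add: "u \<in> X \<Longrightarrow> v \<in> X \<Longrightarrow> AE t in M. Dt (u + v) t = (Dt u + Dt v) t"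
  by (intro Dt_eq vderiv_add vderiv_Dt)

lemma Dt_scale: "u \<in> X \<Longrightarrow> AE t in M. Dt (c *\<^sub>R u) t = (c *\<^sub>R Dt u) t"
  by (intro Dt_eq vderiv_scale vderiv_Dt)

lemma Dt_diff: assumes "u \<in> X" "v \<in> X" shows "AE t in M. Dt (u - v) t = (Dt u - Dt v) t"
  using Dt_add[OF assms(1) X_intros(3)[OF assms(2), of "-1"]] Dt_scale[OF assms(2), of "-1"]
  by eventually_elim simp

lemma L2_inner_Dt_add: "u \<in> X \<Longrightarrow> v \<in> X \<Longrightarrow> f \<in> L2_space M \<Longrightarrow>
    L2_inner M (Dt (u + v)) f = L2_inner M (Dt u) f + L2_inner M (Dt v) f"
  using L2_inner_cong_AE[of "Dt (u + v)" M f "Dt u + Dt v" f] Dt_add[of u v]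
  by (simp add: Y.bilin Dt_L2)

lemma L2_inner_Dt_scale: "u \<in> X \<Longrightarrow> f \<in> L2_space M \<Longrightarrow>
    L2_inner M (Dt (c *\<^sub>R u)) f = c * L2_inner M (Dt u) f"
  using L2_inner_cong_AE[of "Dt (c *\<^sub>R u)" M f "c *\<^sub>R Dt u" f] Dt_scale[of u c]
  by (simp add: Y.bilin Dt_L2)

text \<open>
  The standard inner product of \<open>X\<close>, with \<open>V\<close> and \<open>V'\<close> carrying their own norms.
\<close>

definition graph_form :: "(real \<Rightarrow> 'v) \<Rightarrow> (real \<Rightarrow> 'v) \<Rightarrow> real" where
  "graph_form u v = L2_inner M u v + L2_inner M (Dt u) (Dt v)"

sublocale X: psd_form X graph_form
proof
  show "subspace X" by (rule subspace_X)
  show "graph_form u v = graph_form v u" if "u \<in> X" "v \<in> X" for u v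
    using Y.sym[of u v] Y.sym[of "Dt u" "Dt v"] that by (simp add: graph_form_def X_L2 Dt_L2)
qed (auto simp: graph_form_def Y.bilin L2_inner_Dt_add L2_inner_Dt_scale Dt_L2 X_L2 Y.nonneg algebra_simps)

lemma nrm_Dt_diff: assumes "u \<in> X" "v \<in> X" shows "Y.nrm (Dt (u - v)) = Y.nrm (Dt u - Dt v)"
proof -
  have L: "Dt (u - v) \<in> L2_space M" "Dt u - Dt v \<in> L2_space M" using assms by (auto simp: Dt_L2)
  have "L2_inner M (Dt (u - v)) (Dt (u - v)) = L2_inner M (Dt u - Dt v) (Dt u - Dt v)"
    by (rule L2_inner_cong_AE) (use L Dt_diff[OF assms] in auto)
  then show ?thesis unfolding Y.nrm_def by (rule arg_cong)
qed

lemma nrm_le_graph: "u \<in> X \<Longrightarrow> Y.nrm u \<le> X.nrm u" "u \<in> X \<Longrightarrow> Y.nrm (Dt u) \<le> X.nrm u"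
  by (auto simp: Y.nrm_def X.nrm_def graph_form_def Y.nonneg X_L2 Dt_L2)

theorem graph_complete: "hilbert_form X graph_form"
proof
  fix U :: "nat \<Rightarrow> real \<Rightarrow> 'v"
  assume U: "\<And>n. U n \<in> X" and C: "\<And>e. e > 0 \<Longrightarrow> \<exists>N. \<forall>m\<ge>N. \<forall>n\<ge>N. X.nrm (U m - U n) < e"
  have "\<exists>u\<in>L2_space M. (\<lambda>n. Y.nrm (U n - u)) \<longlonglongrightarrow> 0"
  proof (rule Y.complete)
    show "U n \<in> L2_space M" for n using U X_L2 by blast
    show "\<exists>N. \<forall>m\<ge>N. \<forall>n\<ge>N. Y.nrm (U m - U n) < e" if pe: "e > 0" for e
    proof -
      obtain N where N: "\<And>m n. m \<ge> N \<Longrightarrow> n \<ge> N \<Longrightarrow> X.nrm (U m - U n) < e" using C[OF pe] by blast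
      have "Y.nrm (U m - U n) < e" if "m \<ge> N" "n \<ge> N" for m n
        using nrm_le_graph(1)[OF X_intros(2)[OF U U]] N[OF that] by (rule le_less_trans)
      then show ?thesis by blast
    qed
  qed
  then obtain u where u: "u \<in> L2_space M" "(\<lambda>n. Y.nrm (U n - u)) \<longlonglongrightarrow> 0" by blast
  have "\<exists>z\<in>L2_space M. (\<lambda>n. Y.nrm (Dt (U n) - z)) \<longlonglongrightarrow> 0"
  proof (rule Y.complete)
    show "Dt (U n) \<in> L2_space M" for n using U Dt_L2 by blast
    show "\<exists>N. \<forall>m\<ge>N. \<forall>n\<ge>N. Y.nrm (Dt (U m) - Dt (U n)) < e" if pe: "e > 0" for e
    proof -
      obtain N where N: "\<And>m n. m \<ge> N \<Longrightarrow> n \<ge> N \<Longrightarrow> X.nrm (U m - U n) < e" using C[OF pe] by blast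
      have "Y.nrm (Dt (U m) - Dt (U n)) < e" if "m \<ge> N" "n \<ge> N" for m n
        unfolding nrm_Dt_diff[OF U U, symmetric]
        using nrm_le_graph(2)[OF X_intros(2)[OF U U]] N[OF that] by (rule le_less_trans)
      then show ?thesis by blast
    qed
  qed
  then obtain z where z: "z \<in> L2_space M" "(\<lambda>n. Y.nrm (Dt (U n) - z)) \<longlonglongrightarrow> 0" by blast
  have const: "(\<lambda>n::nat. Y.nrm (f - f)) \<longlonglongrightarrow> 0" for f :: "real \<Rightarrow> 'v"
    unfolding diff_self Y.nrm_def by (simp add: Y.zero_left)
  have vd: "vderiv u z"
    unfolding vderiv_L2_inner
  proof (intro conjI u z ballI allI)
    fix \<phi> v assume \<phi>: "\<phi> \<in> test_functions T"
    have "(\<lambda>n. L2_inner M (U n) (\<lambda>t. deriv \<phi> t *\<^sub>R K v)) \<longlonglongrightarrow> L2_inner M u (\<lambda>t. deriv \<phi> t *\<^sub>R K v)"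
      by (rule Y.form_tendsto[OF _ u _ _ const]) (use U X_L2 L2_test[OF \<phi>] in auto)
    moreover have "(\<lambda>n. - L2_inner M (Dt (U n)) (\<lambda>t. \<phi> t *\<^sub>R v)) \<longlonglongrightarrow> - L2_inner M z (\<lambda>t. \<phi> t *\<^sub>R v)"
      by (intro tendsto_minus Y.form_tendsto[OF _ z _ _ const]) (use U Dt_L2 L2_test[OF \<phi>] in auto)
    moreover have "L2_inner M (U n) (\<lambda>t. deriv \<phi> t *\<^sub>R K v) = - L2_inner M (Dt (U n)) (\<lambda>t. \<phi> t *\<^sub>R v)" for n
      using vderiv_Dt[OF U] \<phi> by (simp add: vderiv_L2_inner)
    ultimately show "L2_inner M u (\<lambda>t. deriv \<phi> t *\<^sub>R K v) = - L2_inner M z (\<lambda>t. \<phi> t *\<^sub>R v)"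
      using LIMSEQ_unique by fastforce
  qed
  then have uX: "u \<in> X" by (auto simp: X_def)
  have "(\<lambda>n. X.nrm (U n - u)) \<longlonglongrightarrow> 0"
  proof -
    have eq: "X.nrm (U n - u) = sqrt ((Y.nrm (U n - u))\<^sup>2 + (Y.nrm (Dt (U n) - z))\<^sup>2)" for n
    proof -
      have "AE t in M. Dt (U n - u) t = (Dt (U n) - z) t"
        using Dt_diff[OF U uX] Dt_eq[OF vd] by eventually_elim simp
      then have "L2_inner M (Dt (U n - u)) (Dt (U n - u)) = L2_inner M (Dt (U n) - z) (Dt (U n) - z)"
        by (intro L2_inner_cong_AE) (use U uX z Dt_L2 in auto)
      then show ?thesis
        using U u z by (simp add: X.nrm_def graph_form_def Y.nrm_sq X_L2 Dt_L2)
    qed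
    have "(\<lambda>n. sqrt ((Y.nrm (U n - u))\<^sup>2 + (Y.nrm (Dt (U n) - z))\<^sup>2)) \<longlonglongrightarrow> sqrt (0\<^sup>2 + 0\<^sup>2)"
      by (intro tendsto_intros u z)
    then show ?thesis by (simp add: eq)
  qed
  with uX show "\<exists>u\<in>X. (\<lambda>n. X.nrm (U n - u)) \<longlonglongrightarrow> 0" by blast
qed

end

section \<open>Density of smooth functions, traces and the energy identity\<close>

lemma measure_time: "T > 0 \<Longrightarrow> measure (time_measure T) {0<..<T} = T"
  by (subst measure_restrict_space) auto

lemma integral_prim:
  fixes f :: "real \<Rightarrow> 'b::{real_inner, banach, second_countable_topology}"
  assumes T: "T > 0" and f: "integrable (time_measure T) f"
  shows "(LINT t|time_measure T. prim T f t) = (LINT s|time_measure T. (T - s) *\<^sub>R f s)"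
proof -
  have one: "integrable (time_measure T) (\<lambda>s. 1 :: real)"
    using finite_measure.integrable_const[OF finite_time_measure] .
  have "bounded_bilinear (\<lambda>x (r::real). r *\<^sub>R (x::'b))"
    by (rule bounded_bilinear.flip[OF bounded_bilinear_scaleR])
  from prim_swap[OF this f one]
  have "(LINT t|time_measure T. prim T f t) = (LINT s|time_measure T. (T - prim T (\<lambda>_. 1) s) *\<^sub>R f s)"
    by (simp add: measure_time T)
  also have "\<dots> = (LINT s|time_measure T. (T - s) *\<^sub>R f s)"
    by (rule Bochner_Integration.integral_cong) (auto simp: prim_const)
  finally show ?thesis .
qed

lemma prim_self_inner:
  fixes f :: "real \<Rightarrow> 'b::{real_inner, banach, second_countable_topology}"
  assumes "integrable (time_measure T) f" "integrable (time_measure T) g"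
  shows "(LINT t|time_measure T. prim T f t \<bullet> g t) = (LINT s|time_measure T. f s \<bullet> ((LINT t|time_measure T. g t) - prim T g s))"
  by (rule prim_swap[OF bounded_bilinear_inner assms])

context gelfand_time
begin

text \<open>
  Continuously differentiable functions of time on the whole line, with values in \<open>V\<close>.
\<close>

definition C1 :: "(real \<Rightarrow> 'v) set" where
  "C1 = {z. \<exists>z'. (\<forall>t. (z has_vector_derivative z' t) (at t)) \<and> continuous_on UNIV z'}"

lemma C1_continuous:
  assumes "z \<in> C1" shows "continuous_on A z"
proof -
  obtain z' where z: "\<And>t. (z has_vector_derivative z' t) (at t)" using assms by (auto simp: C1_def)
  show ?thesis
    by (intro continuous_at_imp_continuous_on ballI has_vector_derivative_continuous[OF z])
qed

lemma subspace_C1: "subspace C1"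
proof (rule subspaceI)
  show "0 \<in> C1" by (auto simp: C1_def zero_fun_def intro!: exI[of _ "\<lambda>_. 0"])
  fix x y assume "x \<in> C1" "y \<in> C1"
  then obtain x' y' where "\<And>t. (x has_vector_derivative x' t) (at t)" "continuous_on UNIV x'"
    "\<And>t. (y has_vector_derivative y' t) (at t)" "continuous_on UNIV y'" by (auto simp: C1_def)
  then show "x + y \<in> C1" unfolding C1_def plus_fun_def
    by (auto intro!: exI[of _ "\<lambda>t. x' t + y' t"] has_vector_derivative_add continuous_intros)
next
  fix c and x assume "x \<in> C1"
  then obtain x' where x': "\<And>t. (x has_vector_derivative x' t) (at t)" "continuous_on UNIV x'"
    by (auto simp: C1_def)
  have "((\<lambda>t. c *\<^sub>R x t) has_vector_derivative c *\<^sub>R x' t) (at t)" for t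
    by (rule bounded_linear.has_vector_derivative[OF bounded_linear_scaleR_right x'(1)])
  then show "c *\<^sub>R x \<in> C1" unfolding C1_def scaleR_fun_def
    using x'(2) by (auto intro!: exI[of _ "\<lambda>t. c *\<^sub>R x' t"] continuous_intros)
qed

lemma integral_derivative:
  assumes "\<And>t. (F has_real_derivative F' t) (at t)" "continuous_on UNIV F'"
  shows "(LINT t|M. F' t) = F T - F 0"
  using prim_FTC[of F F' T T] prim_eq_total[of T T F'] assms T by simp

lemma C1_vderiv:
  assumes z: "\<And>t. (z has_vector_derivative z' t) (at t)" and z': "continuous_on UNIV z'"
  shows "vderiv z (\<lambda>t. K (z' t))"
proof -
  have cz: "continuous_on UNIV z"
    by (intro continuous_at_imp_continuous_on ballI has_vector_derivative_continuous[OF z])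
  have cKz': "continuous_on UNIV (\<lambda>t. K (z' t))"
    by (rule K.continuous_on[OF z'])
  show ?thesis
    unfolding vderiv_def
  proof (intro conjI ballI allI)
    show "z \<in> L2_space M" "(\<lambda>t. K (z' t)) \<in> L2_space M"
      by (intro L2_continuous cz cKz')+
    fix \<phi> v assume \<phi>: "\<phi> \<in> test_functions T"
    note \<phi>' = test_functionD[OF \<phi> T]
    have Kz: "((\<lambda>t. K (z t) \<bullet> v) has_real_derivative K (z' t) \<bullet> v) (at t)" for t
      unfolding has_real_derivative_iff_has_vector_derivative
      by (rule bounded_linear.has_vector_derivative[OF bounded_linear_compose[OF bounded_linear_inner_left K] z])
    have "((\<lambda>t. \<phi> t * (K (z t) \<bullet> v)) has_real_derivative deriv \<phi> t * (K (z t) \<bullet> v) + K (z' t) \<bullet> v * \<phi> t) (at t)" for t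
      by (rule DERIV_mult[OF \<phi>'(1) Kz])
    from integral_derivative[OF this]
    have "(LINT t|M. deriv \<phi> t * (K (z t) \<bullet> v) + K (z' t) \<bullet> v * \<phi> t) = 0"
      using \<phi>'(4,5) by (simp add: continuous_intros \<phi>'(2,3) K.continuous_on cz z')
    moreover have "integrable M (\<lambda>t. deriv \<phi> t * (K (z t) \<bullet> v))" "integrable M (\<lambda>t. \<phi> t * (K (z' t) \<bullet> v))"
      by (intro integrable_L2_time L2_continuous continuous_intros \<phi>' K.continuous_on cz z')+
    ultimately show "(LINT t|M. deriv \<phi> t * (K (z t) \<bullet> v)) = - (LINT t|M. \<phi> t * (K (z' t) \<bullet> v))"
      by (simp add: mult.commute[of "\<phi> _"])
  qed
qed

lemma C1_subset_X: "C1 \<subseteq> X"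
  using C1_vderiv by (auto simp: C1_def X_def)

text \<open>
  The orthogonality argument behind the density of \<open>C1\<close>.  The test functions \<open>\<psi> v\<close> with smooth \<open>\<psi>\<close> of
  compact support give \<open>K w = c + prim T u\<close>, the choice \<open>\<psi> = 1\<close> gives \<open>\<integral> u = 0\<close>, and \<open>\<psi> = t\<close> then
  gives \<open>c = 0\<close>.
\<close>

lemma graph_orthogonal_null:
  assumes u: "u \<in> X" and orth: "\<And>z. z \<in> C1 \<Longrightarrow> graph_form u z = 0"
  shows "graph_form u u = 0"
proof -
  define w where "w = Dt u"
  have uL: "u \<in> L2_space M" and wL: "w \<in> L2_space M" using u by (auto simp: w_def X_L2 Dt_L2)
  have ui: "integrable M u" and wi: "integrable M w" using uL wL by (auto intro: integrable_L2_time)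
  have KwL: "(\<lambda>t. K (w t)) \<in> L2_space M" and KuL: "(\<lambda>t. K (u t)) \<in> L2_space M"
    using uL wL by (auto intro: L2_bounded_linear[OF K])
  have Kwi: "integrable M (\<lambda>t. K (w t))" using KwL by (rule integrable_L2_time)
  have ode: "(LINT t|M. \<psi>' t * (K (w t) \<bullet> v)) = - (LINT t|M. \<psi> t * (u t \<bullet> v))"
    if \<psi>: "\<And>t. (\<psi> has_real_derivative \<psi>' t) (at t)" "continuous_on UNIV \<psi>'" for \<psi> \<psi>' v
  proof -
    have d: "((\<lambda>t. \<psi> t *\<^sub>R v) has_vector_derivative \<psi>' t *\<^sub>R v) (at t)" for t
      using \<psi>(1) has_vector_derivative_scaleR[OF \<psi>(1)[of t] has_vector_derivative_const[of v]] by simp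
    have c: "continuous_on UNIV (\<lambda>t. \<psi>' t *\<^sub>R v)" by (intro continuous_intros \<psi>)
    have zX: "(\<lambda>t. \<psi> t *\<^sub>R v) \<in> C1"
      unfolding C1_def using d c by (intro CollectI exI[of _ "\<lambda>t. \<psi>' t *\<^sub>R v"]) blast
    have vd: "vderiv (\<lambda>t. \<psi> t *\<^sub>R v) (\<lambda>t. K (\<psi>' t *\<^sub>R v))" by (rule C1_vderiv[OF d c])
    have "0 = L2_inner M u (\<lambda>t. \<psi> t *\<^sub>R v) + L2_inner M w (Dt (\<lambda>t. \<psi> t *\<^sub>R v))"
      using orth[OF zX] by (simp add: graph_form_def w_def)
    also have "L2_inner M w (Dt (\<lambda>t. \<psi> t *\<^sub>R v)) = L2_inner M w (\<lambda>t. K (\<psi>' t *\<^sub>R v))"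
      by (rule L2_inner_cong_AE) (use wL vd Dt_eq[OF vd] zX C1_subset_X Dt_L2 in \<open>auto simp: vderiv_def\<close>)
    finally show ?thesis by (simp add: L2_inner_def K.scaleR K_sym)
  qed
  obtain c where c: "AE t in M. K (w t) = c + prim T u t"
  proof (rule weak_primitive[OF T Kwi ui])
    show "(LINT t|M. deriv \<phi> t * (K (w t) \<bullet> v)) = - (LINT t|M. \<phi> t * (u t \<bullet> v))"
      if \<phi>: "\<phi> \<in> test_functions T" for \<phi> v
      by (rule ode) (use test_functionD[OF \<phi> T] in auto)
  qed
  have int_u: "(LINT t|M. u t) = 0"
  proof (rule inner_eqI)
    fix v
    have "(LINT t|M. u t \<bullet> v) = 0" using ode[of "\<lambda>_. 1" "\<lambda>_. 0" v] by simp
    then show "(LINT t|M. u t) \<bullet> v = 0 \<bullet> v" using ui by simp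
  qed
  have Uc: "continuous_on A (prim T u)" for A by (rule continuous_prim[OF ui])
  have UL: "prim T u \<in> L2_space M" by (rule L2_continuous[OF Uc])
  have Ui: "integrable M (prim T u)" by (rule integrable_L2_time[OF UL])
  have tu: "integrable M (\<lambda>t. t *\<^sub>R u t)"
    by (rule integrable_bounded_scaleR[OF ui ident_measurable_time, where C = T]) (auto intro!: AE_I2)
  have c0: "c = 0"
  proof -
    have "(LINT t|M. K (w t)) = (LINT t|M. c + prim T u t)"
      by (rule integral_cong_AE)
         (use c Kwi Ui finite_measure.integrable_const[OF finite_time_measure] in \<open>auto intro!: borel_measurable_integrable\<close>)
    also have "\<dots> = (LINT t|M. c) + (LINT t|M. prim T u t)"
      by (intro Bochner_Integration.integral_add Ui finite_measure.integrable_const[OF finite_time_measure])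
    also have "(LINT t|M. c) = T *\<^sub>R c" by (simp add: measure_time T)
    also have "(LINT t|M. prim T u t) = T *\<^sub>R (LINT t|M. u t) - (LINT t|M. t *\<^sub>R u t)"
      using ui tu by (simp add: integral_prim[OF T ui] scaleR_diff_left)
    finally have 1: "(LINT t|M. K (w t)) = T *\<^sub>R c - (LINT t|M. t *\<^sub>R u t)" by (simp add: int_u)
    have "(LINT t|M. K (w t)) = - (LINT t|M. t *\<^sub>R u t)"
    proof (rule inner_eqI)
      fix v
      have "(LINT t|M. K (w t) \<bullet> v) = - (LINT t|M. t *\<^sub>R u t \<bullet> v)"
        using ode[of "\<lambda>t. t" "\<lambda>_. 1" v] by simp
      then show "(LINT t|M. K (w t)) \<bullet> v = - (LINT t|M. t *\<^sub>R u t) \<bullet> v"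
        using Kwi tu by (simp del: inner_scaleR_left)
    qed
    with 1 have "T *\<^sub>R c = 0" by simp
    then show ?thesis using T by simp
  qed
  obtain k where k: "AE t in M. K (u t) = k + prim T w t"
    using vderiv_primitive[OF vderiv_Dt[OF u]] by (auto simp: w_def)
  have KK: "AE t in M. K (K (u t)) = K k + prim T (prim T u) t"
    using k
  proof eventually_elim
    case (elim t)
    have "prim T (\<lambda>t. K (w t)) t = prim T (prim T u) t"
      by (rule prim_cong_AE[OF Kwi Ui]) (use c c0 in auto)
    then show ?case using elim by (simp add: K.add prim_bounded_linear[OF K wi])
  qed
  have Pc: "continuous_on A (prim T (prim T u))" for A by (rule continuous_prim[OF Ui])
  \<comment> \<open>integration by parts, in the form \<open>prim_self_inner\<close>\<close>
  have "L2_inner M (\<lambda>t. K (u t)) (\<lambda>t. K (u t)) = (LINT t|M. K (K (u t)) \<bullet> u t)"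
    by (simp add: L2_inner_def K_sym)
  also have "\<dots> = (LINT t|M. K k \<bullet> u t + prim T (prim T u) t \<bullet> u t)"
  proof (rule integral_cong_AE)
    show "AE t in M. K (K (u t)) \<bullet> u t = K k \<bullet> u t + prim T (prim T u) t \<bullet> u t"
      using KK by eventually_elim (simp add: inner_add_left)
  qed (use L2_spaceD(1)[OF uL] L2_spaceD(1)[OF L2_bounded_linear[OF K KuL]] L2_spaceD(1)[OF L2_continuous[OF Pc]]
      in \<open>auto intro!: borel_measurable_inner borel_measurable_add\<close>)
  also have "\<dots> = (LINT t|M. K k \<bullet> u t) + (LINT t|M. prim T (prim T u) t \<bullet> u t)"
    using ui L2_inner_integrable[OF L2_continuous[OF Pc] uL] by simp
  also have "\<dots> = - L2_inner M (prim T u) (prim T u)"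
    using ui by (simp add: prim_self_inner[OF Ui ui] int_u L2_inner_def)
  finally have "L2_inner M (\<lambda>t. K (u t)) (\<lambda>t. K (u t)) = 0"
    using Y.nonneg[OF UL] Y.nonneg[OF KuL] by simp
  then have "AE t in M. K (u t) = 0" using L2_null_iff[OF KuL] by simp
  then have u0: "AE t in M. u t = 0"
  proof eventually_elim
    case (elim t)
    have "j (u t) \<bullet> j (u t) = 0" using K_inner[of "u t" "u t"] elim by simp
    then show ?case by (simp add: j_eq_0)
  qed
  have "vderiv 0 0" using vderiv_scale[OF vderiv_Dt[OF u], of 0] by simp
  then have "AE t in M. w t = 0"
    using vderiv_unique[OF vderiv_Dt[OF u], of 0 0] u0 by (simp add: w_def)
  then show ?thesis
    using u0 L2_null_iff[OF uL] L2_null_iff[OF wL] by (simp add: graph_form_def w_def)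
qed

sublocale X: hilbert_form X graph_form by (rule graph_complete)

lemma C1_dense:
  assumes "u \<in> X"
  obtains z where "\<And>n::nat. z n \<in> C1" "(\<lambda>n. X.nrm (z n - u)) \<longlonglongrightarrow> 0"
  using X.dense_if_orthogonal_null[OF subspace_C1 C1_subset_X graph_orthogonal_null assms] by blast

lemma C1_energy:
  assumes "z \<in> C1" and t: "0 \<le> t" "t \<le> T"
  shows "(norm (j (z t)))\<^sup>2 = (norm (j (z 0)))\<^sup>2 + 2 * prim T (\<lambda>s. Dt z s \<bullet> z s) t"
proof -
  obtain z' where z: "\<And>t. (z has_vector_derivative z' t) (at t)" and z': "continuous_on UNIV z'"
    using assms(1) by (auto simp: C1_def)
  have cz: "continuous_on UNIV z"
    by (intro continuous_at_imp_continuous_on ballI has_vector_derivative_continuous[OF z])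
  have zX: "z \<in> X" using assms(1) C1_subset_X by auto
  have jz: "((\<lambda>t. j (z t)) has_vector_derivative j (z' t)) (at t)" for t
    by (rule j.has_vector_derivative[OF z])
  have "((\<lambda>t. j (z t) \<bullet> j (z t)) has_real_derivative 2 * (K (z' t) \<bullet> z t)) (at t)" for t
  proof -
    have "((\<lambda>t. j (z t) \<bullet> j (z t)) has_vector_derivative j (z t) \<bullet> j (z' t) + j (z' t) \<bullet> j (z t)) (at t)"
      by (rule bounded_bilinear.has_vector_derivative[OF bounded_bilinear_inner jz jz])
    then show ?thesis
      by (simp add: has_real_derivative_iff_has_vector_derivative K_inner inner_commute[of "j (z t)" "j (z' t)"])
  qed
  then have "prim T (\<lambda>t. 2 * (K (z' t) \<bullet> z t)) t = j (z t) \<bullet> j (z t) - j (z 0) \<bullet> j (z 0)"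
    by (rule prim_FTC) (use t in \<open>auto intro!: continuous_intros K.continuous_on cz z'\<close>)
  moreover have "prim T (\<lambda>t. 2 * (K (z' t) \<bullet> z t)) t = 2 * prim T (\<lambda>t. K (z' t) \<bullet> z t) t"
    by (rule prim_bounded_linear[OF bounded_linear_mult_right])
       (intro integrable_L2_time L2_continuous continuous_intros K.continuous_on cz z')
  moreover have "prim T (\<lambda>t. K (z' t) \<bullet> z t) t = prim T (\<lambda>s. Dt z s \<bullet> z s) t"
  proof (rule prim_cong_AE)
    show "AE s in M. K (z' s) \<bullet> z s = Dt z s \<bullet> z s"
      using Dt_eq[OF C1_vderiv[OF z z']] by eventually_elim simp
    show "integrable M (\<lambda>t. K (z' t) \<bullet> z t)"
      by (intro integrable_L2_time L2_continuous continuous_intros K.continuous_on cz z')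
    show "integrable M (\<lambda>s. Dt z s \<bullet> z s)" by (rule L2_inner_integrable[OF Dt_L2[OF zX] X_L2[OF zX]])
  qed
  ultimately show ?thesis by (simp add: power2_norm_eq_inner)
qed

lemma Dt_inner_integral_le:
  assumes u: "u \<in> X"
  shows "2 * \<bar>prim T (\<lambda>s. Dt u s \<bullet> u s) t\<bar> \<le> graph_form u u"
proof -
  have i: "integrable M (\<lambda>s. Dt u s \<bullet> u s)" by (rule L2_inner_integrable[OF Dt_L2[OF u] X_L2[OF u]])
  have "2 * \<bar>prim T (\<lambda>s. Dt u s \<bullet> u s) t\<bar> \<le> 2 * (LINT s|M. \<bar>Dt u s \<bullet> u s\<bar>)"
    using norm_prim_le[OF i, of t] by simp
  also have "\<dots> = (LINT s|M. 2 * \<bar>Dt u s \<bullet> u s\<bar>)" by simp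
  also have "\<dots> \<le> (LINT s|M. (norm (u s))\<^sup>2 + (norm (Dt u s))\<^sup>2)"
  proof (rule integral_mono)
    fix s
    have "\<bar>Dt u s \<bullet> u s\<bar> \<le> norm (Dt u s) * norm (u s)" by (rule Cauchy_Schwarz_ineq2)
    then show "2 * \<bar>Dt u s \<bullet> u s\<bar> \<le> (norm (u s))\<^sup>2 + (norm (Dt u s))\<^sup>2"
      using sum_squares_bound[of "norm (Dt u s)" "norm (u s)"] unfolding mult.assoc by linarith
  qed (use i L2_spaceD(2)[OF X_L2[OF u]] L2_spaceD(2)[OF Dt_L2[OF u]] in auto)
  also have "\<dots> = graph_form u u"
    using L2_spaceD(2)[OF X_L2[OF u]] L2_spaceD(2)[OF Dt_L2[OF u]] by (simp add: graph_form_def L2_inner_self)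
  finally show ?thesis .
qed

text \<open>
  A constant in the trace inequality \<open>|u(t)|\<^sup>2 \<le> C \<parallel>u\<parallel>\<^sup>2\<close> for the standard norm, first for functions in
  \<open>C1\<close>; by density it serves for all of \<open>X\<close>.
\<close>

definition trace_const :: real where
  "trace_const = (SOME C. \<forall>z\<in>C1. \<forall>t\<in>{0..T}. (norm (j (z t)))\<^sup>2 \<le> C * graph_form z z)"

lemma C1_trace_bound:
  assumes "z \<in> C1" "t \<in> {0..T}"
  shows "(norm (j (z t)))\<^sup>2 \<le> trace_const * graph_form z z"
proof -
  obtain B where B: "\<And>x. norm (j x) \<le> norm x * B" "0 \<le> B" using j.nonneg_bounded by auto
  have "(norm (j (z t)))\<^sup>2 \<le> (B\<^sup>2 / T + 2) * graph_form z z" if z: "z \<in> C1" and t: "t \<in> {0..T}" for z t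
  proof -
    have zX: "z \<in> X" using z C1_subset_X by auto
    \<comment> \<open>this bound is integrated over \<open>s\<close> below\<close>
    have le: "(norm (j (z t)))\<^sup>2 \<le> B\<^sup>2 * (norm (z s))\<^sup>2 + 2 * graph_form z z" if s: "s \<in> {0..T}" for s
    proof -
      have "(norm (j (z s)))\<^sup>2 \<le> (norm (z s) * B)\<^sup>2" by (rule power_mono[OF B(1)]) simp
      moreover have "(norm (j (z t)))\<^sup>2 - (norm (j (z s)))\<^sup>2
        = 2 * prim T (\<lambda>s. Dt z s \<bullet> z s) t - 2 * prim T (\<lambda>s. Dt z s \<bullet> z s) s"
        using C1_energy[OF z, of t] C1_energy[OF z, of s] t s by simp
      moreover have "2 * \<bar>prim T (\<lambda>s. Dt z s \<bullet> z s) t\<bar> \<le> graph_form z z"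
        "2 * \<bar>prim T (\<lambda>s. Dt z s \<bullet> z s) s\<bar> \<le> graph_form z z"
        using Dt_inner_integral_le[OF zX] by auto
      ultimately show ?thesis by (simp add: power_mult_distrib mult.commute)
    qed
    have one: "integrable M (\<lambda>s. c :: real)" for c
      using finite_measure.integrable_const[OF finite_time_measure] .
    have const: "(LINT s|M. c) = T * c" for c :: real
      by (simp add: measure_time T)
    have "T * (norm (j (z t)))\<^sup>2 = (LINT s|M. (norm (j (z t)))\<^sup>2)" by (simp only: const)
    also have "\<dots> \<le> (LINT s|M. B\<^sup>2 * (norm (z s))\<^sup>2 + 2 * graph_form z z)"
      using le by (intro integral_mono Bochner_Integration.integrable_add integrable_mult_right one
          L2_spaceD(2)[OF X_L2[OF zX]]) auto
    also have "\<dots> = B\<^sup>2 * L2_inner M z z + T * (2 * graph_form z z)"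
      using L2_spaceD(2)[OF X_L2[OF zX]] one[of "2 * graph_form z z"] const[of "2 * graph_form z z"]
      by (simp add: L2_inner_self del: integral_const_real lebesgue_integral_const)
    also have "\<dots> \<le> B\<^sup>2 * graph_form z z + T * (2 * graph_form z z)"
      using Y.nonneg[OF Dt_L2[OF zX]] by (intro add_right_mono mult_left_mono) (auto simp: graph_form_def)
    finally show ?thesis using T by (simp add: field_simps)
  qed
  then have "\<exists>C. \<forall>z\<in>C1. \<forall>t\<in>{0..T}. (norm (j (z t)))\<^sup>2 \<le> C * graph_form z z" by blast
  from someI_ex[OF this] show ?thesis using assms unfolding trace_const_def by blast
qed

text \<open>
  The trace theorem: approximants in \<open>C1\<close> are uniformly Cauchy in \<open>H\<close> by the trace inequality, and the
  energy identity passes to the limit.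
\<close>

lemma trace_exists:
  assumes u: "u \<in> X"
  shows "\<exists>c. continuous_on {0..T} c \<and> (AE t in M. c t = j (u t)) \<and>
    (\<forall>t\<in>{0..T}. (norm (c t))\<^sup>2 \<le> trace_const * graph_form u u) \<and>
    (norm (c T))\<^sup>2 - (norm (c 0))\<^sup>2 = 2 * L2_inner M (Dt u) u"
proof -
  obtain z where z: "\<And>n. z n \<in> C1" and lim: "(\<lambda>n. X.nrm (z n - u)) \<longlonglongrightarrow> 0"
    using C1_dense[OF u] by blast
  have zX: "z n \<in> X" for n using z C1_subset_X by auto
  have diff_C1: "z m - z n \<in> C1" for m n using z subspace_C1 subspace_diff by blast
  have jc: "continuous_on A (\<lambda>t. j (z n t))" for n A
  proof -
    show ?thesis by (rule j.continuous_on[OF C1_continuous[OF z]])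
  qed
  have C: "uniformly_Cauchy_on {0..T} (\<lambda>n t. j (z n t))"
  proof (rule uniformly_Cauchy_onI)
    fix e :: real assume e: "e > 0"
    define q where "q = sqrt \<bar>trace_const\<bar> + 1"
    define d where "d = e / (2 * q)"
    have sp: "q > 0" unfolding q_def by (rule add_nonneg_pos) auto
    have d: "d > 0" using e sp by (simp add: d_def)
    obtain N where N: "\<And>n. n \<ge> N \<Longrightarrow> X.nrm (z n - u) < d"
      using order_tendstoD(2)[OF lim d] by (auto simp: eventually_sequentially)
    have "dist (j (z m t)) (j (z n t)) < e" if t: "t \<in> {0..T}" and mn: "m \<ge> N" "n \<ge> N" for t m n
    proof -
      have "X.nrm (z m - z n) \<le> X.nrm (z m - u) + X.nrm (u - z n)"
        by (rule X.triangle_sub[OF zX u zX])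
      then have nr: "X.nrm (z m - z n) < 2 * d"
        using N[OF mn(1)] N[OF mn(2)] X.nrm_minus[OF u zX, of n] by simp
      have "(norm (j ((z m - z n) t)))\<^sup>2 \<le> trace_const * graph_form (z m - z n) (z m - z n)"
        by (rule C1_trace_bound[OF diff_C1 t])
      also have "\<dots> \<le> \<bar>trace_const\<bar> * graph_form (z m - z n) (z m - z n)"
        using X.nonneg[OF X_intros(2)[OF zX zX]] by (intro mult_right_mono) auto
      finally have "norm (j ((z m - z n) t)) \<le> sqrt (\<bar>trace_const\<bar> * graph_form (z m - z n) (z m - z n))"
        by (rule real_le_rsqrt)
      also have "\<dots> = sqrt \<bar>trace_const\<bar> * X.nrm (z m - z n)" by (simp add: real_sqrt_mult X.nrm_def)
      also have "\<dots> \<le> q * X.nrm (z m - z n)"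
        unfolding q_def by (intro mult_right_mono) (auto intro!: X.nrm_nonneg zX)
      also have "\<dots> < q * (2 * d)" using nr sp by (rule mult_strict_left_mono)
      also have "\<dots> = e" using sp by (simp add: d_def)
      finally show ?thesis by (simp add: dist_norm j.diff)
    qed
    then show "\<exists>M. \<forall>x\<in>{0..T}. \<forall>m\<ge>M. \<forall>n\<ge>M. dist (j (z m x)) (j (z n x)) < e" by blast
  qed
  obtain c where c: "uniform_limit {0..T} (\<lambda>n t. j (z n t)) c sequentially"
    using Cauchy_uniformly_convergent[OF C] by (auto simp: uniformly_convergent_on_def)
  have cl: "(\<lambda>n. j (z n t)) \<longlonglongrightarrow> c t" if "t \<in> {0..T}" for t
    using tendsto_uniform_limitI[OF c that] .
  show ?thesis
  proof (intro exI conjI ballI)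
    show "continuous_on {0..T} c"
      by (rule uniform_limit_theorem[OF always_eventually c]) (simp_all add: jc)
    have "(\<lambda>n. Y.nrm (z n - u)) \<longlonglongrightarrow> 0"
    proof (rule real_tendsto_sandwich[OF _ _ tendsto_const lim])
      show "\<forall>\<^sub>F n in sequentially. 0 \<le> Y.nrm (z n - u)"
        by (simp add: X_L2[OF zX] X_L2[OF u])
      show "\<forall>\<^sub>F n in sequentially. Y.nrm (z n - u) \<le> X.nrm (z n - u)"
        by (simp add: nrm_le_graph(1) zX u)
    qed
    note Ylim = this
    have "(\<lambda>n. L2_inner M (z n - u) (z n - u)) \<longlonglongrightarrow> 0"
      by (rule Y.nrm_sq_tendsto_0[OF _ _ Ylim]) (use zX u X_L2 in auto)
    then obtain r where r: "strict_mono r" "AE t in M. (\<lambda>n. z (r n) t) \<longlonglongrightarrow> u t"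
      using L2_tendsto_AE_subseq[of z M u] zX u X_L2 by blast
    have sp: "AE t in M. t \<in> {0..T}" by (rule AE_I2) auto
    show "AE t in M. c t = j (u t)"
      using r(2) sp
    proof eventually_elim
      case (elim t)
      have "(\<lambda>n. j (z (r n) t)) \<longlonglongrightarrow> j (u t)" by (rule j.tendsto[OF elim(1)])
      moreover have "(\<lambda>n. j (z (r n) t)) \<longlonglongrightarrow> c t"
        using LIMSEQ_subseq_LIMSEQ[OF cl[OF elim(2)] r(1)] by (simp add: o_def)
      ultimately show ?case by (metis LIMSEQ_unique)
    qed
    have Glim: "(\<lambda>n. graph_form (z n) (z n)) \<longlonglongrightarrow> graph_form u u"
      by (rule X.form_tendsto[OF zX u lim zX u lim])
    show "(norm (c t))\<^sup>2 \<le> trace_const * graph_form u u" if t: "t \<in> {0..T}" for t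
    proof (rule LIMSEQ_le)
      show "(\<lambda>n. (norm (j (z n t)))\<^sup>2) \<longlonglongrightarrow> (norm (c t))\<^sup>2" by (intro tendsto_intros cl t)
      show "(\<lambda>n. trace_const * graph_form (z n) (z n)) \<longlonglongrightarrow> trace_const * graph_form u u"
        by (intro tendsto_intros Glim)
    qed (use C1_trace_bound[OF z t] in blast)
    have Dlim: "(\<lambda>n. Y.nrm (Dt (z n) - Dt u)) \<longlonglongrightarrow> 0"
    proof (rule real_tendsto_sandwich[OF _ _ tendsto_const lim])
      show "\<forall>\<^sub>F n in sequentially. 0 \<le> Y.nrm (Dt (z n) - Dt u)"
        by (simp add: Dt_L2[OF zX] Dt_L2[OF u])
      show "\<forall>\<^sub>F n in sequentially. Y.nrm (Dt (z n) - Dt u) \<le> X.nrm (z n - u)"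
        unfolding nrm_Dt_diff[OF zX u, symmetric] by (simp add: nrm_le_graph(2) zX u)
    qed
    have "(\<lambda>n. 2 * L2_inner M (Dt (z n)) (z n)) \<longlonglongrightarrow> 2 * L2_inner M (Dt u) u"
      by (intro tendsto_intros Y.form_tendsto Dlim Ylim Dt_L2 X_L2 zX u)
    moreover have "2 * L2_inner M (Dt (z n)) (z n) = (norm (j (z n T)))\<^sup>2 - (norm (j (z n 0)))\<^sup>2" for n
      using C1_energy[OF z, of T n] T by (simp add: prim_eq_total L2_inner_def)
    ultimately have "(\<lambda>n. (norm (j (z n T)))\<^sup>2 - (norm (j (z n 0)))\<^sup>2) \<longlonglongrightarrow> 2 * L2_inner M (Dt u) u" by simp
    moreover have "(\<lambda>n. (norm (j (z n T)))\<^sup>2 - (norm (j (z n 0)))\<^sup>2) \<longlonglongrightarrow> (norm (c T))\<^sup>2 - (norm (c 0))\<^sup>2"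
      using T by (intro tendsto_intros cl) auto
    ultimately show "(norm (c T))\<^sup>2 - (norm (c 0))\<^sup>2 = 2 * L2_inner M (Dt u) u"
      using LIMSEQ_unique by blast
  qed
qed

abbreviation tr :: "(real \<Rightarrow> 'v) \<Rightarrow> real \<Rightarrow> 'h" where "tr \<equiv> time_trace T j"

lemma trace:
  assumes u: "u \<in> X"
  shows "continuous_on {0..T} (tr u)" "AE t in M. tr u t = j (u t)"
proof -
  have "\<exists>c. continuous_on {0..T} c \<and> (AE s in M. c s = j (u s))"
    using trace_exists[OF u] by blast
  from someI_ex[OF this] show "continuous_on {0..T} (tr u)" "AE t in M. tr u t = j (u t)"
    by (auto simp: time_trace_def)
qed

lemma trace_eqI:
  assumes "u \<in> X" "continuous_on {0..T} c" "AE t in M. c t = j (u t)" "t \<in> {0..T}"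
  shows "tr u t = c t"
proof (rule AE_continuous_eq[OF T trace(1)[OF assms(1)] assms(2) _ assms(4)])
  show "AE t in M. tr u t = c t" using trace(2)[OF assms(1)] assms(3) by eventually_elim simp
qed

lemma trace_add:
  assumes "u \<in> X" "v \<in> X" "t \<in> {0..T}" shows "tr (u + v) t = tr u t + tr v t"
proof (rule trace_eqI)
  show "AE t in M. tr u t + tr v t = j ((u + v) t)"
    using trace(2)[OF assms(1)] trace(2)[OF assms(2)] by eventually_elim (simp add: j.add)
qed (intro assms X_intros continuous_intros trace)+

lemma trace_scale:
  assumes "u \<in> X" "t \<in> {0..T}" shows "tr (c *\<^sub>R u) t = c *\<^sub>R tr u t"
proof (rule trace_eqI)
  show "AE t in M. c *\<^sub>R tr u t = j ((c *\<^sub>R u) t)"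
    using trace(2)[OF assms(1)] by eventually_elim (simp add: j.scaleR)
qed (intro assms X_intros continuous_intros trace)+

lemma trace_bound:
  assumes "u \<in> X" "t \<in> {0..T}" shows "(norm (tr u t))\<^sup>2 \<le> trace_const * graph_form u u"
proof -
  obtain c where c: "continuous_on {0..T} c" "AE t in M. c t = j (u t)"
    "\<And>t. t \<in> {0..T} \<Longrightarrow> (norm (c t))\<^sup>2 \<le> trace_const * graph_form u u"
    "(norm (c T))\<^sup>2 - (norm (c 0))\<^sup>2 = 2 * L2_inner M (Dt u) u"
    using trace_exists[OF assms(1)] by blast
  show ?thesis using trace_eqI[OF assms(1) c(1,2) assms(2)] c(3)[OF assms(2)] by simp
qed

lemma energy_identity:
  assumes "u \<in> X" shows "(norm (tr u T))\<^sup>2 - (norm (tr u 0))\<^sup>2 = 2 * L2_inner M (Dt u) u"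
proof -
  obtain c where c: "continuous_on {0..T} c" "AE t in M. c t = j (u t)"
    "\<And>t. t \<in> {0..T} \<Longrightarrow> (norm (c t))\<^sup>2 \<le> trace_const * graph_form u u"
    "(norm (c T))\<^sup>2 - (norm (c 0))\<^sup>2 = 2 * L2_inner M (Dt u) u"
    using trace_exists[OF assms] by blast
  show ?thesis using trace_eqI[OF assms c(1,2), of 0] trace_eqI[OF assms c(1,2), of T] c(4) T by simp
qed

end

section \<open>Measurability of the time-dependent form\<close>

lemma complete_time_measure: "complete_measure (time_measure T)"
proof
  fix A B assume "A \<subseteq> B" "B \<in> null_sets (time_measure T)"
  then have "B \<in> null_sets lebesgue" "A \<subseteq> {0<..<T}"
    using null_sets_restrict_space[of "{0<..<T}" lebesgue B] null_setsD2[of B "time_measure T"]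
    by (auto dest: sets.sets_into_space)
  then have "A \<in> sets lebesgue" using \<open>A \<subseteq> B\<close> completion.complete by blast
  then show "A \<in> sets (time_measure T)"
    using \<open>A \<subseteq> {0<..<T}\<close> by (intro sets_restrict_space_iff[THEN iffD2]) auto
qed

lemma measurable_time_cong_AE:
  assumes g: "g \<in> borel_measurable (time_measure T)" and ae: "AE t in time_measure T. f t = g t"
  shows "f \<in> borel_measurable (time_measure T)"
proof (rule measurableI)
  interpret complete_measure "time_measure T" by (rule complete_time_measure)
  fix A :: "'a set" assume A: "A \<in> sets borel"
  show "f -` A \<inter> space (time_measure T) \<in> sets (time_measure T)"
  proof (rule in_sets_AE)
    show "g -` A \<inter> space (time_measure T) \<in> sets (time_measure T)" by (rule measurable_sets[OF g A])
    have sp: "AE t in time_measure T. t \<in> space (time_measure T)" by (rule AE_space)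
    show "AE t in time_measure T. (t \<in> g -` A \<inter> space (time_measure T)) = (t \<in> f -` A \<inter> space (time_measure T))"
      using ae sp by eventually_elim auto
  qed auto
qed auto

lemma measurable_time_LIMSEQ_AE:
  fixes f :: "nat \<Rightarrow> real \<Rightarrow> real"
  assumes f: "\<And>n. f n \<in> borel_measurable (time_measure T)"
    and lim: "AE t in time_measure T. (\<lambda>n. f n t) \<longlonglongrightarrow> g t"
  shows "g \<in> borel_measurable (time_measure T)"
proof (rule measurable_time_cong_AE)
  show "(\<lambda>t. lim (\<lambda>n. f n t)) \<in> borel_measurable (time_measure T)" using f by measurable
  show "AE t in time_measure T. g t = lim (\<lambda>n. f n t)"
    using lim by eventually_elim (simp add: limI)
qed

text \<open>
  Evaluating the form along measurable functions gives a measurable function: it is the limit of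
  evaluations along simple functions.  The limit exists only almost everywhere, so completeness of the
  Lebesgue measure is used.
\<close>

lemma measurable_form:
  fixes a :: "real \<Rightarrow> 'v::{real_inner, second_countable_topology} \<Rightarrow> 'v \<Rightarrow> real"
  assumes a: "parabolic_form T a"
    and u: "u \<in> borel_measurable (time_measure T)" and v: "v \<in> borel_measurable (time_measure T)"
  shows "(\<lambda>t. a t (u t) (v t)) \<in> borel_measurable (time_measure T)"
proof -
  define M where "M = time_measure T"
  have am: "(\<lambda>t. a t x y) \<in> borel_measurable M" for x y using a by (simp add: parabolic_form_def M_def)
  obtain C where bil: "AE t in M. bilinear (a t)" and C: "AE t in M. \<forall>x y. \<bar>a t x y\<bar> \<le> C * norm x * norm y"
    using a unfolding parabolic_form_def M_def by blast
  obtain F where F: "\<And>i. simple_function M (F i)" "\<And>x. x \<in> space M \<Longrightarrow> (\<lambda>i. F i x) \<longlonglongrightarrow> u x"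
    using borel_measurable_implies_sequence_metric[of u M 0] u unfolding M_def by metis
  obtain G where G: "\<And>i. simple_function M (G i)" "\<And>x. x \<in> space M \<Longrightarrow> (\<lambda>i. G i x) \<longlonglongrightarrow> v x"
    using borel_measurable_implies_sequence_metric[of v M 0] v unfolding M_def by metis
  have "(\<lambda>t. a t (F i t) (G i t)) \<in> borel_measurable M" for i
  proof -
    have fin: "finite (F i ` space M)" "finite (G i ` space M)"
      using F(1)[of i] G(1)[of i] by (auto simp: simple_function_def)
    have "(\<lambda>t. \<Sum>x\<in>F i ` space M. \<Sum>y\<in>G i ` space M.
        indicator (F i -` {x} \<inter> space M) t * indicator (G i -` {y} \<inter> space M) t * a t x y) \<in> borel_measurable M"
      using simple_functionD(2)[OF F(1)[of i]] simple_functionD(2)[OF G(1)[of i]]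
      by (intro borel_measurable_sum borel_measurable_times borel_measurable_indicator am) auto
    then show ?thesis
    proof (rule measurable_cong[THEN iffD1, rotated])
      fix t assume t: "t \<in> space M"
      have "(\<Sum>x\<in>F i ` space M. \<Sum>y\<in>G i ` space M.
          indicator (F i -` {x} \<inter> space M) t * indicator (G i -` {y} \<inter> space M) t * a t x y)
        = (\<Sum>x\<in>F i ` space M. \<Sum>y\<in>G i ` space M. if y = G i t then (if x = F i t then a t x y else 0) else 0)"
        using t by (intro sum.cong refl) (auto simp: indicator_def)
      also have "\<dots> = a t (F i t) (G i t)" using fin t by (simp add: sum.delta)
      finally show "(\<Sum>x\<in>F i ` space M. \<Sum>y\<in>G i ` space M.
          indicator (F i -` {x} \<inter> space M) t * indicator (G i -` {y} \<inter> space M) t * a t x y) = a t (F i t) (G i t)" .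
    qed
  qed
  moreover have "AE t in M. (\<lambda>i. a t (F i t) (G i t)) \<longlonglongrightarrow> a t (u t) (v t)"
    using bil C AE_space[of M]
  proof eventually_elim
    case (elim t)
    have "bounded_bilinear (a t)"

    proof
      show "\<exists>K. \<forall>x y. norm (a t x y) \<le> norm x * norm y * K"
        using elim(2) by (intro exI[of _ C]) (simp add: mult.commute[of C] mult.assoc mult.left_commute)
    qed (use elim(1) in \<open>auto simp: bilinear_ladd bilinear_radd bilinear_lmul bilinear_rmul\<close>)
    then show ?case by (rule bounded_bilinear.tendsto[OF _ F(2)[OF elim(3)] G(2)[OF elim(3)]])
  qed
  ultimately show ?thesis unfolding M_def by (rule measurable_time_LIMSEQ_AE)
qed

section \<open>The spatial form and the energy norms\<close>

lemma closed_subspace_ofD: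
  assumes "closed_subspace_of S N W"
  shows "subspace W" "W \<subseteq> S"
    "\<And>w u. \<lbrakk>\<And>n::nat. w n \<in> W; u \<in> S; (\<lambda>n. N (w n - u)) \<longlonglongrightarrow> 0\<rbrakk> \<Longrightarrow> u \<in> W"
proof -
  show "subspace W" "W \<subseteq> S"
    using assms by (auto simp: closed_subspace_of_def subspace_def zero_fun_def plus_fun_def scaleR_fun_def)
  fix w :: "nat \<Rightarrow> real \<Rightarrow> 'a" and u
  assume "\<And>n. w n \<in> W" "u \<in> S" "(\<lambda>n. N (w n - u)) \<longlonglongrightarrow> 0"
  then show "u \<in> W"
    using assms unfolding closed_subspace_of_def fun_diff_def by blast
qed

text \<open>
  The parabolic problem with a symmetric spatial operator; symmetry is required of the form integrated
  over time.
\<close>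

locale parabolic = gelfand_time j T
  for j :: "'v::{real_inner,banach,second_countable_topology} \<Rightarrow> 'h::{real_inner,banach,second_countable_topology}"
    and T :: real +
  fixes a :: "real \<Rightarrow> 'v \<Rightarrow> 'v \<Rightarrow> real"
  assumes form: "parabolic_form T a"
    and symmetric: "\<forall>u\<in>space_Y T. \<forall>v\<in>space_Y T. op_A T a u v = op_As T a u v"
begin

lemma space_Y_eq: "space_Y T = L2_space M" by (simp add: space_Y_def bochner_L2_eq)

lemma integrable_form:
  assumes u: "u \<in> L2_space M" and v: "v \<in> L2_space M"
  shows "integrable M (\<lambda>t. a t (u t) (v t))"
proof -
  obtain C where C: "AE t in M. \<forall>x y. \<bar>a t x y\<bar> \<le> C * norm x * norm y"
    using form unfolding parabolic_form_def by blast
  show ?thesis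
  proof (rule Bochner_Integration.integrable_bound)
    show "integrable M (\<lambda>t. \<bar>C\<bar> * ((norm (u t))\<^sup>2 + (norm (v t))\<^sup>2))"
      using L2_spaceD(2)[OF u] L2_spaceD(2)[OF v] by simp
    show "(\<lambda>t. a t (u t) (v t)) \<in> borel_measurable M"
      by (rule measurable_form[OF form L2_spaceD(1)[OF u] L2_spaceD(1)[OF v]])
    show "AE t in M. norm (a t (u t) (v t)) \<le> norm (\<bar>C\<bar> * ((norm (u t))\<^sup>2 + (norm (v t))\<^sup>2))"
      using C
    proof eventually_elim
      case (elim t)
      have "\<bar>a t (u t) (v t)\<bar> \<le> C * (norm (u t) * norm (v t))" using elim by (simp add: mult.assoc)
      also have "\<dots> \<le> \<bar>C\<bar> * (norm (u t) * norm (v t))" by (intro mult_right_mono) auto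
      also have "\<dots> \<le> \<bar>C\<bar> * ((norm (u t))\<^sup>2 + (norm (v t))\<^sup>2)"
      proof (rule mult_left_mono)
        have "0 \<le> norm (u t) * norm (v t)" by simp
        then show "norm (u t) * norm (v t) \<le> (norm (u t))\<^sup>2 + (norm (v t))\<^sup>2"
          using sum_squares_bound[of "norm (u t)" "norm (v t)"] unfolding mult.assoc by linarith
      qed simp
      finally show ?case by simp
    qed
  qed
qed

abbreviation A :: "(real \<Rightarrow> 'v) \<Rightarrow> (real \<Rightarrow> 'v) \<Rightarrow> real" where "A \<equiv> op_A T a"

lemma A_sym: "u \<in> L2_space M \<Longrightarrow> v \<in> L2_space M \<Longrightarrow> A u v = A v u"
  using symmetric by (simp add: space_Y_eq op_As_def)

lemma form_bounds:
  obtains c C where "0 < c" "\<And>v. v \<in> L2_space M \<Longrightarrow> c * L2_inner M v v \<le> A v v"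
    "\<And>v. v \<in> L2_space M \<Longrightarrow> A v v \<le> C * L2_inner M v v"
proof -
  obtain C where C: "AE t in M. \<forall>x y. \<bar>a t x y\<bar> \<le> C * norm x * norm y"
    using form unfolding parabolic_form_def by blast
  obtain c where c: "c > 0" "AE t in M. \<forall>x. c * (norm x)\<^sup>2 \<le> a t x x"
    using form unfolding parabolic_form_def by blast
  have "c * L2_inner M v v \<le> A v v \<and> A v v \<le> C * L2_inner M v v" if v: "v \<in> L2_space M" for v
  proof
    have "c * L2_inner M v v = (LINT t|M. c * (norm (v t))\<^sup>2)" by (simp add: L2_inner_self)
    also have "\<dots> \<le> A v v"
      unfolding op_A_def
      by (rule integral_mono_AE)
         (use c(2) L2_spaceD(2)[OF v] integrable_form[OF v v] in \<open>auto elim: eventually_mono\<close>)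
    finally show "c * L2_inner M v v \<le> A v v" .
    have "A v v \<le> (LINT t|M. C * (norm (v t))\<^sup>2)"
      unfolding op_A_def
    proof (rule integral_mono_AE)
      show "AE t in M. a t (v t) (v t) \<le> C * (norm (v t))\<^sup>2"
        using C
      proof eventually_elim
        case (elim t)
        then have "\<bar>a t (v t) (v t)\<bar> \<le> C * norm (v t) * norm (v t)" by blast
        then show ?case by (simp add: power2_eq_square mult.assoc)
      qed
    qed (use L2_spaceD(2)[OF v] integrable_form[OF v v] in auto)
    then show "A v v \<le> C * L2_inner M v v" by (simp add: L2_inner_self)
  qed
  with c(1) show thesis using that by blast
qed

lemma psd_form_A: "psd_form (L2_space M) A"
proof
  have bil: "AE t in M. bilinear (a t)" using form unfolding parabolic_form_def by blast
  show "subspace (L2_space M :: (real \<Rightarrow> 'v) set)" by (rule subspace_L2)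
  fix u v w :: "real \<Rightarrow> 'v" and c :: real
  assume u: "u \<in> L2_space M"
  show "0 \<le> A u u"
    by (rule form_bounds) (use u Y.nonneg[OF u] in \<open>meson mult_nonneg_nonneg order_trans less_imp_le\<close>)
  assume w: "w \<in> L2_space M"
  show "A u w = A w u" by (rule A_sym[OF u w])
  have "A (c *\<^sub>R u) w = (LINT t|M. c * a t (u t) (w t))"
    unfolding op_A_def
  proof (rule integral_cong_AE)
    show "AE t in M. a t ((c *\<^sub>R u) t) (w t) = c * a t (u t) (w t)"
      using bil by eventually_elim (simp add: bilinear_lmul)
  qed (use integrable_form[OF u w] integrable_form[OF Y.mem(4)[OF u, of c] w] in \<open>auto intro: borel_measurable_integrable\<close>)
  then show "A (c *\<^sub>R u) w = c * A u w" by (simp add: op_A_def)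
  assume v: "v \<in> L2_space M"
  have "A (u + v) w = (LINT t|M. a t (u t) (w t) + a t (v t) (w t))"
    unfolding op_A_def
  proof (rule integral_cong_AE)
    show "AE t in M. a t ((u + v) t) (w t) = a t (u t) (w t) + a t (v t) (w t)"
      using bil by eventually_elim (simp add: bilinear_ladd)
  qed (use integrable_form[OF u w] integrable_form[OF v w] integrable_form[OF Y.mem(2)[OF u v] w]
      in \<open>auto intro!: borel_measurable_integrable Bochner_Integration.integrable_add\<close>)
  then show "A (u + v) w = A u w + A v w"
    by (simp add: op_A_def integrable_form[OF u w] integrable_form[OF v w])
qed

lemma hilbert_form_A: "hilbert_form (L2_space M) A"
  by (rule form_bounds, rule Y.hilbert_form_equivalent[OF psd_form_A])

sublocale A: hilbert_form "L2_space M :: (real \<Rightarrow> 'v) set" A by (rule hilbert_form_A)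

lemma norm_Y_eq: "norm_Y T a = A.nrm"
  by (simp add: fun_eq_iff norm_Y_def A.nrm_def op_As_def)

lemma A_null_AE: "v \<in> L2_space M \<Longrightarrow> A v v = 0 \<Longrightarrow> AE t in M. v t = 0"
proof -
  assume v: "v \<in> L2_space M" "A v v = 0"
  obtain c where "c > 0" "c * L2_inner M v v \<le> A v v" using form_bounds v(1) by metis
  then have "L2_inner M v v = 0" using Y.nonneg[OF v(1)] v(2) by (simp add: mult_le_0_iff)
  then show ?thesis using L2_null_iff[OF v(1)] by simp
qed

lemma op_B_eq:
  assumes "w \<in> X" "v \<in> L2_space M" shows "op_B T j a w v = L2_inner M (Dt w) v + A w v"
proof -
  have "op_B T j a w v = (LINT t|M. Dt w t \<bullet> v t + a t (w t) (v t))"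
    by (simp add: op_B_def Dt_def)
  then show ?thesis
    using assms by (simp add: L2_inner_def op_A_def L2_inner_integrable integrable_form Dt_L2 X_L2)
qed

lemma op_dt_eq: "w \<in> X \<Longrightarrow> v \<in> L2_space M \<Longrightarrow> op_dt T j a w v = L2_inner M (Dt w) v"
  by (simp add: op_dt_def op_B_eq)

lemma Dt_bounded:
  obtains K where "0 \<le> K" "\<And>w v. w \<in> X \<Longrightarrow> v \<in> L2_space M \<Longrightarrow> \<bar>L2_inner M (Dt w) v\<bar> \<le> K * Y.nrm (Dt w) * A.nrm v"
proof -
  obtain c where c: "c > 0" "\<And>v. v \<in> L2_space M \<Longrightarrow> c * L2_inner M v v \<le> A v v" using form_bounds by metis
  have "\<bar>L2_inner M (Dt w) v\<bar> \<le> (1 / sqrt c) * Y.nrm (Dt w) * A.nrm v" if w: "w \<in> X" and v: "v \<in> L2_space M" for w v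
  proof -
    have "sqrt c * Y.nrm v \<le> A.nrm v"
      using real_sqrt_le_mono[OF c(2)[OF v]] by (simp add: real_sqrt_mult Y.nrm_def A.nrm_def)
    then have "Y.nrm v \<le> (1 / sqrt c) * A.nrm v" using c(1) by (simp add: field_simps)
    then have "Y.nrm (Dt w) * Y.nrm v \<le> Y.nrm (Dt w) * ((1 / sqrt c) * A.nrm v)"
      by (intro mult_left_mono Y.nrm_nonneg Dt_L2 w)
    then show ?thesis using Y.cauchy_schwarz[OF Dt_L2[OF w] v] by (simp add: mult_ac)
  qed
  then show thesis using that[of "1 / sqrt c"] c(1) by simp
qed

lemma Dt_riesz:
  assumes W: "subspace W" "W \<subseteq> L2_space M" "hilbert_form W A" and u: "u \<in> X"
  shows "\<exists>r\<in>W. \<forall>v\<in>W. L2_inner M (Dt u) v = A r v"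
proof -
  interpret W: hilbert_form W A by fact
  obtain K where K: "\<And>v. v \<in> L2_space M \<Longrightarrow> \<bar>L2_inner M (Dt u) v\<bar> \<le> K * Y.nrm (Dt u) * A.nrm v"
    using Dt_bounded u by metis
  obtain r where "r \<in> W" "\<And>v. v \<in> W \<Longrightarrow> L2_inner M (Dt u) v = A r v"
    using W.riesz[of "L2_inner M (Dt u)" "K * Y.nrm (Dt u)"] W(2) K Dt_L2[OF u]
    by (auto simp: Y.add_right Y.scale_right subset_iff)
  then show ?thesis by blast
qed

text \<open>
  The representer of \<open>\<partial>\<^sub>t u\<close> on all of \<open>Y\<close> in the energy inner product; the dual norm of \<open>\<partial>\<^sub>t u\<close> is the
  norm of this representer.
\<close>

definition Dt_rep :: "(real \<Rightarrow> 'v) \<Rightarrow> real \<Rightarrow> 'v" where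
  "Dt_rep u = (SOME r. r \<in> L2_space M \<and> (\<forall>v\<in>L2_space M. L2_inner M (Dt u) v = A r v))"

lemma Dt_rep:
  assumes "u \<in> X"
  shows "Dt_rep u \<in> L2_space M" "v \<in> L2_space M \<Longrightarrow> L2_inner M (Dt u) v = A (Dt_rep u) v"
proof -
  have "\<exists>r. r \<in> L2_space M \<and> (\<forall>v\<in>L2_space M. L2_inner M (Dt u) v = A r v)"
    using Dt_riesz[OF subspace_L2 order_refl hilbert_form_A assms] by blast
  from someI_ex[OF this]
  show "Dt_rep u \<in> L2_space M" "v \<in> L2_space M \<Longrightarrow> L2_inner M (Dt u) v = A (Dt_rep u) v"
    by (auto simp: Dt_rep_def)
qed

lemma norm_X_eq:
  assumes u: "u \<in> X"
  shows "norm_X T j a u = sqrt (A u u + A (Dt_rep u) (Dt_rep u) + (norm (tr u T))\<^sup>2)"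
proof -
  have "dual_norm_Y T a (op_dt T j a u) = A.nrm (Dt_rep u)"
    unfolding dual_norm_Y_def space_Y_eq norm_Y_eq
    by (rule A.SUP_quotient_sq(2)[OF Dt_rep(1)[OF u]]) (simp add: op_dt_eq u Dt_rep)
  then show ?thesis by (simp add: norm_X_def norm_Y_eq A.nrm_sq X_L2 Dt_rep u)
qed

lemma norm_X_sq: "u \<in> X \<Longrightarrow> (norm_X T j a u)\<^sup>2 = A u u + A (Dt_rep u) (Dt_rep u) + (norm (tr u T))\<^sup>2"
  by (simp add: norm_X_eq A.nonneg X_L2 Dt_rep)

lemma norm_X_nonneg: "u \<in> X \<Longrightarrow> 0 \<le> norm_X T j a u"
  by (simp add: norm_X_eq A.nonneg X_L2 Dt_rep)

text \<open>
  The energy norm of \<open>X\<close> is equivalent to the standard norm.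
\<close>

lemma norm_X_equiv:
  obtains C where "0 \<le> C" "\<And>u. u \<in> X \<Longrightarrow> norm_X T j a u \<le> C * X.nrm u" "\<And>u. u \<in> X \<Longrightarrow> X.nrm u \<le> C * norm_X T j a u"
proof -
  obtain c C where cC: "c > 0" "\<And>v. v \<in> L2_space M \<Longrightarrow> c * L2_inner M v v \<le> A v v"
    "\<And>v. v \<in> L2_space M \<Longrightarrow> A v v \<le> C * L2_inner M v v" using form_bounds by metis
  define B where "B = \<bar>C\<bar> + 1 / c + \<bar>trace_const\<bar>"
  have B: "0 \<le> B" using cC(1) by (simp add: B_def)
  have C': "A v v \<le> \<bar>C\<bar> * L2_inner M v v" if "v \<in> L2_space M" for v
    using cC(3)[OF that] mult_right_mono[OF abs_ge_self[of C] Y.nonneg[OF that]] by linarith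
  have le: "(norm_X T j a u)\<^sup>2 \<le> B * graph_form u u" "graph_form u u \<le> B * (norm_X T j a u)\<^sup>2"
    if u: "u \<in> X" for u
  proof -
    note L = X_L2[OF u] Dt_L2[OF u] Dt_rep(1)[OF u]
    define r where "r = Dt_rep u"
    have r: "r \<in> L2_space M" "\<And>v. v \<in> L2_space M \<Longrightarrow> L2_inner M (Dt u) v = A r v"
      using Dt_rep[OF u] by (auto simp: r_def)
    have pos: "0 \<le> L2_inner M u u" "0 \<le> L2_inner M (Dt u) (Dt u)" "0 \<le> A u u" "0 \<le> A r r"
      by (rule Y.nonneg[OF L(1)] Y.nonneg[OF L(2)] A.nonneg[OF L(1)] A.nonneg[OF r(1)])+
    have 1: "c * A r r \<le> L2_inner M (Dt u) (Dt u)"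
    proof (cases "A r r = 0")
      case False
      have "(A r r)\<^sup>2 \<le> L2_inner M (Dt u) (Dt u) * L2_inner M r r"
        using Y.cauchy_schwarz_sq[OF L(2) r(1)] r by simp
      then have "c * (A r r)\<^sup>2 \<le> L2_inner M (Dt u) (Dt u) * (c * L2_inner M r r)"
        using cC(1) mult_left_mono[of "(A r r)\<^sup>2" _ c] by (simp add: mult_ac)
      also have "\<dots> \<le> L2_inner M (Dt u) (Dt u) * A r r"
        by (intro mult_left_mono cC r pos)
      finally have "(c * A r r) * A r r \<le> L2_inner M (Dt u) (Dt u) * A r r" by (simp add: power2_eq_square mult_ac)
      then show ?thesis using False pos(4) by (simp add: mult_le_cancel_right)
    qed (use pos in simp)
    have 2: "L2_inner M (Dt u) (Dt u) \<le> \<bar>C\<bar> * A r r"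
    proof (cases "L2_inner M (Dt u) (Dt u) = 0")
      case False
      have "(L2_inner M (Dt u) (Dt u))\<^sup>2 \<le> A r r * A (Dt u) (Dt u)"
        using A.cauchy_schwarz_sq[OF r(1) L(2)] r(2)[OF L(2)] by simp
      also have "\<dots> \<le> A r r * (\<bar>C\<bar> * L2_inner M (Dt u) (Dt u))" by (intro mult_left_mono C' L pos)
      finally have "L2_inner M (Dt u) (Dt u) * L2_inner M (Dt u) (Dt u) \<le> (\<bar>C\<bar> * A r r) * L2_inner M (Dt u) (Dt u)"
        by (simp add: power2_eq_square mult_ac)
      then show ?thesis using False pos(2) by (simp add: mult_le_cancel_right)
    qed (use pos in simp)
    have g: "graph_form u u = L2_inner M u u + L2_inner M (Dt u) (Dt u)" by (simp add: graph_form_def)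
    have gn: "0 \<le> graph_form u u" using pos g by simp
    have n: "(norm_X T j a u)\<^sup>2 = A u u + A r r + (norm (tr u T))\<^sup>2" by (simp add: norm_X_sq u r_def)
    have 3: "A r r \<le> 1 / c * L2_inner M (Dt u) (Dt u)" using 1 cC(1) by (simp add: field_simps)
    have "A u u \<le> \<bar>C\<bar> * graph_form u u"
      using C'[OF L(1)] mult_left_mono[of "L2_inner M u u" "graph_form u u" "\<bar>C\<bar>"] g pos by simp
    moreover have "A r r \<le> 1 / c * graph_form u u"
      using 3 mult_left_mono[of "L2_inner M (Dt u) (Dt u)" "graph_form u u" "1 / c"] g pos cC(1) by simp
    moreover have "(norm (tr u T))\<^sup>2 \<le> \<bar>trace_const\<bar> * graph_form u u"
      using trace_bound[OF u, of T] T mult_right_mono[OF abs_ge_self[of trace_const] gn] by simp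
    ultimately show "(norm_X T j a u)\<^sup>2 \<le> B * graph_form u u" unfolding n B_def by (simp add: distrib_right)
    define n' where "n' = (norm_X T j a u)\<^sup>2"
    have n': "A u u \<le> n'" "A r r \<le> n'" "0 \<le> n'" using n pos by (auto simp: n'_def)
    have "L2_inner M u u \<le> 1 / c * A u u" using cC(2)[OF L(1)] cC(1) by (simp add: field_simps)
    also have "\<dots> \<le> 1 / c * n'" using n' cC(1) by (intro mult_left_mono) auto
    finally have a1: "L2_inner M u u \<le> 1 / c * n'" .
    have a2: "L2_inner M (Dt u) (Dt u) \<le> \<bar>C\<bar> * n'"
      using 2 mult_left_mono[OF n'(2), of "\<bar>C\<bar>"] by simp
    have a3: "0 \<le> \<bar>trace_const\<bar> * n'" using n' by simp
    show "graph_form u u \<le> B * (norm_X T j a u)\<^sup>2"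
      using a1 a2 a3 unfolding g B_def n'_def[symmetric] distrib_right by linarith
  qed
  show thesis
  proof (rule that[of "sqrt B"])
    fix u assume u: "u \<in> X"
    show "norm_X T j a u \<le> sqrt B * X.nrm u"
      using real_sqrt_le_mono[OF le(1)[OF u]] norm_X_nonneg[OF u] by (simp add: real_sqrt_mult X.nrm_def)
    show "X.nrm u \<le> sqrt B * norm_X T j a u"
      using real_sqrt_le_mono[OF le(2)[OF u]] norm_X_nonneg[OF u] by (simp add: real_sqrt_mult X.nrm_def)
  qed (use B in simp)
qed

end

section \<open>The residual form and the Galerkin system\<close>

text \<open>
  The discrete spaces of the Galerkin method.
\<close>

locale galerkin = parabolic j T a
  for j :: "'v::{real_inner,banach,second_countable_topology} \<Rightarrow> 'h::{real_inner,banach,second_countable_topology}"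
    and T :: real and a :: "real \<Rightarrow> 'v \<Rightarrow> 'v \<Rightarrow> real" +
  fixes Yd Xd :: "(real \<Rightarrow> 'v) set" and Hd :: "'h set"
  assumes Yd: "closed_subspace_of (space_Y T) (norm_Y T a) Yd"
    and Hd: "subspace Hd" "closed Hd"
    and Xd: "closed_subspace_of (space_X T j) (norm_X T j a) Xd"
    and XdYd: "Xd \<subseteq> Yd"
    and trHd: "\<forall>w\<in>Xd. time_trace T j w 0 \<in> Hd"
begin

lemma subspace_Yd: "subspace Yd" and Yd_L2: "Yd \<subseteq> L2_space M"
  using closed_subspace_ofD[OF Yd] by (auto simp: space_Y_eq)

lemma subspace_Xd: "subspace Xd" and Xd_X: "Xd \<subseteq> X"
  using closed_subspace_ofD[OF Xd] by (auto simp: space_X_eq)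

sublocale D: hilbert_form Yd A
  by (rule A.hilbert_form_closed[OF subspace_Yd Yd_L2])
     (use closed_subspace_ofD(3)[OF Yd] in \<open>auto simp: space_Y_eq norm_Y_eq\<close>)

lemma Yd_L2I: "v \<in> Yd \<Longrightarrow> v \<in> L2_space M" using Yd_L2 by auto

lemma Xd_XI: "v \<in> Xd \<Longrightarrow> v \<in> X" using Xd_X by auto

text \<open>
  The representer of \<open>\<partial>\<^sub>t u\<close> on \<open>Yd\<close>, in the energy inner product.
\<close>

definition Dt_repd :: "(real \<Rightarrow> 'v) \<Rightarrow> real \<Rightarrow> 'v" where
  "Dt_repd u = (SOME r. r \<in> Yd \<and> (\<forall>v\<in>Yd. L2_inner M (Dt u) v = A r v))"

lemma Dt_repd:
  assumes "u \<in> X"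
  shows "Dt_repd u \<in> Yd" "v \<in> Yd \<Longrightarrow> L2_inner M (Dt u) v = A (Dt_repd u) v"
proof -
  have "\<exists>r. r \<in> Yd \<and> (\<forall>v\<in>Yd. L2_inner M (Dt u) v = A r v)"
    using Dt_riesz[OF subspace_Yd Yd_L2 D.hilbert_form_axioms assms] by blast
  from someI_ex[OF this]
  show "Dt_repd u \<in> Yd" "v \<in> Yd \<Longrightarrow> L2_inner M (Dt u) v = A (Dt_repd u) v"
    by (auto simp: Dt_repd_def)
qed

text \<open>
  The energy-orthogonal projection onto \<open>Yd\<close>.
\<close>
definition Pd :: "(real \<Rightarrow> 'v) \<Rightarrow> real \<Rightarrow> 'v" where
  "Pd u = (SOME r. r \<in> Yd \<and> (\<forall>v\<in>Yd. A u v = A r v))"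

lemma Pd:
  assumes "u \<in> L2_space M"
  shows "Pd u \<in> Yd" "v \<in> Yd \<Longrightarrow> A (Pd u) v = A u v"
proof -
  obtain r where "r \<in> Yd" "\<And>v. v \<in> Yd \<Longrightarrow> A u v = A r v"
    using D.riesz[of "A u" "A.nrm u"] assms Yd_L2
    by (auto simp: A.add_right A.scale_right A.cauchy_schwarz subset_iff)
  then have "\<exists>r. r \<in> Yd \<and> (\<forall>v\<in>Yd. A u v = A r v)" by blast
  from someI_ex[OF this] show "Pd u \<in> Yd" "v \<in> Yd \<Longrightarrow> A (Pd u) v = A u v"
    by (auto simp: Pd_def)
qed

text \<open>
  The representer of \<open>B u\<close> on \<open>Yd\<close>; it is the operator \<open>R\<close> of the introduction.
\<close>

definition Bd :: "(real \<Rightarrow> 'v) \<Rightarrow> real \<Rightarrow> 'v" where "Bd u = Dt_repd u + Pd u"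

lemma Bd:
  assumes "u \<in> X"
  shows "Bd u \<in> Yd" "v \<in> Yd \<Longrightarrow> op_B T j a u v = A (Bd u) v"
  using Dt_repd[OF assms] Pd[OF X_L2[OF assms]] assms
  by (auto simp: Bd_def D.add_left op_B_eq Yd_L2I)

lemma op_B_add: "u \<in> X \<Longrightarrow> w \<in> X \<Longrightarrow> v \<in> L2_space M \<Longrightarrow> op_B T j a (u + w) v = op_B T j a u v + op_B T j a w v"
  by (simp add: op_B_eq L2_inner_Dt_add A.add_left X_L2)

lemma op_B_scale: "u \<in> X \<Longrightarrow> v \<in> L2_space M \<Longrightarrow> op_B T j a (c *\<^sub>R u) v = c * op_B T j a u v"
  by (simp add: op_B_eq L2_inner_Dt_scale A.scale_left X_L2 algebra_simps)

lemma zero_T: "0 \<in> {0..T}" "T \<in> {0..T}" using T by auto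

text \<open>
  The inner product of the mesh-dependent norm, and the form \<open>E\<close> of the reduced system.  Both are written
  so that linearity in the first argument does not depend on the choice of representers.
\<close>
definition mesh_form :: "(real \<Rightarrow> 'v) \<Rightarrow> (real \<Rightarrow> 'v) \<Rightarrow> real" where
  "mesh_form u w = A u w + L2_inner M (Dt u) (Dt_repd w) + tr u T \<bullet> tr w T"

definition residual_form :: "(real \<Rightarrow> 'v) \<Rightarrow> (real \<Rightarrow> 'v) \<Rightarrow> real" where
  "residual_form u w = op_B T j a u (Bd w) + tr u 0 \<bullet> tr w 0"

sublocale m: psd_form X mesh_form
proof
  show "subspace X" by (rule subspace_X)
  fix u w v :: "real \<Rightarrow> 'v" and c :: real
  assume u: "u \<in> X"
  show "0 \<le> mesh_form u u"
    using A.nonneg[OF X_L2[OF u]] D.nonneg[OF Dt_repd(1)[OF u]] Dt_repd(2)[OF u Dt_repd(1)[OF u]]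
    by (simp add: mesh_form_def)
  assume w: "w \<in> X"
  show "mesh_form u w = mesh_form w u"
    using A.sym[OF X_L2[OF u] X_L2[OF w]] D.sym[OF Dt_repd(1)[OF u] Dt_repd(1)[OF w]]
      Dt_repd(2)[OF u Dt_repd(1)[OF w]] Dt_repd(2)[OF w Dt_repd(1)[OF u]]
    by (simp add: mesh_form_def inner_commute)
  note L = Yd_L2I[OF Dt_repd(1)[OF w]] X_L2[OF u] X_L2[OF w]
  show "mesh_form (c *\<^sub>R u) w = c * mesh_form u w"
    using L u zero_T by (simp add: mesh_form_def A.scale_left L2_inner_Dt_scale trace_scale algebra_simps)
  assume v: "v \<in> X"
  show "mesh_form (u + v) w = mesh_form u w + mesh_form v w"
    using L u v zero_T by (simp add: mesh_form_def A.add_left X_L2 L2_inner_Dt_add trace_add inner_add_left)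
qed

sublocale E: psd_form X residual_form
proof
  show "subspace X" by (rule subspace_X)
  fix u w v :: "real \<Rightarrow> 'v" and c :: real
  assume u: "u \<in> X"
  show "0 \<le> residual_form u u"
    using D.nonneg[OF Bd(1)[OF u]] Bd(2)[OF u Bd(1)[OF u]] by (simp add: residual_form_def)
  assume w: "w \<in> X"
  show "residual_form u w = residual_form w u"
    using D.sym[OF Bd(1)[OF u] Bd(1)[OF w]] Bd(2)[OF u Bd(1)[OF w]] Bd(2)[OF w Bd(1)[OF u]]
    by (simp add: residual_form_def inner_commute)
  note L = Yd_L2I[OF Bd(1)[OF w]]
  show "residual_form (c *\<^sub>R u) w = c * residual_form u w"
    using L u zero_T by (simp add: residual_form_def op_B_scale trace_scale algebra_simps)
  assume v: "v \<in> X"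
  show "residual_form (u + v) w = residual_form u w + residual_form v w"
    using L u v zero_T by (simp add: residual_form_def op_B_add trace_add inner_add_left)
qed

lemma mesh_norm_eq:
  assumes u: "u \<in> X" shows "mesh_norm T j a Yd u = m.nrm u"
proof -
  have "(SUP v\<in>Yd. (op_dt T j a u v)\<^sup>2 / (norm_Y T a v)\<^sup>2) = A (Dt_repd u) (Dt_repd u)"
    unfolding norm_Y_eq
    by (rule D.SUP_quotient_sq(1)[OF Dt_repd(1)[OF u]]) (simp add: op_dt_eq u Yd_L2I Dt_repd(2))
  then show ?thesis
    using Dt_repd(2)[OF u Dt_repd(1)[OF u]]
    by (simp add: mesh_norm_def m.nrm_def mesh_form_def norm_Y_eq A.nrm_sq X_L2 u power2_norm_eq_inner)
qed

lemma mesh_le_norm_X: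
  assumes u: "u \<in> X" shows "m.nrm u \<le> norm_X T j a u"
proof -
  have "A (Dt_repd u) (Dt_repd u) \<le> A (Dt_rep u) (Dt_rep u)"
    by (rule A.le_if_projection)
       (use Dt_repd[OF u] Dt_rep[OF u] Yd_L2I in auto)
  then show ?thesis
    using Dt_repd(2)[OF u Dt_repd(1)[OF u]]
    by (simp add: norm_X_eq u m.nrm_def mesh_form_def power2_norm_eq_inner)
qed

text \<open>
  If \<open>r\<close> represents \<open>\<partial>\<^sub>t u\<close>, the cross term of \<open>\<parallel>r + u\<parallel>\<^sup>2\<close> converts the initial value into the
  final value.
\<close>

lemma energy_expand:
  assumes u: "u \<in> X" and r: "r \<in> L2_space M" "A r u = L2_inner M (Dt u) u"
  shows "A (r + u) (r + u) + (norm (tr u 0))\<^sup>2 = A u u + A r r + (norm (tr u T))\<^sup>2"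
  using energy_identity[OF u] r by (simp add: A.expand_add X_L2 u)

lemma residual_le_norm_X:
  assumes u: "u \<in> X" shows "E.nrm u \<le> norm_X T j a u"
proof -
  note r = Dt_rep[OF u]
  have b: "A (Bd u) (Bd u) \<le> A (Dt_rep u + u) (Dt_rep u + u)"
  proof (rule A.le_if_projection)
    have L: "Bd u \<in> L2_space M" using Bd(1)[OF u] by (rule Yd_L2I)
    show "A (Bd u) (Bd u) = A (Dt_rep u + u) (Bd u)"
      using Bd(2)[OF u Bd(1)[OF u]] r L u by (simp add: op_B_eq A.add_left X_L2)
  qed (use Bd(1)[OF u] Yd_L2I r u X_L2 in auto)
  have "residual_form u u = A (Bd u) (Bd u) + (norm (tr u 0))\<^sup>2"
    using Bd(2)[OF u Bd(1)[OF u]] by (simp add: residual_form_def power2_norm_eq_inner)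
  also have "\<dots> \<le> A u u + A (Dt_rep u) (Dt_rep u) + (norm (tr u T))\<^sup>2"
    using b energy_expand[OF u r(1)] r(2)[OF X_L2[OF u]] by simp
  finally show ?thesis by (simp add: norm_X_eq u E.nrm_def)
qed

lemma residual_eq_mesh:
  assumes u: "u \<in> Xd" shows "residual_form u u = mesh_form u u"
proof -
  have uX: "u \<in> X" and uY: "u \<in> Yd" using u Xd_X XdYd by auto
  note r = Dt_repd[OF uX]
  have sY: "Dt_repd u + u \<in> Yd" using r(1) uY by simp
  have s: "A (Bd u) v = A (Dt_repd u + u) v" if "v \<in> Yd" for v
    using Bd(2)[OF uX that] r that uX uY by (simp add: op_B_eq D.add_left Yd_L2I)
  have "A (Bd u) (Bd u) = A (Dt_repd u + u) (Bd u)" by (rule s[OF Bd(1)[OF uX]])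
  also have "\<dots> = A (Bd u) (Dt_repd u + u)" by (rule D.sym[OF sY Bd(1)[OF uX]])
  also have "\<dots> = A (Dt_repd u + u) (Dt_repd u + u)" by (rule s[OF sY])
  finally have "residual_form u u = A (Dt_repd u + u) (Dt_repd u + u) + (norm (tr u 0))\<^sup>2"
    using Bd(2)[OF uX Bd(1)[OF uX]] by (simp add: residual_form_def power2_norm_eq_inner)
  also have "\<dots> = A u u + A (Dt_repd u) (Dt_repd u) + (norm (tr u T))\<^sup>2"
    using energy_expand[OF uX Yd_L2I[OF r(1)]] r(2)[OF uY] by simp
  finally show ?thesis using r(2)[OF r(1)] by (simp add: mesh_form_def power2_norm_eq_inner)
qed

lemma residual_nrm_eq_mesh: "u \<in> Xd \<Longrightarrow> E.nrm u = m.nrm u"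
  by (simp add: E.nrm_def m.nrm_def residual_eq_mesh)

lemma dual_YD:
  assumes "g \<in> dual_Y T a"
  shows "u \<in> L2_space M \<Longrightarrow> v \<in> L2_space M \<Longrightarrow> g (u + v) = g u + g v"
    "v \<in> L2_space M \<Longrightarrow> g (c *\<^sub>R v) = c * g v"
    "\<exists>C. \<forall>v\<in>L2_space M. \<bar>g v\<bar> \<le> C * A.nrm v"
  using assms by (auto simp: dual_Y_def space_Y_eq norm_Y_eq plus_fun_def scaleR_fun_def)

lemma dual_Y_riesz:
  assumes "g \<in> dual_Y T a"
  obtains r where "r \<in> Yd" "\<And>v. v \<in> Yd \<Longrightarrow> g v = A r v"
proof -
  obtain C where C: "\<And>v. v \<in> L2_space M \<Longrightarrow> \<bar>g v\<bar> \<le> C * A.nrm v" using dual_YD(3)[OF assms] by blast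
  show thesis
    by (rule D.riesz[of g C]) (use dual_YD(1,2)[OF assms] C Yd_L2I that in auto)
qed

lemma Hd_projection: obtains q where "q \<in> Hd" "\<And>h. h \<in> Hd \<Longrightarrow> x \<bullet> h = q \<bullet> h"
proof -
  interpret H: hilbert_form Hd inner by (rule hilbert_form_inner[OF Hd])
  show thesis
    by (rule H.riesz[of "\<lambda>h. x \<bullet> h" "norm x"])
       (use that in \<open>auto simp: inner_add_right H.nrm_def norm_eq_sqrt_inner[symmetric] Cauchy_Schwarz_ineq2\<close>)
qed

lemma galerkin_iff:
  assumes "g \<in> dual_Y T a"
  shows "galerkin_solution T j a Yd Hd Xd g u0 \<mu> \<sigma> u \<longleftrightarrow> \<mu> \<in> Yd \<and> \<sigma> \<in> Hd \<and> u \<in> Xd \<and>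
    (\<forall>v\<in>Yd. A \<mu> v + op_B T j a u v = g v) \<and>
    (\<forall>h\<in>Hd. \<sigma> \<bullet> h + tr u 0 \<bullet> h = u0 \<bullet> h) \<and>
    (\<forall>w\<in>Xd. op_B T j a w \<mu> + tr w 0 \<bullet> \<sigma> = 0)"
proof -
  have As: "op_As T a \<mu> v = A \<mu> v" if "\<mu> \<in> Yd" "v \<in> Yd" for v
    using D.sym[OF that] by (simp add: op_As_def)
  have "0 \<in> Yd" "0 \<in> Hd" "0 \<in> Xd" using subspace_Yd Hd(1) subspace_Xd by (auto simp: subspace_0)
  then show ?thesis using As unfolding galerkin_solution_def by (intro iffI; elim conjE; intro conjI ballI) (auto; blast)+
qed

text \<open>
  Elimination of \<open>\<mu>\<close> and \<open>\<sigma>\<close>: the equation for \<open>ud\<close> in terms of the form \<open>E\<close>.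
\<close>

lemma galerkin_residual:
  assumes g: "g \<in> dual_Y T a" and sol: "galerkin_solution T j a Yd Hd Xd g u0 \<mu> \<sigma> ud"
    and r: "r \<in> Yd" "\<And>v. v \<in> Yd \<Longrightarrow> g v = A r v" and w: "w \<in> Xd"
  shows "residual_form w ud = op_B T j a w r + tr w 0 \<bullet> u0"
proof -
  have s: "\<mu> \<in> Yd" "\<sigma> \<in> Hd" "ud \<in> Xd" "\<And>v. v \<in> Yd \<Longrightarrow> A \<mu> v + op_B T j a ud v = g v"
    "\<And>h. h \<in> Hd \<Longrightarrow> \<sigma> \<bullet> h + tr ud 0 \<bullet> h = u0 \<bullet> h" "op_B T j a w \<mu> + tr w 0 \<bullet> \<sigma> = 0"
    using sol w by (auto simp: galerkin_iff[OF g])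
  have wX: "w \<in> X" and udX: "ud \<in> X" using w s(3) Xd_X by auto
  note B = Bd(1)[OF wX]
  have "op_B T j a w \<mu> = A \<mu> (Bd w)"
    using Bd(2)[OF wX s(1)] D.sym[OF B s(1)] by simp
  also have "\<dots> = A r (Bd w) - op_B T j a ud (Bd w)" using s(4)[OF B] r(2)[OF B] by simp
  also have "A r (Bd w) = op_B T j a w r" using Bd(2)[OF wX r(1)] D.sym[OF B r(1)] by simp
  also have "op_B T j a ud (Bd w) = residual_form w ud - tr w 0 \<bullet> tr ud 0"
    using E.sym[OF wX udX] by (simp add: residual_form_def inner_commute)
  finally have "op_B T j a w \<mu> = op_B T j a w r - residual_form w ud + tr w 0 \<bullet> tr ud 0" by simp
  moreover have "tr w 0 \<bullet> \<sigma> = tr w 0 \<bullet> u0 - tr w 0 \<bullet> tr ud 0"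
    using s(5)[of "tr w 0"] trHd w by (simp add: inner_commute)
  ultimately show ?thesis using s(6) by simp
qed

theorem galerkin_unique:
  assumes g: "g \<in> dual_Y T a"
    and sol: "galerkin_solution T j a Yd Hd Xd g u0 \<mu> \<sigma> u" "galerkin_solution T j a Yd Hd Xd g u0 \<mu>' \<sigma>' u'"
  shows "(AE t in M. \<mu> t = \<mu>' t) \<and> \<sigma> = \<sigma>' \<and> (AE t in M. u t = u' t)"
proof -
  obtain r where r: "r \<in> Yd" "\<And>v. v \<in> Yd \<Longrightarrow> g v = A r v" using dual_Y_riesz[OF g] by blast
  note s = sol[unfolded galerkin_iff[OF g]]
  have mem: "\<mu> \<in> Yd" "\<mu>' \<in> Yd" "\<sigma> \<in> Hd" "\<sigma>' \<in> Hd" "u \<in> Xd" "u' \<in> Xd" using s by auto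
  define d where "d = u - u'"
  have d: "d \<in> Xd" unfolding d_def by (rule subspace_diff[OF subspace_Xd mem(5,6)])
  have uX: "u \<in> X" "u' \<in> X" "d \<in> X" using mem d Xd_X by auto
  have E0: "residual_form d d = 0"
    using galerkin_residual[OF g sol(1) r d] galerkin_residual[OF g sol(2) r d] uX
    by (simp add: d_def E.diff_right)
  then have m0: "mesh_form d d = 0" using residual_eq_mesh[OF d] by simp
  have "A d d + A (Dt_repd d) (Dt_repd d) + tr d T \<bullet> tr d T = 0"
    using m0 Dt_repd(2)[OF uX(3) Dt_repd(1)[OF uX(3)]] by (simp add: mesh_form_def)
  moreover have "0 \<le> A d d" "0 \<le> A (Dt_repd d) (Dt_repd d)" "0 \<le> tr d T \<bullet> tr d T"
    using A.nonneg[OF X_L2[OF uX(3)]] D.nonneg[OF Dt_repd(1)[OF uX(3)]] by auto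
  ultimately have parts: "A d d = 0" "A (Dt_repd d) (Dt_repd d) = 0" by linarith+
  have trd: "tr d 0 = 0"
    using E0 D.nonneg[OF Bd(1)[OF uX(3)]] Bd(2)[OF uX(3) Bd(1)[OF uX(3)]] inner_ge_zero[of "tr d 0"]
    by (auto simp: residual_form_def add_nonneg_eq_0_iff)
  have Bd0: "op_B T j a d v = 0" if v: "v \<in> Yd" for v
    using Dt_repd(2)[OF uX(3) v] D.null_left[OF Dt_repd(1)[OF uX(3)] v parts(2)]
      A.null_left[OF X_L2[OF uX(3)] Yd_L2I[OF v] parts(1)]
    by (simp add: op_B_eq uX Yd_L2I v)
  have u_eq: "AE t in M. u t = u' t"
    using A_null_AE[OF X_L2[OF uX(3)] parts(1)] by (simp add: d_def)
  have B_eq: "op_B T j a u v = op_B T j a u' v" if v: "v \<in> Yd" for v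
    using Bd0[OF v] op_B_add[OF uX(3,2) Yd_L2I[OF v]] by (simp add: d_def)
  have tr_eq: "tr u 0 = tr u' 0"
    using trd trace_add[OF uX(3,2) zero_T(1)] by (simp add: d_def)
  have "A (\<mu> - \<mu>') v = 0" if v: "v \<in> Yd" for v
    using s B_eq[OF v] v mem by (simp add: D.diff_left) (metis add_right_cancel)
  then have "A (\<mu> - \<mu>') (\<mu> - \<mu>') = 0" using mem by simp
  then have "AE t in M. \<mu> t = \<mu>' t"
    using A_null_AE[OF Yd_L2I[OF D.mem(3)[OF mem(1,2)]]] by simp
  moreover have "\<sigma> = \<sigma>'"
  proof -
    have "(\<sigma> - \<sigma>') \<bullet> h = 0" if "h \<in> Hd" for h
      using s that tr_eq by (simp add: inner_diff_left) (metis add_right_cancel)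
    from this[OF subspace_diff[OF Hd(1) mem(3,4)]] show ?thesis by simp
  qed
  ultimately show ?thesis using u_eq by blast
qed

theorem galerkin_quasi_optimal:
  assumes g: "g \<in> dual_Y T a" and sol: "galerkin_solution T j a Yd Hd Xd g u0 \<mu> \<sigma> ud"
    and u: "parabolic_solution T j a g u0 u" and ub: "ub \<in> Xd"
  shows "mesh_norm T j a Yd (u - ud) \<le> 2 * norm_X T j a (u - ub)"
proof -
  obtain r where r: "r \<in> Yd" "\<And>v. v \<in> Yd \<Longrightarrow> g v = A r v" using dual_Y_riesz[OF g] by blast
  have udXd: "ud \<in> Xd" using sol by (simp add: galerkin_solution_def)
  have uX: "u \<in> X" and eq: "\<And>v h. v \<in> L2_space M \<Longrightarrow> op_B T j a u v + tr u 0 \<bullet> h = g v + u0 \<bullet> h"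
    using u by (auto simp: parabolic_solution_def space_X_eq space_Y_eq)
  have X: "ud \<in> X" "ub \<in> X" using udXd ub Xd_X by auto
  have Bu: "op_B T j a u v = g v" if "v \<in> L2_space M" for v using eq[OF that, of 0] by simp
  have tr0: "tr u 0 = u0"
    by (rule inner_eqI) (use eq[OF Y.mem(1)] Bu[OF Y.mem(1)] in simp)
  \<comment> \<open>Galerkin orthogonality\<close>
  have orth: "residual_form w (u - ud) = 0" if w: "w \<in> Xd" for w
  proof -
    have wX: "w \<in> X" using w Xd_X by auto
    have "op_B T j a w (Bd u) = op_B T j a u (Bd w)"
      using Bd(2)[OF wX Bd(1)[OF uX]] Bd(2)[OF uX Bd(1)[OF wX]] D.sym[OF Bd(1)[OF uX] Bd(1)[OF wX]] by simp
    also have "\<dots> = A r (Bd w)" using Bu[OF Yd_L2I[OF Bd(1)[OF wX]]] r(2)[OF Bd(1)[OF wX]] by simp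
    also have "\<dots> = op_B T j a w r" using Bd(2)[OF wX r(1)] D.sym[OF Bd(1)[OF wX] r(1)] by simp
    finally have "residual_form w u = residual_form w ud"
      using galerkin_residual[OF g sol r w] by (simp add: residual_form_def tr0)
    then show ?thesis using uX X wX by (simp add: E.diff_right)
  qed
  have dXd: "ub - ud \<in> Xd" and dXd': "ud - ub \<in> Xd"
    by (rule subspace_diff[OF subspace_Xd]; fact)+
  have "residual_form (ud - ub) (ud - ub) \<le> residual_form (u - ub) (u - ub)"
  proof (rule E.le_if_projection)
    have "residual_form (u - ub) (ud - ub) = residual_form ((u - ud) + (ud - ub)) (ud - ub)" by simp
    also have "\<dots> = residual_form (u - ud) (ud - ub) + residual_form (ud - ub) (ud - ub)"
      using uX X by (intro E.add_left) auto
    finally show "residual_form (ud - ub) (ud - ub) = residual_form (u - ub) (ud - ub)"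
      using orth[OF dXd'] E.sym[of "u - ud" "ud - ub"] uX X by simp
  qed (use uX X in auto)
  then have "E.nrm (ud - ub) \<le> E.nrm (u - ub)" by (simp add: E.nrm_def)
  then have "E.nrm (ub - ud) \<le> E.nrm (u - ub)" using E.nrm_minus[OF X(2,1)] by simp
  also have "\<dots> \<le> norm_X T j a (u - ub)" using uX X by (intro residual_le_norm_X) auto
  finally have e: "m.nrm (ub - ud) \<le> norm_X T j a (u - ub)" by (simp add: residual_nrm_eq_mesh[OF dXd])
  have "m.nrm (u - ud) \<le> m.nrm (u - ub) + m.nrm (ub - ud)" by (rule m.triangle_sub[OF uX X(2) X(1)])
  also have "\<dots> \<le> 2 * norm_X T j a (u - ub)"
    using e mesh_le_norm_X[of "u - ub"] uX X by simp
  finally show ?thesis using uX X by (simp add: mesh_norm_eq)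
qed

text \<open>
  Conversely, a solution of the reduced equation extends to a solution of the system.
\<close>

lemma galerkin_from_residual:
  assumes g: "g \<in> dual_Y T a" and r: "r \<in> Yd" "\<And>v. v \<in> Yd \<Longrightarrow> g v = A r v"
    and ud: "ud \<in> Xd" and eq: "\<And>w. w \<in> Xd \<Longrightarrow> op_B T j a w r + tr w 0 \<bullet> u0 = residual_form ud w"
  shows "\<exists>\<mu> \<sigma> u. galerkin_solution T j a Yd Hd Xd g u0 \<mu> \<sigma> u"
proof -
  have udX: "ud \<in> X" using ud Xd_X by auto
  obtain q where q: "q \<in> Hd" "\<And>h. h \<in> Hd \<Longrightarrow> u0 \<bullet> h = q \<bullet> h" using Hd_projection by blast
  have trH: "tr ud 0 \<in> Hd" using trHd ud by blast
  have "galerkin_solution T j a Yd Hd Xd g u0 (r - Bd ud) (q - tr ud 0) ud"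
    unfolding galerkin_iff[OF g]
  proof (intro conjI ballI ud)
    show "r - Bd ud \<in> Yd" using r(1) Bd(1)[OF udX] by simp
    show "q - tr ud 0 \<in> Hd" by (rule subspace_diff[OF Hd(1) q(1) trH])
    show "A (r - Bd ud) v + op_B T j a ud v = g v" if "v \<in> Yd" for v
      using that r Bd[OF udX] by (simp add: D.diff_left)
    show "(q - tr ud 0) \<bullet> h + tr ud 0 \<bullet> h = u0 \<bullet> h" if "h \<in> Hd" for h
      using q(2)[OF that] by (simp add: inner_diff_left)
    show "op_B T j a w (r - Bd ud) + tr w 0 \<bullet> (q - tr ud 0) = 0" if w: "w \<in> Xd" for w
    proof -
      have wX: "w \<in> X" using w Xd_X by auto
      have "op_B T j a w (r - Bd ud) = op_B T j a w r - op_B T j a w (Bd ud)"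
        using r(1) Bd(1)[OF udX] Bd[OF wX] by (simp add: D.diff_right)
      moreover have "tr w 0 \<bullet> q = tr w 0 \<bullet> u0" using q(2)[of "tr w 0"] trHd w by (simp add: inner_commute)
      ultimately show ?thesis
        using eq[OF w] E.sym[OF udX wX] by (simp add: residual_form_def inner_diff_right)
    qed
  qed
  then show ?thesis by blast
qed

lemma residual_functional_bound:
  assumes r: "r \<in> Yd" and w: "w \<in> X"
  shows "\<bar>op_B T j a w r + tr w 0 \<bullet> u0\<bar> \<le> (A.nrm r + norm u0) * E.nrm w"
proof -
  have E: "residual_form w w = A (Bd w) (Bd w) + (norm (tr w 0))\<^sup>2"
    using Bd(2)[OF w Bd(1)[OF w]] by (simp add: residual_form_def power2_norm_eq_inner)
  have 1: "A.nrm (Bd w) \<le> E.nrm w" unfolding A.nrm_def E.nrm_def E by simp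
  have "norm (tr w 0) = sqrt ((norm (tr w 0))\<^sup>2)" by simp
  also have "\<dots> \<le> E.nrm w" unfolding E.nrm_def E using D.nonneg[OF Bd(1)[OF w]] by (intro real_sqrt_le_mono) simp
  finally have 2: "norm (tr w 0) \<le> E.nrm w" .
  have "\<bar>op_B T j a w r\<bar> \<le> A.nrm (Bd w) * A.nrm r"
    using Bd(2)[OF w r] D.cauchy_schwarz[OF Bd(1)[OF w] r] by simp
  also have "\<dots> \<le> E.nrm w * A.nrm r" by (intro mult_right_mono 1 A.nrm_nonneg Yd_L2I r)
  finally have 3: "\<bar>op_B T j a w r\<bar> \<le> E.nrm w * A.nrm r" .
  have "\<bar>tr w 0 \<bullet> u0\<bar> \<le> norm (tr w 0) * norm u0" by (rule Cauchy_Schwarz_ineq2)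
  also have "\<dots> \<le> E.nrm w * norm u0" by (intro mult_right_mono 2) simp
  finally show ?thesis using 3 by (simp add: algebra_simps)
qed

text \<open>
  If the mesh-dependent norm bounds the norm of \<open>X\<close> on \<open>Xd\<close>, then \<open>Xd\<close> is complete for the form \<open>E\<close>,
  being closed in \<open>X\<close>.
\<close>

lemma residual_hilbert:
  assumes C: "\<And>w. w \<in> Xd \<Longrightarrow> norm_X T j a w \<le> C * mesh_norm T j a Yd w"
  shows "hilbert_form Xd residual_form"
proof -
  interpret Ed: psd_form Xd residual_form by (rule E.restrict[OF subspace_Xd Xd_X])
  obtain B where B: "0 \<le> B" "\<And>u. u \<in> X \<Longrightarrow> norm_X T j a u \<le> B * X.nrm u" "\<And>u. u \<in> X \<Longrightarrow> X.nrm u \<le> B * norm_X T j a u"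
    using norm_X_equiv by blast
  show ?thesis
  proof
    fix U :: "nat \<Rightarrow> real \<Rightarrow> 'v"
    assume U: "\<And>n. U n \<in> Xd" and Ca: "\<And>e. e > 0 \<Longrightarrow> \<exists>N. \<forall>m\<ge>N. \<forall>n\<ge>N. E.nrm (U m - U n) < e"
    have UX: "U n \<in> X" for n using U Xd_X by auto
    have Ud: "U m - U n \<in> Xd" for m n by (rule subspace_diff[OF subspace_Xd U U])
    define B' where "B' = B * \<bar>C\<bar> + 1"
    have B': "B' > 0" using B(1) by (simp add: B'_def add_nonneg_pos)
    have le: "X.nrm (U m - U n) \<le> B' * E.nrm (U m - U n)" for m n
    proof -
      have nn: "0 \<le> E.nrm (U m - U n)" using UX by simp
      have "X.nrm (U m - U n) \<le> B * norm_X T j a (U m - U n)" using UX by (intro B) auto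
      also have "\<dots> \<le> B * (C * E.nrm (U m - U n))"
        using C[OF Ud] UX by (intro mult_left_mono B) (simp add: mesh_norm_eq residual_nrm_eq_mesh[OF Ud])
      also have "\<dots> \<le> B * (\<bar>C\<bar> * E.nrm (U m - U n))"
        using nn B(1) by (intro mult_left_mono mult_right_mono) auto
      also have "\<dots> \<le> B' * E.nrm (U m - U n)" using nn by (simp add: B'_def algebra_simps)
      finally show ?thesis .
    qed
    have "\<exists>u\<in>X. (\<lambda>n. X.nrm (U n - u)) \<longlonglongrightarrow> 0"
    proof (rule X.complete[OF UX])
      fix e :: real assume "e > 0"
      then have "e / B' > 0" using B' by simp
      from Ca[OF this] obtain N where N: "\<And>m n. m \<ge> N \<Longrightarrow> n \<ge> N \<Longrightarrow> E.nrm (U m - U n) < e / B'" by blast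
      have "X.nrm (U m - U n) < e" if "m \<ge> N" "n \<ge> N" for m n
      proof -
        have "B' * E.nrm (U m - U n) < e" using N[OF that] B' by (simp add: pos_less_divide_eq mult.commute)
        then show ?thesis using le[of m n] by linarith
      qed
      then show "\<exists>N. \<forall>m\<ge>N. \<forall>n\<ge>N. X.nrm (U m - U n) < e" by blast
    qed
    then obtain u where u: "u \<in> X" "(\<lambda>n. X.nrm (U n - u)) \<longlonglongrightarrow> 0" by blast
    have lim: "(\<lambda>n. norm_X T j a (U n - u)) \<longlonglongrightarrow> 0"
    proof (rule real_tendsto_sandwich[OF _ _ tendsto_const tendsto_mult_right_zero[OF u(2)]])
      show "\<forall>\<^sub>F n in sequentially. 0 \<le> norm_X T j a (U n - u)"
        by (intro always_eventually allI norm_X_nonneg X_intros UX u)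
      show "\<forall>\<^sub>F n in sequentially. norm_X T j a (U n - u) \<le> B * X.nrm (U n - u)"
        by (intro always_eventually allI B X_intros UX u)
    qed
    have uXd: "u \<in> Xd" by (rule closed_subspace_ofD(3)[OF Xd U _ lim]) (simp add: space_X_eq u)
    have "(\<lambda>n. E.nrm (U n - u)) \<longlonglongrightarrow> 0"
    proof (rule real_tendsto_sandwich[OF _ _ tendsto_const lim])
      show "\<forall>\<^sub>F n in sequentially. 0 \<le> E.nrm (U n - u)"
        by (intro always_eventually allI E.nrm_nonneg X_intros UX u)
      show "\<forall>\<^sub>F n in sequentially. E.nrm (U n - u) \<le> norm_X T j a (U n - u)"
        by (intro always_eventually allI residual_le_norm_X X_intros UX u)
    qed
    with uXd show "\<exists>u\<in>Xd. (\<lambda>n. E.nrm (U n - u)) \<longlonglongrightarrow> 0" by blast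
  qed
qed

lemma residual_AE_null:
  assumes u: "u \<in> X" and ae: "AE t in M. u t = 0"
  shows "residual_form u u = 0"
proof -
  have "vderiv 0 0" using vderiv_Dt[OF X_intros(4)] vderiv_scale[OF vderiv_Dt[OF u], of 0] by simp
  then have "AE t in M. Dt u t = 0" using vderiv_unique[OF vderiv_Dt[OF u], of 0 0] ae by simp
  then have "graph_form u u = 0"
    using ae L2_null_iff[OF X_L2[OF u]] L2_null_iff[OF Dt_L2[OF u]] by (simp add: graph_form_def)
  moreover obtain C where "norm_X T j a u \<le> C * X.nrm u" using norm_X_equiv u by metis
  ultimately have "E.nrm u \<le> 0" using residual_le_norm_X[OF u] by (simp add: X.nrm_def)
  then show ?thesis using E.nonneg[OF u] by (simp add: E.nrm_def)
qed

theorem galerkin_exists: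
  assumes g: "g \<in> dual_Y T a"
    and Xd': "finite_dim_ae T Xd \<or> (\<exists>C. \<forall>w\<in>Xd. norm_X T j a w \<le> C * mesh_norm T j a Yd w)"
  shows "\<exists>\<mu> \<sigma> u. galerkin_solution T j a Yd Hd Xd g u0 \<mu> \<sigma> u"
proof -
  obtain r where r: "r \<in> Yd" "\<And>v. v \<in> Yd \<Longrightarrow> g v = A r v" using dual_Y_riesz[OF g] by blast
  define f where "f w = op_B T j a w r + tr w 0 \<bullet> u0" for w
  have rL: "r \<in> L2_space M" using r(1) by (rule Yd_L2I)
  have fadd: "f (u + w) = f u + f w" if "u \<in> X" "w \<in> X" for u w
    using that rL zero_T by (simp add: f_def op_B_add trace_add inner_add_left)
  have fscale: "f (c *\<^sub>R u) = c * f u" if "u \<in> X" for c u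
    using that rL zero_T by (simp add: f_def op_B_scale trace_scale algebra_simps)
  have fb: "\<bar>f w\<bar> \<le> (A.nrm r + norm u0) * E.nrm w" if "w \<in> X" for w
    unfolding f_def by (rule residual_functional_bound[OF r(1) that])
  have fnull: "f w = 0" if "w \<in> X" "residual_form w w = 0" for w
    using fb[OF that(1)] that(2) by (simp add: E.nrm_def)
  have "\<exists>ud\<in>Xd. \<forall>w\<in>Xd. f w = residual_form ud w"
    using Xd'
  proof
    assume "\<exists>C. \<forall>w\<in>Xd. norm_X T j a w \<le> C * mesh_norm T j a Yd w"
    then obtain C where "\<And>w. w \<in> Xd \<Longrightarrow> norm_X T j a w \<le> C * mesh_norm T j a Yd w" by blast
    then interpret Ed: hilbert_form Xd residual_form by (rule residual_hilbert)
    show ?thesis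
      by (rule Ed.riesz[of f "A.nrm r + norm u0"]) (use fadd fscale fb Xd_XI in auto)
  next
    assume "finite_dim_ae T Xd"
    then obtain F where F: "finite F" "F \<subseteq> Xd"
      "\<And>w. w \<in> Xd \<Longrightarrow> \<exists>c. AE t in M. w t = (\<Sum>f\<in>F. c f *\<^sub>R f t)"
      unfolding finite_dim_ae_def by blast
    have "\<exists>ud\<in>span F. \<forall>w\<in>span F. f w = residual_form ud w"
      by (rule E.riesz_span[OF F(1)]) (use F(2) Xd_X fadd fscale fnull in auto)
    then obtain ud where ud: "ud \<in> span F" "\<And>w. w \<in> span F \<Longrightarrow> f w = residual_form ud w" by blast
    have spX: "span F \<subseteq> Xd" by (rule span_minimal[OF F(2) subspace_Xd])
    have "f w = residual_form ud w" if w: "w \<in> Xd" for w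
    proof -
      obtain c where c: "AE t in M. w t = (\<Sum>f\<in>F. c f *\<^sub>R f t)" using F(3)[OF w] by blast
      define w' where "w' = (\<Sum>f\<in>F. c f *\<^sub>R f)"
      have w': "w' \<in> span F" unfolding w'_def by (intro span_sum span_scale span_base)
      have X: "w \<in> X" "w' \<in> X" "ud \<in> X" using w w' ud(1) spX Xd_X by auto
      define e where "e = w - w'"
      have eX: "e \<in> X" using X by (simp add: e_def)
      have "AE t in M. e t = 0" using c by eventually_elim (simp add: e_def w'_def sum_fun_apply)
      then have e0: "residual_form e e = 0" by (rule residual_AE_null[OF eX])
      have we: "w = w' + e" by (simp add: e_def)
      have "f w = f w'" unfolding we using fadd[OF X(2) eX] fnull[OF eX e0] by simp
      moreover have "residual_form ud w = residual_form ud w'"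
        unfolding we using E.add_right[OF X(2) eX X(3)] E.null_right[OF eX X(3) e0] by simp
      ultimately show ?thesis using ud(2)[OF w'] by simp
    qed
    then show ?thesis using ud(1) spX by blast
  qed
  then obtain ud where "ud \<in> Xd" "\<And>w. w \<in> Xd \<Longrightarrow> f w = residual_form ud w" by blast
  then show ?thesis by (intro galerkin_from_residual[OF g r]) (auto simp: f_def)
qed

end

theorem theorem3p5:
  fixes j :: "'v::{real_inner,banach,second_countable_topology}
              \<Rightarrow> 'h::{real_inner,banach,second_countable_topology}"
    and a :: "real \<Rightarrow> 'v \<Rightarrow> 'v \<Rightarrow> real" and T :: real
    and Yd Xd :: "(real \<Rightarrow> 'v) set" and Hd :: "'h set"
    and g :: "(real \<Rightarrow> 'v) \<Rightarrow> real" and u0 :: 'h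
  assumes "T > 0"
    and "gelfand_triple j"
    and "parabolic_form T a"
    and "\<forall>u\<in>space_Y T. \<forall>v\<in>space_Y T. op_A T a u v = op_As T a u v"
    and "closed_subspace_of (space_Y T) (norm_Y T a) Yd"
    and "subspace Hd" and "closed Hd"
    and "closed_subspace_of (space_X T j) (norm_X T j a) Xd"
    and "Xd \<subseteq> Yd"
    and "\<forall>w\<in>Xd. time_trace T j w 0 \<in> Hd"
    and "g \<in> dual_Y T a"
  shows "(finite_dim_ae T Xd \<or> (\<exists>C. \<forall>w\<in>Xd. norm_X T j a w \<le> C * mesh_norm T j a Yd w) \<longrightarrow>
      (\<exists>\<mu> \<sigma> ud. galerkin_solution T j a Yd Hd Xd g u0 \<mu> \<sigma> ud))
    \<and> (\<forall>\<mu> \<sigma> ud \<mu>' \<sigma>' ud'.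
        galerkin_solution T j a Yd Hd Xd g u0 \<mu> \<sigma> ud \<and>
        galerkin_solution T j a Yd Hd Xd g u0 \<mu>' \<sigma>' ud' \<longrightarrow>
        (AE t in time_measure T. \<mu> t = \<mu>' t) \<and> \<sigma> = \<sigma>' \<and> (AE t in time_measure T. ud t = ud' t))
    \<and> (\<forall>u \<mu> \<sigma> ud.
        parabolic_solution T j a g u0 u \<and> galerkin_solution T j a Yd Hd Xd g u0 \<mu> \<sigma> ud \<longrightarrow>
        mesh_norm T j a Yd (\<lambda>t. u t - ud t) \<le> 2 * (INF ub\<in>Xd. norm_X T j a (\<lambda>t. u t - ub t)))"
proof -
  interpret galerkin j T a Yd Xd Hd
    by unfold_locales (fact assms)+
  have "mesh_norm T j a Yd (\<lambda>t. u t - ud t) \<le> 2 * (INF ub\<in>Xd. norm_X T j a (\<lambda>t. u t - ub t))"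
    if u: "parabolic_solution T j a g u0 u" and sol: "galerkin_solution T j a Yd Hd Xd g u0 \<mu> \<sigma> ud"
    for u \<mu> \<sigma> ud
  proof -
    have "mesh_norm T j a Yd (u - ud) / 2 \<le> (INF ub\<in>Xd. norm_X T j a (u - ub))"
    proof (rule cINF_greatest)
      show "Xd \<noteq> {}" using subspace_0[OF subspace_Xd] by blast
      show "mesh_norm T j a Yd (u - ud) / 2 \<le> norm_X T j a (u - ub)" if "ub \<in> Xd" for ub
        using galerkin_quasi_optimal[OF assms(11) sol u that] by simp
    qed
    then show ?thesis by (simp add: fun_diff_def)
  qed
  then show ?thesis
    using galerkin_exists[OF assms(11)] galerkin_unique[OF assms(11)] by blast
qed

end
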